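(* Let $X$ be an infinite-dimensional real Banach lattice. Then $$2^{1/s(X)}=\lim_{n}\ \inf_{Y\subset X,\ \dim Y=n}\ \sup_{Z\subset Y}\lambda^+(Z)=\lim_{n}\ \inf_{Y\subset X,\ \dim Y=n}\ \sup_{Z\subset Y}\beta(Z),$$ where the supremum is taken over all sublattices $Z\subset Y$ with $\dim Z\ge2$ and the infimum over all $n$-dimensional sublattices $Y\subset X$. Similarly, $$2^{1/S(X)}=\lim_{n}\ \sup_{Y\subset X,\ \dim Y=n}\ \inf_{Z\subset Y}\alpha(Z),$$ where the infimum is taken over all sublattices $Z\subset Y$ with $\dim Z\ge 2$ and the supremum over all $n$-dimensional sublattices $Y\subset X$.
   Context: For a Banach lattice $X$, $S_X^+$ (respectively $B_X^+$) denotes the set of positive elements $x\in X$ ($x\ge 0$) with $\|x\|=1$ (respectively $\|x\|\le1$). Define $\lambda^+(X)=\inf\{\max\{\|x-y\|,\|x+y\|\} : x,y\in S_X^+\}$, $\alpha(X)=\sup\{\|x\vee y\| : x,y\in B_X^+\}$, and, for $\dim X\ge2$, $\beta(X)=\inf\{\|x\vee y\| : x,y\in S_X^+,\ x\wedge y=0\}$. For $1\le q\le\infty$, $X$ satisfies a lower (respectively upper) $q$-estimate with constant $M$ if $M\left\|\sum_{i=1}^n x_i\right\|\ge\left(\sum_{i=1}^n\|x_i\|^q\right)^{1/q}$ (respectively $\left\|\sum_{i=1}^n x_i\right\|\le M\left(\sum_{i=1}^n\|x_i\|^q\right)^{1/q}$) for every finite family of pairwise disjoint elements $x_1,\dots,x_n\in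 X$, with the usual maximum interpretation when $q=\infty$. $s(X)$ is the infimum of all $q\in[1,\infty]$ for which $X$ has a lower $q$-estimate with some constant, and $S(X)$ is the supremum of all $q\in[1,\infty]$ for which $X$ has an upper $q$-estimate with some constant. By convention $1/\infty=0$. The limits are taken as $n\to\infty$ over $n\ge2$. *)

theory Defs
  imports "HOL-Analysis.Analysis" "HOL-Library.Lattice_Algebras" "HOL-Library.Extended_Real"
begin

text \<open>Here \<open>\<bar>x\<bar>\<close> is the lattice modulus \<open>sup x (- x)\<close>.\<close>

class banach_lattice = banach + ordered_real_vector + lattice_ab_group_add_abs +
  assumes norm_mono_abs: "\<bar>x\<bar> \<le> \<bar>y\<bar> \<Longrightarrow> norm x \<le> norm y"

text \<open>
  The parameters of a Banach lattice are defined for a subset \<open>X\<close> of an ambient Banach lattice, so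
  that they apply both to the whole space (\<open>X = UNIV\<close>) and to its sublattices. A sublattice is a
  linear subspace closed under the lattice operations of the ambient space. Finite-dimensional
  sublattices are automatically closed.
\<close>

definition sublattice :: "'a::banach_lattice set \<Rightarrow> bool" where
  "sublattice X \<longleftrightarrow> subspace X \<and> (\<forall>x\<in>X. \<forall>y\<in>X. sup x y \<in> X \<and> inf x y \<in> X)"

definition pos_sphere :: "'a::banach_lattice set \<Rightarrow> 'a set" where
  "pos_sphere X = {x \<in> X. 0 \<le> x \<and> norm x = 1}"

definition pos_ball :: "'a::banach_lattice set \<Rightarrow> 'a set" where
  "pos_ball X = {x \<in> X. 0 \<le> x \<and> norm x \<le> 1}"

definition lambda_plus :: "'a::banach_lattice set \<Rightarrow> real" where
  "lambda_plus X = Inf {max (norm (x - y)) (norm (x + y)) | x y. x \<in> pos_sphere X \<and> y \<in> pos_sphere X}"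

definition alpha :: "'a::banach_lattice set \<Rightarrow> real" where
  "alpha X = Sup {norm (sup x y) | x y. x \<in> pos_ball X \<and> y \<in> pos_ball X}"

text \<open>Only meaningful for sublattices of dimension at least 2; otherwise the infimum is over \<open>{}\<close>.\<close>

definition beta :: "'a::banach_lattice set \<Rightarrow> real" where
  "beta X = Inf {norm (sup x y) | x y. x \<in> pos_sphere X \<and> y \<in> pos_sphere X \<and> inf x y = 0}"

definition pairwise_disjoint :: "nat \<Rightarrow> (nat \<Rightarrow> 'a::banach_lattice) \<Rightarrow> bool" where
  "pairwise_disjoint n x \<longleftrightarrow> (\<forall>i<n. \<forall>j<n. i \<noteq> j \<longrightarrow> inf \<bar>x i\<bar> \<bar>x j\<bar> = 0)"

text \<open>The \<open>\<ell>\<^sub>q\<close>-norm of \<open>(\<parallel>x 0\<parallel>, \<dots>, \<parallel>x (n - 1)\<parallel>)\<close>, for \<open>1 \<le> q \<le> \<infinity>\<close> and \<open>n \<ge> 1\<close>.\<close>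

definition lq_norms :: "ereal \<Rightarrow> nat \<Rightarrow> (nat \<Rightarrow> 'a::banach_lattice) \<Rightarrow> real" where
  "lq_norms q n x =
    (if q = \<infinity> then Max ((\<lambda>i. norm (x i)) ` {..<n})
     else (\<Sum>i<n. norm (x i) powr real_of_ereal q) powr (1 / real_of_ereal q))"

definition lower_estimate :: "'a::banach_lattice set \<Rightarrow> ereal \<Rightarrow> real \<Rightarrow> bool" where
  "lower_estimate X q M \<longleftrightarrow>
    (\<forall>n\<ge>1. \<forall>x. (\<forall>i<n. x i \<in> X) \<and> pairwise_disjoint n x \<longrightarrow>
      M * norm (\<Sum>i<n. x i) \<ge> lq_norms q n x)"

definition upper_estimate :: "'a::banach_lattice set \<Rightarrow> ereal \<Rightarrow> real \<Rightarrow> bool" where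
  "upper_estimate X q M \<longleftrightarrow>
    (\<forall>n\<ge>1. \<forall>x. (\<forall>i<n. x i \<in> X) \<and> pairwise_disjoint n x \<longrightarrow>
      norm (\<Sum>i<n. x i) \<le> M * lq_norms q n x)"

definition lower_index :: "'a::banach_lattice set \<Rightarrow> ereal" where
  "lower_index X = Inf {q. 1 \<le> q \<and> (\<exists>M. lower_estimate X q M)}"

definition upper_index :: "'a::banach_lattice set \<Rightarrow> ereal" where
  "upper_index X = Sup {q. 1 \<le> q \<and> (\<exists>M. upper_estimate X q M)}"

end

theory Submission
  imports Defs "HOL-Library.Ramsey"
begin

text \<open>
  Write \<open>\<kappa>\<close> for \<open>1/s(X)\<close> or \<open>1/S(X)\<close>. A finite-dimensional sublattice is spanned by disjoint positive
  vectors, and for disjoint \<open>x\<close> and \<open>y\<close> the supremum is \<open>x + y\<close>. So the theorem compares the norm of a sum of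
  two positive unit vectors with \<open>2 powr \<kappa>\<close>. Each limit has an easy half and a hard half;
  since \<open>lambda_plus\<close> is at most \<open>beta\<close>, the lower bound for \<open>lambda_plus\<close> and the upper bound for \<open>beta\<close> serve both.

  For the easy half, take a lower \<open>q\<close>-estimate with \<open>q\<close> close to \<open>s(X)\<close>. If each disjoint pair in a sublattice of
  dimension \<open>2^k\<close> violated the estimate with a constant just worse than \<open>1\<close>, the violations would multiply along
  a binary tree with \<open>2^k\<close> leaves and exceed every constant. So there is a disjoint pair that satisfies the estimate
  with constant almost \<open>1\<close> (\<open>ex_pair_lower_estimate\<close>), and a convexity argument extends it from disjoint
  to arbitrary positive vectors of the plane spanned by the pair (\<open>lambda_plus_pair_ge\<close>). The tree argument
  applies to upper estimates as well, and there \<open>alpha\<close> of the plane is at most the norm of the sum of the pair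
  (\<open>ex_pair_upper_estimate\<close>, \<open>alpha_pair_le\<close>).

  For the hard half one needs sublattices of each dimension in which every disjoint pair of unit vectors
  has a sum of norm about \<open>2 powr \<kappa>\<close>. This is a local form of Krivine's theorem. An exponent strictly beyond the
  index admits no estimate. A violating family of least cardinality
  then obeys the opposite inequality on all its subfamilies (\<open>minimal_violating_family\<close>). Together with
  the estimates on the other side of the index this yields long families of unit vectors in which any
  \<open>N\<close> members have a sum of norm \<open>N powr \<kappa>\<close>, up to an arbitrarily small error in the exponent
  (\<open>lower_exponent_families\<close>, \<open>upper_exponent_families\<close>).

  To sharpen this to almost exact equality, superpose rescaled sums of \<open>\<Prod>m m ^ a\<^sub>m\<close> equidistant members for all exponent
  vectors \<open>a\<close> in a large box, with weights that decay slowly away from its centre. Replacing such a layered vector by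
  \<open>m\<close> copies of itself only shifts the layers, hence has nearly the same effect as multiplication by \<open>m powr \<kappa>\<close>
  (\<open>layers_eigenvector\<close>). By Ramsey's theorem the norm of a pattern may be assumed not to depend
  on its position. Consequently \<open>n\<close> layered vectors \<open>v\<^sub>j\<close> in consecutive segments satisfy
  \<open>norm (\<Sum>j. (m\<^sub>j powr \<kappa>) v\<^sub>j) \<approx> (\<Sum>j. m\<^sub>j) powr \<kappa>\<close> after normalization (\<open>ex_power_blocks\<close>), and by approximation of
  real coefficients their span is a sublattice as required (\<open>ex_power_family\<close>).
\<close>

section \<open>Disjoint positive families\<close>

context
  fixes x y :: "'a::banach_lattice"
begin

lemma norm_mono_pos: "0 \<le> x \<Longrightarrow> x \<le> y \<Longrightarrow> norm x \<le> norm y"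
  by (rule norm_mono_abs) simp

lemma norm_abs_lattice: "norm \<bar>x\<bar> = norm x"
  by (rule antisym; rule norm_mono_abs) simp_all

lemma norm_le_of_abs_le: "\<bar>x\<bar> \<le> y \<Longrightarrow> norm x \<le> norm y"
  by (rule norm_mono_abs) (meson abs_ge_self order_trans)

lemma sup_eq_add_of_disjoint: "inf x y = 0 \<Longrightarrow> sup x y = x + y"
  using add_eq_inf_sup[of x y] by simp

end

text \<open>If \<open>w\<close> lies below \<open>x\<close> and \<open>y + z\<close>, then \<open>w - y\<close> lies below \<open>x\<close> and \<open>z\<close>, hence below their infimum \<open>0\<close>;
  so \<open>w\<close> lies below \<open>x\<close> and \<open>y\<close>.\<close>

lemma disjoint_add:
  fixes x y z :: "'a::banach_lattice"
  assumes "0 \<le> x" "0 \<le> y" "0 \<le> z" "inf x y = 0" "inf x z = 0"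
  shows "inf x (y + z) = 0"
proof -
  define w where "w = inf x (y + z)"
  have w: "w \<le> x" "w \<le> y + z" "0 \<le> w"
    using assms by (auto simp: w_def)
  have "w - y \<le> x" using w(1) assms(2) by (simp add: diff_le_eq add_increasing2)
  moreover have "w - y \<le> z" using w(2) by (simp add: diff_le_eq add.commute)
  ultimately have "w - y \<le> inf x z" by simp
  then have "w \<le> y" using assms by simp
  then have "w \<le> inf x y" using w by simp
  then have "w \<le> 0" using assms by simp
  then show ?thesis using w(3) unfolding w_def by (rule antisym)
qed

lemma disjoint_scaleR:
  fixes x y :: "'a::banach_lattice"
  assumes "0 \<le> x" "0 \<le> y" "inf x y = 0" "0 \<le> c" "0 \<le> d"
  shows "inf (c *\<^sub>R x) (d *\<^sub>R y) = 0"
proof -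
  define C where "C = 1 + max c d"
  have C: "0 < C" "c \<le> C" "d \<le> C" using assms(4) by (auto simp: C_def)
  define w where "w = inf (c *\<^sub>R x) (d *\<^sub>R y)"
  have w0: "0 \<le> w" using assms by (simp add: w_def scaleR_nonneg_nonneg)
  have "w \<le> C *\<^sub>R x" "w \<le> C *\<^sub>R y"
    using C assms(1,2) by (auto simp: w_def intro: le_infI1 le_infI2 scaleR_right_mono)
  then have "(1 / C) *\<^sub>R w \<le> (1 / C) *\<^sub>R (C *\<^sub>R x)" "(1 / C) *\<^sub>R w \<le> (1 / C) *\<^sub>R (C *\<^sub>R y)"
    using C by (meson scaleR_left_mono less_imp_le zero_less_divide_1_iff)+
  then have "(1 / C) *\<^sub>R w \<le> inf x y" using C by simp
  then have "C *\<^sub>R ((1 / C) *\<^sub>R w) \<le> C *\<^sub>R 0" using C assms by (intro scaleR_left_mono) auto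
  then have "w \<le> 0" using C by simp
  then show ?thesis using w0 unfolding w_def by (rule antisym)
qed

lemma disjoint_mono:
  fixes x y u v :: "'a::banach_lattice"
  assumes "inf x y = 0" "0 \<le> u" "u \<le> x" "0 \<le> v" "v \<le> y"
  shows "inf u v = 0"
  using inf_mono[OF assms(3,5)] assms by (intro antisym) auto

definition disjoint_pos :: "'i set \<Rightarrow> ('i \<Rightarrow> 'a::banach_lattice) \<Rightarrow> bool" where
  "disjoint_pos I x \<longleftrightarrow> (\<forall>i\<in>I. 0 \<le> x i) \<and> (\<forall>i\<in>I. \<forall>j\<in>I. i \<noteq> j \<longrightarrow> inf (x i) (x j) = 0)"

lemma disjoint_posD:
  "disjoint_pos I x \<Longrightarrow> i \<in> I \<Longrightarrow> 0 \<le> x i"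
  "disjoint_pos I x \<Longrightarrow> i \<in> I \<Longrightarrow> j \<in> I \<Longrightarrow> i \<noteq> j \<Longrightarrow> inf (x i) (x j) = 0"
  unfolding disjoint_pos_def by blast+

lemma disjoint_pos_subset: "disjoint_pos I x \<Longrightarrow> J \<subseteq> I \<Longrightarrow> disjoint_pos J x"
  by (simp add: disjoint_pos_def subset_eq)

lemma disjoint_pos_compose:
  "disjoint_pos I x \<Longrightarrow> f ` J \<subseteq> I \<Longrightarrow> inj_on f J \<Longrightarrow> disjoint_pos J (\<lambda>j. x (f j))"
  unfolding disjoint_pos_def inj_on_def image_subset_iff by metis

lemma disjoint_pos_scale:
  "disjoint_pos I x \<Longrightarrow> (\<And>i. i \<in> I \<Longrightarrow> 0 \<le> c i) \<Longrightarrow> disjoint_pos I (\<lambda>i. c i *\<^sub>R x i)"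
  unfolding disjoint_pos_def by (meson scaleR_nonneg_nonneg disjoint_scaleR)

lemma disjoint_sum:
  fixes y :: "'a::banach_lattice"
  assumes "finite A" "0 \<le> y" "\<And>i. i \<in> A \<Longrightarrow> 0 \<le> x i" "\<And>i. i \<in> A \<Longrightarrow> inf y (x i) = 0"
  shows "inf y (\<Sum>i\<in>A. x i) = 0"
  using assms by (induction A rule: finite_induct) (auto intro!: disjoint_add sum_nonneg simp: inf.absorb2)

lemma disjoint_pos_sums:
  assumes "disjoint_pos I x" "A \<subseteq> I" "B \<subseteq> I" "A \<inter> B = {}" "finite A" "finite B"
  shows "inf (\<Sum>i\<in>A. x i) (\<Sum>i\<in>B. x i) = 0"
proof (rule disjoint_sum)
  fix j assume j: "j \<in> B"
  have "inf (x j) (x i) = 0" if "i \<in> A" for i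
    using assms(2-4) j that by (intro disjoint_posD(2)[OF assms(1)]) auto
  then have "inf (x j) (\<Sum>i\<in>A. x i) = 0"
    using assms j by (intro disjoint_sum) (auto simp: disjoint_pos_def)
  then show "inf (\<Sum>i\<in>A. x i) (x j) = 0" by (simp add: inf_commute)
qed (use assms in \<open>auto simp: disjoint_pos_def intro!: sum_nonneg\<close>)

lemma disjoint_pos_lincombs:
  assumes x: "disjoint_pos I x" and I: "finite I"
    and b: "\<And>i. i \<in> I \<Longrightarrow> 0 \<le> b i" and c: "\<And>i. i \<in> I \<Longrightarrow> 0 \<le> c i"
    and bc: "\<And>i. i \<in> I \<Longrightarrow> b i = 0 \<or> c i = 0"
  shows "inf (\<Sum>i\<in>I. b i *\<^sub>R x i) (\<Sum>i\<in>I. c i *\<^sub>R x i) = 0"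
proof -
  let ?B = "{i\<in>I. c i = 0}" and ?C = "{i\<in>I. c i \<noteq> 0}"
  have d: "disjoint_pos I (\<lambda>i. (b i + c i) *\<^sub>R x i)"
    using x b c by (intro disjoint_pos_scale) auto
  have "(\<Sum>i\<in>I. b i *\<^sub>R x i) = (\<Sum>i\<in>?B. (b i + c i) *\<^sub>R x i)"
    using I bc by (intro sum.mono_neutral_cong_right) auto
  moreover have "(\<Sum>i\<in>I. c i *\<^sub>R x i) = (\<Sum>i\<in>?C. (b i + c i) *\<^sub>R x i)"
    using I bc by (intro sum.mono_neutral_cong_right) auto
  ultimately show ?thesis using disjoint_pos_sums[OF d, of ?B ?C] I by auto
qed

lemma lincomb_nonneg:
  assumes "disjoint_pos I x" "\<And>i. i \<in> I \<Longrightarrow> 0 \<le> b i"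
  shows "0 \<le> (\<Sum>i\<in>I. b i *\<^sub>R x i)"
  using assms by (auto simp: disjoint_pos_def intro!: sum_nonneg scaleR_nonneg_nonneg)

lemma lincomb_mono:
  assumes "disjoint_pos I x" "\<And>i. i \<in> I \<Longrightarrow> b i \<le> c i"
  shows "(\<Sum>i\<in>I. b i *\<^sub>R x i) \<le> (\<Sum>i\<in>I. c i *\<^sub>R x i)"
  using assms by (auto simp: disjoint_pos_def intro!: sum_mono scaleR_right_mono)

lemma norm_lincomb_mono:
  assumes "disjoint_pos I x" "\<And>i. i \<in> I \<Longrightarrow> 0 \<le> b i" "\<And>i. i \<in> I \<Longrightarrow> b i \<le> c i"
  shows "norm (\<Sum>i\<in>I. b i *\<^sub>R x i) \<le> norm (\<Sum>i\<in>I. c i *\<^sub>R x i)"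
  using assms by (intro norm_mono_pos lincomb_nonneg lincomb_mono)

lemma term_le_lincomb:
  assumes "disjoint_pos I x" "finite I" "\<And>i. i \<in> I \<Longrightarrow> 0 \<le> b i" "j \<in> I"
  shows "b j *\<^sub>R x j \<le> (\<Sum>i\<in>I. b i *\<^sub>R x i)"
proof -
  have "0 \<le> (\<Sum>i\<in>I - {j}. b i *\<^sub>R x i)"
    using assms by (auto simp: disjoint_pos_def intro!: sum_nonneg scaleR_nonneg_nonneg)
  then show ?thesis using assms by (simp add: sum.remove[of I j])
qed

lemma norm_term_le_lincomb:
  assumes "disjoint_pos I x" "finite I" "\<And>i. i \<in> I \<Longrightarrow> 0 \<le> b i" "j \<in> I"
  shows "b j * norm (x j) \<le> norm (\<Sum>i\<in>I. b i *\<^sub>R x i)"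
  using norm_mono_pos[OF _ term_le_lincomb[OF assms]] assms
  by (auto simp: disjoint_pos_def scaleR_nonneg_nonneg)

text \<open>Disjointness makes the span of the family a copy of \<open>\<real>\<^sup>I\<close> with coordinatewise order: after
  subtracting \<open>b\<close> and \<open>c\<close> from their coordinatewise maximum, the two remainders are disjoint.\<close>

lemma sup_lincomb:
  assumes x: "disjoint_pos I x" and I: "finite I"
  shows "sup (\<Sum>i\<in>I. b i *\<^sub>R x i) (\<Sum>i\<in>I. c i *\<^sub>R x i) = (\<Sum>i\<in>I. max (b i) (c i) *\<^sub>R x i)"
proof -
  let ?S = "\<lambda>b. \<Sum>i\<in>I. b i *\<^sub>R x i"
  let ?d = "\<lambda>i. max (b i) (c i)"
  have "inf (?S (\<lambda>i. ?d i - b i)) (?S (\<lambda>i. ?d i - c i)) = 0"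
    by (rule disjoint_pos_lincombs[OF x I]) auto
  moreover have "?S (\<lambda>i. ?d i - b i) = ?S ?d - ?S b" "?S (\<lambda>i. ?d i - c i) = ?S ?d - ?S c"
    by (simp_all add: scaleR_diff_left sum_subtractf)
  ultimately have "inf (?S ?d + - ?S b) (?S ?d + - ?S c) = 0" by (simp only: diff_conv_add_uminus)
  then have "?S ?d + inf (- ?S b) (- ?S c) = 0"
    by (simp only: add_inf_distrib_left)
  then have "?S ?d - sup (?S b) (?S c) = 0" by (simp only: neg_sup_eq_inf[symmetric] diff_conv_add_uminus)
  then show ?thesis by (simp only: right_minus_eq)
qed

lemma inf_lincomb:
  assumes x: "disjoint_pos I x" and I: "finite I"
  shows "inf (\<Sum>i\<in>I. b i *\<^sub>R x i) (\<Sum>i\<in>I. c i *\<^sub>R x i) = (\<Sum>i\<in>I. min (b i) (c i) *\<^sub>R x i)"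
proof -
  let ?S = "\<lambda>b. \<Sum>i\<in>I. b i *\<^sub>R x i"
  have "?S b + ?S c = ?S (\<lambda>i. max (b i) (c i)) + ?S (\<lambda>i. min (b i) (c i))"
    unfolding sum.distrib[symmetric] scaleR_add_left[symmetric]
    by (intro sum.cong refl) (auto simp: max_def min_def add.commute)
  then have "?S (\<lambda>i. max (b i) (c i)) + inf (?S b) (?S c) = ?S (\<lambda>i. max (b i) (c i)) + ?S (\<lambda>i. min (b i) (c i))"
    using add_eq_inf_sup[of "?S b" "?S c"] by (simp only: sup_lincomb[OF x I])
  then show ?thesis by (simp only: add_left_cancel)
qed

lemma lincomb_eq_0D:
  assumes x: "disjoint_pos I x" and I: "finite I" and 0: "(\<Sum>i\<in>I. b i *\<^sub>R x i) = 0"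
    and i: "i \<in> I" "x i \<noteq> 0"
  shows "b i = 0"
proof -
  let ?S = "\<lambda>b. \<Sum>i\<in>I. b i *\<^sub>R x i"
  \<comment> \<open>the modulus of the combination has the moduli of the coefficients\<close>
  have "?S (\<lambda>i. \<bar>b i\<bar>) = sup (?S b) (?S (\<lambda>i. - b i))"
    unfolding sup_lincomb[OF x I] by (auto intro!: sum.cong simp: abs_real_def max_def)
  also have "\<dots> = 0" using 0 by (simp add: sum_negf)
  finally have "\<bar>b i\<bar> *\<^sub>R x i \<le> 0"
    using term_le_lincomb[OF x I, of "\<lambda>i. \<bar>b i\<bar>" i] i by simp
  moreover have "0 \<le> \<bar>b i\<bar> *\<^sub>R x i" using x i by (simp add: disjoint_pos_def scaleR_nonneg_nonneg)
  ultimately show ?thesis using i by (simp add: antisym)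
qed

lemma lincomb_nonnegD:
  assumes x: "disjoint_pos I x" and I: "finite I" and 0: "0 \<le> (\<Sum>i\<in>I. b i *\<^sub>R x i)"
    and i: "i \<in> I" "x i \<noteq> 0"
  shows "0 \<le> b i"
proof -
  have "(\<Sum>i\<in>I. (max (b i) 0 - b i) *\<^sub>R x i) = 0"
    using sup_lincomb[OF x I, of b "\<lambda>_. 0"] 0
    by (simp add: scaleR_diff_left sum_subtractf sup_absorb1)
  from lincomb_eq_0D[OF x I this i] show ?thesis by (simp add: max_def split: if_splits)
qed

lemma disjoint_pos_inj:
  assumes "disjoint_pos I x" "\<And>i. i \<in> I \<Longrightarrow> x i \<noteq> 0"
  shows "inj_on x I"
  using assms unfolding inj_on_def disjoint_pos_def by (metis inf.idem)

lemma span_disjoint_pos: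
  assumes x: "disjoint_pos I x" and I: "finite I"
  shows "span (x ` I) = range (\<lambda>b. \<Sum>i\<in>I. b i *\<^sub>R x i)" (is "_ = ?R")
proof
  have "subspace ?R"
  proof (rule subspaceI)
    show "0 \<in> ?R" by (rule image_eqI[of _ _ "\<lambda>_. 0"]) auto
  next
    fix u v assume "u \<in> ?R" "v \<in> ?R"
    then obtain b c where "u = (\<Sum>i\<in>I. b i *\<^sub>R x i)" "v = (\<Sum>i\<in>I. c i *\<^sub>R x i)" by auto
    then show "u + v \<in> ?R"
      by (intro image_eqI[of _ _ "\<lambda>i. b i + c i"]) (auto simp: scaleR_add_left sum.distrib)
  next
    fix t u assume "u \<in> ?R"
    then obtain b where "u = (\<Sum>i\<in>I. b i *\<^sub>R x i)" by auto
    then show "t *\<^sub>R u \<in> ?R"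
      by (intro image_eqI[of _ _ "\<lambda>i. t * b i"]) (auto simp: scaleR_sum_right)
  qed
  moreover have "x ` I \<subseteq> ?R"
  proof
    fix u assume "u \<in> x ` I"
    then obtain i where i: "i \<in> I" "u = x i" by auto
    then show "u \<in> ?R"
      using I by (intro image_eqI[of _ _ "\<lambda>j. of_bool (i = j)"])
        (auto simp: of_bool_def if_distrib[of "\<lambda>t. t *\<^sub>R _"] cong: if_cong)
  qed
  ultimately show "span (x ` I) \<subseteq> ?R" by (rule span_minimal[rotated])
  show "?R \<subseteq> span (x ` I)" by (auto intro!: span_sum intro: span_scale span_base)
qed

lemma sublattice_span:
  assumes x: "disjoint_pos I x" and I: "finite I"
  shows "sublattice (span (x ` I))"
  unfolding sublattice_def
proof (intro conjI ballI)
  fix u v assume "u \<in> span (x ` I)" "v \<in> span (x ` I)"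
  then obtain b c where "u = (\<Sum>i\<in>I. b i *\<^sub>R x i)" "v = (\<Sum>i\<in>I. c i *\<^sub>R x i)"
    unfolding span_disjoint_pos[OF assms] by blast
  then show "sup u v \<in> span (x ` I)" "inf u v \<in> span (x ` I)"
    by (auto simp: sup_lincomb[OF assms] inf_lincomb[OF assms] intro!: span_sum intro: span_scale span_base)
qed (rule subspace_span)

lemma independent_disjoint_pos:
  assumes x: "disjoint_pos I x" and I: "finite I" and nz: "\<And>i. i \<in> I \<Longrightarrow> x i \<noteq> 0"
  shows "independent (x ` I)"
proof (rule independent_if_scalars_zero)
  have inj: "inj_on x I" using x nz by (rule disjoint_pos_inj)
  fix f v assume "(\<Sum>v\<in>x ` I. f v *\<^sub>R v) = 0" "v \<in> x ` I"
  then obtain i where "(\<Sum>i\<in>I. f (x i) *\<^sub>R x i) = 0" "i \<in> I" "v = x i"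
    by (auto simp: sum.reindex[OF inj])
  with lincomb_eq_0D[OF x I, of "\<lambda>i. f (x i)" i] nz show "f v = 0" by auto
qed (use I in auto)

lemma dim_span_disjoint_pos:
  assumes "disjoint_pos I x" "finite I" "\<And>i. i \<in> I \<Longrightarrow> x i \<noteq> 0"
  shows "dim (span (x ` I)) = card I"
  using dim_eq_card_independent[OF independent_disjoint_pos[OF assms]]
    disjoint_pos_inj[OF assms(1,3)] by (simp add: dim_span card_image)

section \<open>Finite-dimensional sublattices\<close>

text \<open>The order is Archimedean, because the norm of the positive part of \<open>u\<close> is at most every positive
  multiple of the norm of \<open>y\<close>.\<close>

lemma le_0_of_le_small_multiples:
  fixes u y :: "'a::banach_lattice"
  assumes "\<And>e. e > 0 \<Longrightarrow> u \<le> e *\<^sub>R y" and y: "0 \<le> y"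
  shows "u \<le> 0"
proof -
  have "norm (sup u 0) \<le> e * norm y" if "e > 0" for e
  proof -
    have "norm (sup u 0) \<le> norm (e *\<^sub>R y)"
      using assms(1)[OF that] that y by (intro norm_mono_pos) (auto simp: scaleR_nonneg_nonneg)
    then show ?thesis using that by simp
  qed
  note le = this
  have "norm (sup u 0) \<le> 0 + e" if "e > 0" for e
  proof -
    have "norm (sup u 0) \<le> e / (norm y + 1) * norm y"
      using that by (intro le) (simp add: add_nonneg_pos)
    also have "\<dots> = e * (norm y / (norm y + 1))" by simp
    also have "\<dots> \<le> e * 1" using that by (intro mult_left_mono) (auto simp: divide_simps add_nonneg_pos)
    finally show ?thesis by simp
  qed
  then have "norm (sup u 0) \<le> 0" by (rule field_le_epsilon)
  then have "sup u 0 = 0" by simp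
  then show ?thesis by (metis sup.cobounded1)
qed

lemma inf_positive_negative_part:
  fixes d :: "'a::banach_lattice"
  shows "inf (sup d 0) (sup (- d) 0) = 0"
proof -
  have p: "sup d 0 = sup (- d) 0 + d"
    using add_sup_distrib_right[of "- d" 0 d] by (simp add: sup_commute)
  have "inf (sup d 0) (sup (- d) 0) = sup (- d) 0 + inf d 0"
    unfolding p using add_inf_distrib_left[of "sup (- d) 0" d 0] by simp
  also have "inf d 0 = - sup (- d) 0" using inf_eq_neg_sup[of d 0] by simp
  finally show ?thesis by (metis add.right_inverse)
qed

text \<open>A disjoint set \<open>D\<close> of largest possible cardinality in a sublattice spans it. Its elements are atoms:
  the vectors of the sublattice between \<open>0\<close> and a multiple of \<open>y \<in> D\<close> are multiples of \<open>y\<close>, since otherwise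
  \<open>y\<close> could be replaced by two disjoint vectors. Splitting off the components along all atoms from a
  positive vector leaves a remainder that is disjoint from \<open>D\<close>, hence zero.\<close>

context
  fixes Y D :: "'a::banach_lattice set"
  assumes Y: "sublattice Y"
    and D: "finite D" "D \<subseteq> Y" "disjoint_pos D (\<lambda>v. v)" "0 \<notin> D"
    and maximal: "\<And>E. finite E \<Longrightarrow> E \<subseteq> Y \<Longrightarrow> disjoint_pos E (\<lambda>v. v) \<Longrightarrow> 0 \<notin> E \<Longrightarrow> card E \<le> card D"
begin

lemma sub_closed:
  "u \<in> Y \<Longrightarrow> v \<in> Y \<Longrightarrow> u + v \<in> Y" "u \<in> Y \<Longrightarrow> v \<in> Y \<Longrightarrow> u - v \<in> Y" "u \<in> Y \<Longrightarrow> t *\<^sub>R u \<in> Y"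
  "u \<in> Y \<Longrightarrow> - u \<in> Y" "0 \<in> Y" "u \<in> Y \<Longrightarrow> v \<in> Y \<Longrightarrow> sup u v \<in> Y" "u \<in> Y \<Longrightarrow> v \<in> Y \<Longrightarrow> inf u v \<in> Y"
  using Y by (auto simp: sublattice_def subspace_add subspace_diff subspace_scale subspace_neg subspace_0)

text \<open>If \<open>w - t y\<close> had nonzero positive and negative parts, these two disjoint vectors could replace
  \<open>y\<close> in \<open>D\<close>.\<close>

lemma maximal_dichotomy:
  assumes y: "y \<in> D" and w: "w \<in> Y" "0 \<le> w" "w \<le> c *\<^sub>R y" and c: "0 \<le> c" and t: "0 \<le> t"
  shows "w \<le> t *\<^sub>R y \<or> t *\<^sub>R y \<le> w"
proof (rule ccontr)
  assume neg: "\<not> ?thesis"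
  define d where "d = w - t *\<^sub>R y"
  define p m where "p = sup d 0" and "m = sup (- d) 0"
  have y0: "0 \<le> y" "y \<in> Y" using y D by (auto simp: disjoint_pos_def)
  have pm: "inf p m = 0" unfolding p_def m_def by (rule inf_positive_negative_part)
  have nz: "p \<noteq> 0" "m \<noteq> 0" using neg by (auto simp: p_def m_def d_def sup.absorb_iff2[symmetric])
  have pos: "0 \<le> p" "0 \<le> m" by (auto simp: p_def m_def)
  have ty: "0 \<le> t *\<^sub>R y" "0 \<le> c *\<^sub>R y" using t c y0 by (auto intro: scaleR_nonneg_nonneg)
  have "d \<le> w" using ty by (simp add: d_def)
  then have "p \<le> c *\<^sub>R y" using w ty by (auto simp: p_def)
  moreover have "- d \<le> t *\<^sub>R y" using w(2) by (simp add: d_def)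
  then have "m \<le> t *\<^sub>R y" using ty by (auto simp: m_def)
  moreover have "inf (c *\<^sub>R y) z = 0" "inf (t *\<^sub>R y) z = 0" if "z \<in> D - {y}" for z
  proof -
    have "0 \<le> z" "inf y z = 0" using disjoint_posD(1)[OF D(3), of z] disjoint_posD(2)[OF D(3), of y z] that y by auto
    then show "inf (c *\<^sub>R y) z = 0" "inf (t *\<^sub>R y) z = 0"
      using disjoint_scaleR[of y z c 1] disjoint_scaleR[of y z t 1] y0 c t by auto
  qed
  ultimately have orth: "inf p z = 0 \<and> inf m z = 0" if "z \<in> D - {y}" for z
    using that pos D(3) by (auto simp: disjoint_pos_def intro: disjoint_mono[of "c *\<^sub>R y" z] disjoint_mono[of "t *\<^sub>R y" z])
  let ?E = "insert p (insert m (D - {y}))"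
  have "p \<noteq> m" using pm nz by auto
  moreover have "p \<notin> D - {y}" "m \<notin> D - {y}" using orth nz inf.idem by metis+
  ultimately have "card ?E = card D + 1"
    using D(1) card.remove[OF D(1) y] by (simp del: card_Diff_singleton card_Diff_singleton_if)
  moreover have "card ?E \<le> card D"
  proof (rule maximal)
    show "?E \<subseteq> Y" using D(2) w(1) y0 by (auto simp: p_def m_def d_def intro!: sub_closed)
    show "disjoint_pos ?E (\<lambda>v. v)"
      using D(3) orth pos pm by (auto simp: disjoint_pos_def inf_commute)
    show "0 \<notin> ?E" using nz D(4) by auto
  qed (use D in auto)
  ultimately show False by simp
qed

text \<open>By the dichotomy the multiples of \<open>y\<close> below \<open>w\<close> and those above \<open>w\<close> form a cut, and the Archimedean
  property identifies \<open>w\<close> with the multiple of \<open>y\<close> at the cut.\<close>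

lemma maximal_atom:
  assumes y: "y \<in> D" and w: "w \<in> Y" "0 \<le> w" "w \<le> c *\<^sub>R y" and c: "0 \<le> c"
  shows "\<exists>t\<ge>0. w = t *\<^sub>R y"
proof -
  have y0: "0 \<le> y" "y \<noteq> 0" using y D by (auto simp: disjoint_pos_def)
  define T where "T = {t. 0 \<le> t \<and> t *\<^sub>R y \<le> w}"
  have T: "0 \<in> T" using w by (simp add: T_def)
  have "t \<le> norm w / norm y" if "t \<in> T" for t
    using norm_mono_pos[of "t *\<^sub>R y" w] that y0
    by (simp add: T_def scaleR_nonneg_nonneg pos_le_divide_eq)
  then have bdd: "bdd_above T" by (rule bdd_aboveI)
  have s0: "0 \<le> Sup T" using T bdd by (rule cSup_upper)
  have "Sup T *\<^sub>R y - w \<le> 0"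
  proof (rule le_0_of_le_small_multiples[OF _ y0(1)])
    fix e :: real assume e: "e > 0"
    then obtain t where t: "t \<in> T" "Sup T - e < t"
      using less_cSup_iff[of T "Sup T - e"] T bdd by auto
    have "Sup T *\<^sub>R y \<le> (e + t) *\<^sub>R y" using t y0 by (intro scaleR_right_mono) auto
    also have "\<dots> \<le> e *\<^sub>R y + w" using t by (simp add: T_def scaleR_add_left)
    finally show "Sup T *\<^sub>R y - w \<le> e *\<^sub>R y" by (simp add: diff_le_eq)
  qed
  moreover have "w - Sup T *\<^sub>R y \<le> 0"
  proof (rule le_0_of_le_small_multiples[OF _ y0(1)])
    fix e :: real assume e: "e > 0"
    have "Sup T + e \<notin> T" using cSup_upper[OF _ bdd, of "Sup T + e"] e by auto
    then have "\<not> (Sup T + e) *\<^sub>R y \<le> w" using e s0 by (simp add: T_def)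
    then have "w \<le> (Sup T + e) *\<^sub>R y"
      using maximal_dichotomy[OF assms, of "Sup T + e"] e s0 by auto
    then show "w - Sup T *\<^sub>R y \<le> e *\<^sub>R y" by (simp add: diff_le_eq scaleR_add_left add.commute)
  qed
  ultimately show ?thesis using s0 by (intro exI[of _ "Sup T"]) auto
qed

text \<open>The truncation of \<open>z\<close> at \<open>c y\<close> is a multiple \<open>t y\<close>, and \<open>t < c\<close> for large \<open>c\<close> by comparison of norms. So
  the truncation is not active along \<open>y\<close>, and \<open>z - t y\<close> is disjoint from \<open>y\<close>.\<close>

lemma maximal_split:
  assumes y: "y \<in> D" and z: "z \<in> Y" "0 \<le> z"
  shows "\<exists>t\<ge>0. 0 \<le> z - t *\<^sub>R y \<and> inf (z - t *\<^sub>R y) y = 0"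
proof -
  have y0: "0 \<le> y" "y \<noteq> 0" "y \<in> Y" using y D by (auto simp: disjoint_pos_def)
  \<comment> \<open>the summand \<open>1\<close> yields \<open>y \<le> (c - t) y\<close> below\<close>
  define c where "c = norm z / norm y + 1"
  have c: "0 \<le> c" by (simp add: c_def)
  have cy: "0 \<le> c *\<^sub>R y" using c y0 by (simp add: scaleR_nonneg_nonneg)
  obtain t where t: "0 \<le> t" "inf z (c *\<^sub>R y) = t *\<^sub>R y"
    using maximal_atom[OF y, of "inf z (c *\<^sub>R y)" c] y0 z c cy by (auto intro!: sub_closed)
  have "t *\<^sub>R y \<le> z" by (metis inf.cobounded1 t(2))
  moreover from this have "t * norm y \<le> norm z"
    using norm_mono_pos[of "t *\<^sub>R y" z] t y0 by (simp add: scaleR_nonneg_nonneg)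
  then have ct: "1 \<le> c - t" using y0 by (simp add: c_def pos_le_divide_eq)
  moreover have "inf (z - t *\<^sub>R y) ((c - t) *\<^sub>R y) = 0"
    using add_inf_distrib_right[of z "c *\<^sub>R y" "- (t *\<^sub>R y)"] t by (simp add: scaleR_diff_left)
  moreover have "1 *\<^sub>R y \<le> (c - t) *\<^sub>R y" using ct y0 by (intro scaleR_right_mono)
  ultimately have "0 \<le> z - t *\<^sub>R y" "inf (z - t *\<^sub>R y) y = 0"
    using disjoint_mono[of "z - t *\<^sub>R y" "(c - t) *\<^sub>R y" "z - t *\<^sub>R y" y] y0 by simp_all
  then show ?thesis using t by blast
qed

lemma span_maximal_disjoint: "span D = Y"
proof
  show "span D \<subseteq> Y" using Y D by (intro span_minimal) (auto simp: sublattice_def)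
  have pos: "z \<in> span D" if z: "z \<in> Y" "0 \<le> z" for z
  proof -
    have "\<exists>r\<in>Y. 0 \<le> r \<and> z - r \<in> span D \<and> (\<forall>y\<in>F. inf r y = 0)" if "F \<subseteq> D" for F
      using finite_subset[OF that D(1)] that
    proof (induction F rule: finite_induct)
      case empty
      then show ?case using z by (intro bexI[of _ z]) (auto simp: span_zero)
    next
      case (insert y F)
      then obtain r where r: "r \<in> Y" "0 \<le> r" "z - r \<in> span D" "\<forall>y\<in>F. inf r y = 0" by auto
      have y: "y \<in> D" "0 \<le> y" "y \<in> Y" using insert D by (auto simp: disjoint_pos_def)
      obtain t where t: "0 \<le> t" "0 \<le> r - t *\<^sub>R y" "inf (r - t *\<^sub>R y) y = 0"
        using maximal_split[OF y(1) r(1,2)] by blast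
      have le: "r - t *\<^sub>R y \<le> r" using t y by (simp add: scaleR_nonneg_nonneg)
      moreover have "inf (r - t *\<^sub>R y) y' = 0" if "y' \<in> F" for y'
        using disjoint_mono[of r y' "r - t *\<^sub>R y" y'] r(4) that t le insert D
        by (auto simp: disjoint_pos_def)
      moreover have "z - r + t *\<^sub>R y \<in> span D" using r(3) y by (intro span_add[OF r(3)] span_scale span_base)
      moreover have "z - (r - t *\<^sub>R y) = z - r + t *\<^sub>R y" by simp
      moreover have "r - t *\<^sub>R y \<in> Y" using r(1) y(3) by (intro sub_closed)
      ultimately show ?case using t by (metis insert_iff)
    qed
    from this[of D] obtain r where r: "r \<in> Y" "0 \<le> r" "z - r \<in> span D" "\<forall>y\<in>D. inf r y = 0" by auto
    have "r = 0"
    proof (rule ccontr)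
      assume "r \<noteq> 0"
      then have "r \<notin> D" using r(4) by (metis inf.idem)
      have "card (insert r D) \<le> card D"
        using r D \<open>r \<noteq> 0\<close> by (intro maximal) (auto simp: disjoint_pos_def inf_commute)
      then show False using \<open>r \<notin> D\<close> D by simp
    qed
    then show ?thesis using r by simp
  qed
  show "Y \<subseteq> span D"
  proof
    fix z assume z: "z \<in> Y"
    have "z = sup z 0 - sup (- z) 0"
      using prts[of z] pprt_neg[of z] by (simp add: pprt_def)
    also have "\<dots> \<in> span D" using z by (intro span_diff pos) (auto intro: sub_closed)
    finally show "z \<in> span D" .
  qed
qed

end

lemma ex_disjoint_spanning:
  fixes Y :: "'a::banach_lattice set"
  assumes Y: "sublattice Y"
    and bound: "\<And>E. finite E \<Longrightarrow> E \<subseteq> Y \<Longrightarrow> disjoint_pos E (\<lambda>v. v) \<Longrightarrow> 0 \<notin> E \<Longrightarrow> card E \<le> n"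
  shows "\<exists>D. finite D \<and> disjoint_pos D (\<lambda>v. v) \<and> 0 \<notin> D \<and> span D = Y"
proof -
  let ?P = "\<lambda>E. finite E \<and> E \<subseteq> Y \<and> disjoint_pos E (\<lambda>v. v) \<and> 0 \<notin> E"
  have "?P {}" by (simp add: disjoint_pos_def)
  moreover have "\<forall>E. ?P E \<longrightarrow> card E < Suc n" using bound by (simp add: less_Suc_eq_le)
  ultimately have "\<exists>D. ?P D \<and> (\<forall>E. ?P E \<longrightarrow> card E \<le> card D)"
    by (rule ex_has_greatest_nat[of ?P "{}" card "Suc n"])
  then obtain D where "?P D \<and> (\<forall>E. ?P E \<longrightarrow> card E \<le> card D)" ..
  then have D: "?P D" and max: "\<forall>E. ?P E \<longrightarrow> card E \<le> card D" by simp_all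
  have "span D = Y" by (rule span_maximal_disjoint[OF Y]) (use D max in simp_all)
  with D show ?thesis by (intro exI[of _ D]) simp
qed

lemma ex_normalized_enumeration:
  assumes "finite D" "disjoint_pos D (\<lambda>v. v)" "(0::'a::banach_lattice) \<notin> D" "card D = n"
  shows "\<exists>x::nat \<Rightarrow> 'a. disjoint_pos {..<n} x \<and> (\<forall>i<n. norm (x i) = 1) \<and> span (x ` {..<n}) = span D"
proof -
  obtain f where f: "bij_betw f {..<n} D"
    using ex_bij_betw_nat_finite[OF assms(1)] unfolding assms(4) atLeast0LessThan ..
  have fD: "f i \<in> D" if "i < n" for i using f that by (auto simp: bij_betw_def)
  have "disjoint_pos {..<n} (\<lambda>i. f i)"
    using disjoint_pos_compose[OF assms(2), of f "{..<n}"] f by (simp add: bij_betw_def)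
  then have "disjoint_pos {..<n} (\<lambda>i. (1 / norm (f i)) *\<^sub>R f i)"
    by (rule disjoint_pos_scale) simp
  moreover have "norm ((1 / norm (f i)) *\<^sub>R f i) = 1" if "i < n" for i
    using fD[OF that] assms(3) by (auto simp: divide_simps)
  moreover have "span ((\<lambda>i. (1 / norm (f i)) *\<^sub>R f i) ` {..<n}) = span D" (is "span ?X = _")
  proof (rule antisym; rule span_minimal[OF _ subspace_span]; rule subsetI)
    fix v assume "v \<in> ?X"
    then show "v \<in> span D" using fD by (force intro: span_scale span_base)
  next
    fix v assume v: "v \<in> D"
    then have "v \<in> f ` {..<n}" using f by (simp add: bij_betw_def)
    then obtain i where i: "i < n" "v = f i" by (elim imageE) simp
    have "norm (f i) *\<^sub>R ((1 / norm (f i)) *\<^sub>R f i) \<in> span ?X"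
      using i by (intro span_scale span_base) simp
    then show "v \<in> span ?X" using i v assms(3) by (cases "f i = 0") simp_all
  qed
  ultimately show ?thesis
    by (intro exI[of _ "\<lambda>i. (1 / norm (f i)) *\<^sub>R f i"]) simp
qed

lemma finite_dim_sublattice_basis:
  fixes Y :: "'a::banach_lattice set"
  assumes Y: "sublattice Y" and n: "dim Y = n" "0 < n"
  shows "\<exists>x. disjoint_pos {..<n} x \<and> (\<forall>i<n. norm (x i) = 1) \<and> x ` {..<n} \<subseteq> Y \<and> span (x ` {..<n}) = Y"
proof -
  obtain B where B: "independent B" "Y \<subseteq> span B" "card B = dim Y"
    using basis_exists[of Y] by metis
  then have finB: "finite B" using n card_ge_0_finite[of B] by metis
  have bound: "card E \<le> card B" if "finite E" "E \<subseteq> Y" "disjoint_pos E (\<lambda>v. v)" "0 \<notin> E" for E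
  proof -
    have "independent E" using independent_disjoint_pos[OF that(3,1)] that(4) by auto
    moreover have "E \<subseteq> span B" using that(2) B(2) by simp
    ultimately show ?thesis using independent_span_bound[OF finB] by auto
  qed
  obtain D where D: "finite D" "disjoint_pos D (\<lambda>v. v)" "0 \<notin> D" "span D = Y"
    using ex_disjoint_spanning[OF Y bound] by auto
  have "independent D" using independent_disjoint_pos[OF D(2,1)] D(3) by auto
  then have "card D = n" using n D(4) by (metis dim_eq_card_independent dim_span)
  then obtain x :: "nat \<Rightarrow> 'a" where
    x: "disjoint_pos {..<n} x" "\<forall>i<n. norm (x i) = 1" "span (x ` {..<n}) = span D"
    using ex_normalized_enumeration[OF D(1-3)] by metis
  then show ?thesis using D(4) span_superset[of "x ` {..<n}"] by (intro exI[of _ x]) simp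
qed

text \<open>Otherwise a disjoint set of maximal cardinality would be a finite spanning set.\<close>

lemma infinite_dim_disjoint:
  assumes "\<not> (\<exists>B::'a::banach_lattice set. finite B \<and> span B = UNIV)"
  shows "\<exists>x::nat \<Rightarrow> 'a. disjoint_pos {..<n} x \<and> (\<forall>i<n. norm (x i) = 1)"
proof -
  have "sublattice (UNIV :: 'a set)" by (simp add: sublattice_def)
  then have "\<not> (\<forall>E::'a set. finite E \<longrightarrow> disjoint_pos E (\<lambda>v. v) \<longrightarrow> 0 \<notin> E \<longrightarrow> card E \<le> n)"
    using ex_disjoint_spanning[of "UNIV :: 'a set" n] assms by metis
  then obtain E :: "'a set" where E: "finite E" "disjoint_pos E (\<lambda>v. v)" "0 \<notin> E" "n \<le> card E"
    by (meson nat_le_linear)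
  obtain D where D: "D \<subseteq> E" "card D = n" "finite D"
    using obtain_subset_with_card_n[OF E(4)] by metis
  have "\<exists>x::nat \<Rightarrow> 'a. disjoint_pos {..<n} x \<and> (\<forall>i<n. norm (x i) = 1) \<and> span (x ` {..<n}) = span D"
    using D E(3) disjoint_pos_subset[OF E(2) D(1)] by (intro ex_normalized_enumeration) (simp_all add: subset_iff, metis)
  then show ?thesis by metis
qed

section \<open>The parameters of a sublattice\<close>

lemma ex_disjoint_pair:
  fixes Z :: "'a::banach_lattice set"
  assumes "sublattice Z" "dim Z \<ge> 2"
  shows "\<exists>u v. u \<in> pos_sphere Z \<and> v \<in> pos_sphere Z \<and> inf u v = 0"
proof -
  obtain x where x: "disjoint_pos {..<dim Z} x" "\<forall>i<dim Z. norm (x i) = 1" "x ` {..<dim Z} \<subseteq> Z"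
    using finite_dim_sublattice_basis[OF assms(1) refl] assms(2) by auto
  have "x 0 \<in> Z" "x 1 \<in> Z" using x(3) assms(2) by auto
  moreover have "inf (x 0) (x 1) = 0" "0 \<le> x 0" "0 \<le> x 1"
    using x(1) assms(2) by (simp_all add: disjoint_pos_def)
  ultimately show ?thesis
    using x(2) assms(2) by (intro exI[of _ "x 0"] exI[of _ "x 1"]) (simp add: pos_sphere_def)
qed

text \<open>For positive \<open>x\<close> and \<open>y\<close> the modulus of \<open>x - y\<close> is at most \<open>x + y\<close>, so only the norm of \<open>x + y\<close>
  matters in \<^const>\<open>lambda_plus\<close>. For disjoint vectors \<open>x + y\<close> is also the supremum of \<open>x\<close> and \<open>y\<close>, which
  links the three parameters.\<close>

lemma norm_diff_le_norm_add:
  fixes x y :: "'a::banach_lattice"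
  assumes "0 \<le> x" "0 \<le> y"
  shows "norm (x - y) \<le> norm (x + y)"
proof (rule norm_mono_abs)
  have "\<bar>x - y\<bar> \<le> \<bar>x\<bar> + \<bar>y\<bar>" using abs_triangle_ineq4 by blast
  then show "\<bar>x - y\<bar> \<le> \<bar>x + y\<bar>" using assms by simp
qed

lemma pos_sphere_norm_add:
  assumes "x \<in> pos_sphere Z" "y \<in> pos_sphere Z"
  shows "1 \<le> norm (x + y)" "norm (x + y) \<le> 2" "max (norm (x - y)) (norm (x + y)) = norm (x + y)"
proof -
  have xy: "0 \<le> x" "0 \<le> y" "norm x = 1" "norm y = 1" using assms by (auto simp: pos_sphere_def)
  show "1 \<le> norm (x + y)" using norm_mono_pos[of x "x + y"] xy by simp
  show "norm (x + y) \<le> 2" using norm_triangle_ineq[of x y] xy by simp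
  show "max (norm (x - y)) (norm (x + y)) = norm (x + y)"
    using norm_diff_le_norm_add[of x y] xy by simp
qed

lemma lambda_plus_le:
  assumes "x \<in> pos_sphere Z" "y \<in> pos_sphere Z"
  shows "lambda_plus Z \<le> norm (x + y)"
  unfolding lambda_plus_def
proof (rule cInf_lower)
  show "bdd_below {max (norm (x - y)) (norm (x + y)) |x y. x \<in> pos_sphere Z \<and> y \<in> pos_sphere Z}"
    by (rule bdd_belowI[of _ 0]) (auto simp: le_max_iff_disj)
  show "norm (x + y) \<in> {max (norm (x - y)) (norm (x + y)) |x y. x \<in> pos_sphere Z \<and> y \<in> pos_sphere Z}"
    using assms pos_sphere_norm_add(3)[OF assms] by (metis (mono_tags, lifting) mem_Collect_eq)
qed

lemma lambda_plus_ge: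
  assumes "sublattice Z" "dim Z \<ge> 2"
    and "\<And>x y. x \<in> pos_sphere Z \<Longrightarrow> y \<in> pos_sphere Z \<Longrightarrow> c \<le> norm (x + y)"
  shows "c \<le> lambda_plus Z"
  unfolding lambda_plus_def
proof (rule cInf_greatest)
  show "{max (norm (x - y)) (norm (x + y)) |x y. x \<in> pos_sphere Z \<and> y \<in> pos_sphere Z} \<noteq> {}"
    using ex_disjoint_pair[OF assms(1,2)] by blast
next
  fix r assume "r \<in> {max (norm (x - y)) (norm (x + y)) |x y. x \<in> pos_sphere Z \<and> y \<in> pos_sphere Z}"
  then obtain x y where "r = max (norm (x - y)) (norm (x + y))" "x \<in> pos_sphere Z" "y \<in> pos_sphere Z"
    by (elim CollectE exE conjE)
  then show "c \<le> r" using assms(3)[of x y] by (simp add: pos_sphere_norm_add(3))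
qed

lemma beta_le:
  assumes "x \<in> pos_sphere Z" "y \<in> pos_sphere Z" "inf x y = 0"
  shows "beta Z \<le> norm (x + y)"
  unfolding beta_def
proof (rule cInf_lower)
  show "bdd_below {norm (sup x y) |x y. x \<in> pos_sphere Z \<and> y \<in> pos_sphere Z \<and> inf x y = 0}"
    by (rule bdd_belowI[of _ 0]) auto
  show "norm (x + y) \<in> {norm (sup x y) |x y. x \<in> pos_sphere Z \<and> y \<in> pos_sphere Z \<and> inf x y = 0}"
    using assms sup_eq_add_of_disjoint[OF assms(3)] by (metis (mono_tags, lifting) mem_Collect_eq)
qed

lemma lambda_plus_le_beta:
  assumes "sublattice Z" "dim Z \<ge> 2"
  shows "lambda_plus Z \<le> beta Z"
  unfolding beta_def
proof (rule cInf_greatest)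
  show "{norm (sup x y) |x y. x \<in> pos_sphere Z \<and> y \<in> pos_sphere Z \<and> inf x y = 0} \<noteq> {}"
    using ex_disjoint_pair[OF assms] by blast
next
  fix r assume "r \<in> {norm (sup x y) |x y. x \<in> pos_sphere Z \<and> y \<in> pos_sphere Z \<and> inf x y = 0}"
  then obtain x y where "r = norm (sup x y)" "x \<in> pos_sphere Z" "y \<in> pos_sphere Z" "inf x y = 0"
    by (elim CollectE exE conjE)
  then show "lambda_plus Z \<le> r" using lambda_plus_le[of x Z y] by (simp add: sup_eq_add_of_disjoint)
qed

lemma norm_sup_le_2:
  assumes "x \<in> pos_ball Z" "y \<in> pos_ball Z"
  shows "norm (sup x y) \<le> 2"
proof -
  have xy: "0 \<le> x" "0 \<le> y" "norm x \<le> 1" "norm y \<le> 1" using assms by (auto simp: pos_ball_def)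
  have "sup x y \<le> x + y" using xy by (simp add: add_increasing add_increasing2)
  then have "norm (sup x y) \<le> norm (x + y)" using xy by (intro norm_mono_pos) (auto intro: le_supI1)
  also have "\<dots> \<le> norm x + norm y" by (rule norm_triangle_ineq)
  finally show ?thesis using xy by simp
qed

lemma alpha_ge:
  assumes "x \<in> pos_ball Z" "y \<in> pos_ball Z"
  shows "norm (sup x y) \<le> alpha Z"
  unfolding alpha_def
proof (rule cSup_upper)
  show "bdd_above {norm (sup x y) |x y. x \<in> pos_ball Z \<and> y \<in> pos_ball Z}"
    by (rule bdd_aboveI[of _ 2]) (auto intro: norm_sup_le_2)
  show "norm (sup x y) \<in> {norm (sup x y) |x y. x \<in> pos_ball Z \<and> y \<in> pos_ball Z}"
    using assms by (intro CollectI exI[of _ x] exI[of _ y]) simp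
qed

lemma alpha_le:
  assumes "0 \<in> Z" and "\<And>x y. x \<in> pos_ball Z \<Longrightarrow> y \<in> pos_ball Z \<Longrightarrow> norm (sup x y) \<le> c"
  shows "alpha Z \<le> c"
  unfolding alpha_def
proof (rule cSup_least)
  have "0 \<in> pos_ball Z" using assms by (simp add: pos_ball_def)
  then show "{norm (sup x y) |x y. x \<in> pos_ball Z \<and> y \<in> pos_ball Z} \<noteq> {}" by blast
next
  fix r assume "r \<in> {norm (sup x y) |x y. x \<in> pos_ball Z \<and> y \<in> pos_ball Z}"
  then obtain x y where "r = norm (sup x y)" "x \<in> pos_ball Z" "y \<in> pos_ball Z"
    by (elim CollectE exE conjE)
  then show "r \<le> c" using assms(2) by simp
qed

lemma alpha_ge_add:
  assumes "x \<in> pos_sphere Z" "y \<in> pos_sphere Z" "inf x y = 0"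
  shows "norm (x + y) \<le> alpha Z"
  using alpha_ge[of x Z y] assms sup_eq_add_of_disjoint[OF assms(3)]
  by (simp add: pos_sphere_def pos_ball_def)

lemma parameters_bounded:
  assumes "sublattice Z" "dim Z \<ge> 2"
  shows "lambda_plus Z \<in> {1..2}" "beta Z \<in> {1..2}" "alpha Z \<in> {1..2}"
proof -
  obtain u v where uv: "u \<in> pos_sphere Z" "v \<in> pos_sphere Z" "inf u v = 0"
    using ex_disjoint_pair[OF assms] by blast
  have "1 \<le> lambda_plus Z" using lambda_plus_ge[OF assms] pos_sphere_norm_add(1) by blast
  moreover have "beta Z \<le> 2" using beta_le[OF uv] pos_sphere_norm_add(2)[OF uv(1,2)] by simp
  moreover have "lambda_plus Z \<le> beta Z" by (rule lambda_plus_le_beta[OF assms])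
  ultimately show "lambda_plus Z \<in> {1..2}" "beta Z \<in> {1..2}" by simp_all
  have "1 \<le> alpha Z" using alpha_ge_add[OF uv] pos_sphere_norm_add(1)[OF uv(1,2)] by simp
  moreover have "alpha Z \<le> 2"
    using assms(1) by (intro alpha_le norm_sup_le_2) (simp_all add: sublattice_def subspace_0)
  ultimately show "alpha Z \<in> {1..2}" by simp
qed

section \<open>Estimates for disjoint positive families\<close>

text \<open>Estimates for disjoint vectors need only be studied for positive ones, because the modulus is
  additive on disjoint vectors.\<close>

lemma abs_add_disjoint:
  fixes x y :: "'a::banach_lattice"
  assumes xy: "inf \<bar>x\<bar> \<bar>y\<bar> = 0"
  shows "\<bar>x + y\<bar> = \<bar>x\<bar> + \<bar>y\<bar>"
proof (rule antisym)
  have le: "\<bar>u\<bar> \<le> \<bar>u + v\<bar>" if "inf \<bar>u\<bar> \<bar>v\<bar> = 0" for u v :: 'a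
  proof -
    have "\<bar>u\<bar> \<le> \<bar>u + v\<bar> + \<bar>v\<bar>" using abs_triangle_ineq4[of "u + v" v] by simp
    then have "\<bar>u\<bar> - \<bar>u + v\<bar> \<le> \<bar>v\<bar>" by (simp add: diff_le_eq add.commute)
    moreover have "\<bar>u\<bar> - \<bar>u + v\<bar> \<le> \<bar>u\<bar>" by simp
    ultimately have "\<bar>u\<bar> - \<bar>u + v\<bar> \<le> inf \<bar>u\<bar> \<bar>v\<bar>" by simp
    then show ?thesis using that by simp
  qed
  have "inf \<bar>y\<bar> \<bar>x\<bar> = 0" using xy by (simp add: inf_commute)
  then have "\<bar>x\<bar> \<le> \<bar>x + y\<bar>" "\<bar>y\<bar> \<le> \<bar>x + y\<bar>" using le[of x y] le[of y x] xy by (simp_all add: add.commute)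
  then have "sup \<bar>x\<bar> \<bar>y\<bar> \<le> \<bar>x + y\<bar>" by simp
  then show "\<bar>x\<bar> + \<bar>y\<bar> \<le> \<bar>x + y\<bar>" by (simp only: sup_eq_add_of_disjoint[OF xy])
qed (rule abs_triangle_ineq)

lemma disjoint_pos_abs:
  assumes "pairwise_disjoint n x"
  shows "disjoint_pos {..<n} (\<lambda>i. \<bar>x i\<bar>)"
  using assms by (simp add: pairwise_disjoint_def disjoint_pos_def)

lemma norm_sum_abs_disjoint:
  assumes "pairwise_disjoint n x"
  shows "norm (\<Sum>i<n. \<bar>x i\<bar>) = norm (\<Sum>i<n. x i)"
proof -
  note d = disjoint_pos_abs[OF assms]
  have "\<bar>\<Sum>i<k. x i\<bar> = (\<Sum>i<k. \<bar>x i\<bar>)" if "k \<le> n" for k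
    using that
  proof (induction k)
    case (Suc k)
    have "inf (\<Sum>i<k. \<bar>x i\<bar>) (\<Sum>i\<in>{k}. \<bar>x i\<bar>) = 0"
      using Suc.prems by (intro disjoint_pos_sums[OF d]) auto
    then show ?case using Suc by (simp add: abs_add_disjoint)
  qed simp
  from this[of n] norm_abs_lattice[of "\<Sum>i<n. x i"] show ?thesis by simp
qed

text \<open>Estimates with finite exponent in power form: without the \<open>q\<close>-th root, both sides are additive over
  a partition of the family. Here \<open>C\<close> is the \<open>q\<close>-th power of the usual constant.\<close>

definition lower_q :: "'a::banach_lattice itself \<Rightarrow> real \<Rightarrow> real \<Rightarrow> bool" where
  "lower_q _ q C \<longleftrightarrow> (\<forall>(I::nat set) x::nat \<Rightarrow> 'a. finite I \<longrightarrow> disjoint_pos I x \<longrightarrow>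
    (\<Sum>i\<in>I. norm (x i) powr q) \<le> C * norm (\<Sum>i\<in>I. x i) powr q)"

definition upper_q :: "'a::banach_lattice itself \<Rightarrow> real \<Rightarrow> real \<Rightarrow> bool" where
  "upper_q _ q C \<longleftrightarrow> (\<forall>(I::nat set) x::nat \<Rightarrow> 'a. finite I \<longrightarrow> disjoint_pos I x \<longrightarrow>
    norm (\<Sum>i\<in>I. x i) powr q \<le> C * (\<Sum>i\<in>I. norm (x i) powr q))"

lemma pairwise_disjoint_reindex:
  assumes x: "disjoint_pos (I::nat set) x" and f: "bij_betw f {..<card I} I"
  shows "pairwise_disjoint (card I) (\<lambda>i. x (f i))"
proof -
  have "disjoint_pos {..<card I} (\<lambda>i. x (f i))"
    using f by (intro disjoint_pos_compose[OF x]) (simp_all add: bij_betw_def)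
  then show ?thesis by (simp add: disjoint_pos_def pairwise_disjoint_def)
qed

lemma ex_bij_lessThan: "finite I \<Longrightarrow> \<exists>f. bij_betw f {..<card I} I"
  using ex_bij_betw_nat_finite by (simp only: atLeast0LessThan)

lemma lower_q_of_lower_estimate:
  assumes est: "lower_estimate (UNIV :: 'a::banach_lattice set) (ereal q) M" and q: "1 \<le> q"
  shows "lower_q TYPE('a) q ((max M 1) powr q)"
  unfolding lower_q_def
proof (intro allI impI)
  fix I :: "nat set" and x :: "nat \<Rightarrow> 'a"
  assume I: "finite I" and x: "disjoint_pos I x"
  show "(\<Sum>i\<in>I. norm (x i) powr q) \<le> (max M 1) powr q * norm (\<Sum>i\<in>I. x i) powr q"
  proof (cases "I = {}")
    case False
    obtain f where f: "bij_betw f {..<card I} I" using ex_bij_lessThan[OF I] ..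
    have reindex: "(\<Sum>i<card I. norm (x (f i)) powr q) = (\<Sum>i\<in>I. norm (x i) powr q)"
      "(\<Sum>i<card I. x (f i)) = (\<Sum>i\<in>I. x i)"
      using sum.reindex_bij_betw[OF f] by (auto intro: sum.reindex_bij_betw[OF f])
    have "1 \<le> card I" using False I by (simp add: Suc_le_eq card_gt_0_iff)
    then have "lq_norms (ereal q) (card I) (\<lambda>i. x (f i)) \<le> M * norm (\<Sum>i<card I. x (f i))"
      using est pairwise_disjoint_reindex[OF x f] unfolding lower_estimate_def by simp
    then have "(\<Sum>i\<in>I. norm (x i) powr q) powr (1 / q) \<le> M * norm (\<Sum>i\<in>I. x i)"
      by (simp add: lq_norms_def reindex)
    also have "\<dots> \<le> max M 1 * norm (\<Sum>i\<in>I. x i)" by (intro mult_right_mono) auto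
    finally have "((\<Sum>i\<in>I. norm (x i) powr q) powr (1 / q)) powr q \<le> (max M 1 * norm (\<Sum>i\<in>I. x i)) powr q"
      using q by (intro powr_mono2) auto
    then show ?thesis using q by (simp add: powr_powr powr_mult sum_nonneg)
  qed simp
qed

lemma lower_estimate_of_lower_q:
  assumes low: "lower_q TYPE('a::banach_lattice) q C" and q: "1 \<le> q" and C: "0 \<le> C"
  shows "lower_estimate (UNIV :: 'a set) (ereal q) (C powr (1 / q))"
  unfolding lower_estimate_def
proof (intro allI impI)
  fix n :: nat and x :: "nat \<Rightarrow> 'a"
  assume n: "1 \<le> n" and "(\<forall>i<n. x i \<in> UNIV) \<and> pairwise_disjoint n x"
  then have x: "pairwise_disjoint n x" by simp
  have "(\<Sum>i<n. norm (x i) powr q) \<le> C * norm (\<Sum>i<n. x i) powr q"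
    using low[unfolded lower_q_def, rule_format, OF _ disjoint_pos_abs[OF x]]
    by (simp add: norm_sum_abs_disjoint[OF x] norm_abs_lattice)
  then have "(\<Sum>i<n. norm (x i) powr q) powr (1 / q) \<le> (C * norm (\<Sum>i<n. x i) powr q) powr (1 / q)"
    using q by (intro powr_mono2 sum_nonneg) auto
  then show "lq_norms (ereal q) n x \<le> C powr (1 / q) * norm (\<Sum>i<n. x i)"
    using q C by (simp add: lq_norms_def powr_mult powr_powr)
qed

lemma upper_q_of_upper_estimate:
  assumes est: "upper_estimate (UNIV :: 'a::banach_lattice set) (ereal q) M" and q: "1 \<le> q"
  shows "upper_q TYPE('a) q ((max M 1) powr q)"
  unfolding upper_q_def
proof (intro allI impI)
  fix I :: "nat set" and x :: "nat \<Rightarrow> 'a"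
  assume I: "finite I" and x: "disjoint_pos I x"
  show "norm (\<Sum>i\<in>I. x i) powr q \<le> (max M 1) powr q * (\<Sum>i\<in>I. norm (x i) powr q)"
  proof (cases "I = {}")
    case False
    obtain f where f: "bij_betw f {..<card I} I" using ex_bij_lessThan[OF I] ..
    have reindex: "(\<Sum>i<card I. norm (x (f i)) powr q) = (\<Sum>i\<in>I. norm (x i) powr q)"
      "(\<Sum>i<card I. x (f i)) = (\<Sum>i\<in>I. x i)"
      using sum.reindex_bij_betw[OF f] by (auto intro: sum.reindex_bij_betw[OF f])
    have "1 \<le> card I" using False I by (simp add: Suc_le_eq card_gt_0_iff)
    then have "norm (\<Sum>i<card I. x (f i)) \<le> M * lq_norms (ereal q) (card I) (\<lambda>i. x (f i))"
      using est pairwise_disjoint_reindex[OF x f] unfolding upper_estimate_def by simp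
    then have "norm (\<Sum>i\<in>I. x i) \<le> M * (\<Sum>i\<in>I. norm (x i) powr q) powr (1 / q)"
      by (simp add: lq_norms_def reindex)
    also have "\<dots> \<le> max M 1 * (\<Sum>i\<in>I. norm (x i) powr q) powr (1 / q)" by (intro mult_right_mono) auto
    finally have "norm (\<Sum>i\<in>I. x i) powr q \<le> (max M 1 * (\<Sum>i\<in>I. norm (x i) powr q) powr (1 / q)) powr q"
      using q by (intro powr_mono2) auto
    then show ?thesis using q by (simp add: powr_powr powr_mult sum_nonneg)
  qed simp
qed

lemma upper_estimate_of_upper_q:
  assumes upp: "upper_q TYPE('a::banach_lattice) q C" and q: "1 \<le> q" and C: "0 \<le> C"
  shows "upper_estimate (UNIV :: 'a set) (ereal q) (C powr (1 / q))"
  unfolding upper_estimate_def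
proof (intro allI impI)
  fix n :: nat and x :: "nat \<Rightarrow> 'a"
  assume n: "1 \<le> n" and "(\<forall>i<n. x i \<in> UNIV) \<and> pairwise_disjoint n x"
  then have x: "pairwise_disjoint n x" by simp
  have "norm (\<Sum>i<n. x i) powr q \<le> C * (\<Sum>i<n. norm (x i) powr q)"
    using upp[unfolded upper_q_def, rule_format, OF _ disjoint_pos_abs[OF x]]
    by (simp add: norm_sum_abs_disjoint[OF x] norm_abs_lattice)
  then have "(norm (\<Sum>i<n. x i) powr q) powr (1 / q) \<le> (C * (\<Sum>i<n. norm (x i) powr q)) powr (1 / q)"
    using q by (intro powr_mono2) auto
  then show "norm (\<Sum>i<n. x i) \<le> C powr (1 / q) * lq_norms (ereal q) n x"
    using q C by (simp add: lq_norms_def powr_mult powr_powr)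
qed

text \<open>An upper \<open>\<infinity>\<close>-estimate is the strongest one, since the maximum is at most each \<open>\<ell>\<^sub>q\<close>-norm. This makes it
  possible to work with finite exponents only.\<close>

lemma upper_estimate_finite_of_infinite:
  assumes est: "upper_estimate X \<infinity> M" and q: "1 \<le> q"
  shows "upper_estimate X (ereal q) (max M 0)"
  unfolding upper_estimate_def
proof (intro allI impI)
  fix n :: nat and x assume n: "1 \<le> n" and x: "(\<forall>i<n. x i \<in> X) \<and> pairwise_disjoint n x"
  have "Max ((\<lambda>i. norm (x i)) ` {..<n}) \<in> (\<lambda>i. norm (x i)) ` {..<n}"
    using n by (intro Max_in) (auto simp: lessThan_empty_iff)
  then obtain j where j: "j < n" "Max ((\<lambda>i. norm (x i)) ` {..<n}) = norm (x j)" by (elim imageE) simp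
  have "norm (x j) powr q \<le> (\<Sum>i<n. norm (x i) powr q)"
    using j by (intro member_le_sum) auto
  then have "(norm (x j) powr q) powr (1 / q) \<le> (\<Sum>i<n. norm (x i) powr q) powr (1 / q)"
    using q by (intro powr_mono2) auto
  then have le: "norm (x j) \<le> (\<Sum>i<n. norm (x i) powr q) powr (1 / q)" using q by (simp add: powr_powr)
  have "norm (\<Sum>i<n. x i) \<le> M * lq_norms \<infinity> n x"
    using est n x unfolding upper_estimate_def by simp
  also have "lq_norms \<infinity> n x = norm (x j)" by (simp add: lq_norms_def j)
  also have "M * norm (x j) \<le> max M 0 * norm (x j)" by (intro mult_right_mono) auto
  also have "\<dots> \<le> max M 0 * lq_norms (ereal q) n x"
    using le by (intro mult_left_mono) (auto simp: lq_norms_def)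
  finally show "norm (\<Sum>i<n. x i) \<le> max M 0 * lq_norms (ereal q) n x" .
qed

section \<open>Reciprocals of the indices\<close>

text \<open>These are the numbers \<open>1/s(X)\<close> and \<open>1/S(X)\<close>; they lie in the unit interval, and \<open>0\<close> stands for an
  infinite index. Heuristically, the norm of a sum of \<open>N\<close> normalized disjoint vectors is at least about
  \<open>N\<close> to the power \<open>1/s(X)\<close> and at most about \<open>N\<close> to the power \<open>1/S(X)\<close>.\<close>

definition lower_exponent :: "'a::banach_lattice itself \<Rightarrow> real" where
  "lower_exponent _ = real_of_ereal (1 / lower_index (UNIV :: 'a set))"

definition upper_exponent :: "'a::banach_lattice itself \<Rightarrow> real" where
  "upper_exponent _ = real_of_ereal (1 / upper_index (UNIV :: 'a set))"

lemma upper_estimate_one: "upper_estimate (X :: 'a::banach_lattice set) 1 1"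
  unfolding upper_estimate_def
proof (intro allI impI)
  fix n :: nat and x :: "nat \<Rightarrow> 'a"
  have "lq_norms 1 n x = (\<Sum>i<n. norm (x i))"
    by (simp add: lq_norms_def sum_nonneg one_ereal_def)
  then show "norm (\<Sum>i<n. x i) \<le> 1 * lq_norms 1 n x" by (simp add: norm_sum)
qed

lemma lower_index_ge_1: "1 \<le> lower_index X"
  unfolding lower_index_def by (rule Inf_greatest) simp

lemma upper_index_ge_1: "1 \<le> upper_index X"
  unfolding upper_index_def using upper_estimate_one by (intro Sup_upper) auto

lemma inverse_ereal_cases:
  assumes "1 \<le> (s::ereal)"
  obtains r where "s = ereal r" "1 \<le> r" "real_of_ereal (1 / s) = 1 / r"
  | "s = \<infinity>" "real_of_ereal (1 / s) = 0"
  using assms by (cases s) (auto simp: one_ereal_def divide_ereal_def inverse_eq_divide)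

lemma reciprocal_less_iff:
  assumes "1 \<le> (s::ereal)" "0 < k"
  shows "real_of_ereal (1 / s) < k \<longleftrightarrow> ereal (1 / k) < s"
    and "k < real_of_ereal (1 / s) \<longleftrightarrow> s < ereal (1 / k)"
proof -
  have "(real_of_ereal (1 / s) < k \<longleftrightarrow> ereal (1 / k) < s) \<and> (k < real_of_ereal (1 / s) \<longleftrightarrow> s < ereal (1 / k))"
  proof (rule inverse_ereal_cases[OF assms(1)])
    fix r assume r: "s = ereal r" "1 \<le> r" "real_of_ereal (1 / s) = 1 / r"
    show ?thesis unfolding r(3) using r(1,2) assms(2) by (simp add: field_simps)
  next
    assume "s = \<infinity>" "real_of_ereal (1 / s) = 0"
    then show ?thesis using assms(2) by simp
  qed
  then show "real_of_ereal (1 / s) < k \<longleftrightarrow> ereal (1 / k) < s"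
    and "k < real_of_ereal (1 / s) \<longleftrightarrow> s < ereal (1 / k)" by simp_all
qed

lemma lower_exponent_bounds: "0 \<le> lower_exponent TYPE('a::banach_lattice)" "lower_exponent TYPE('a) \<le> 1"
  by (rule inverse_ereal_cases[OF lower_index_ge_1[of "UNIV :: 'a set"]]; simp add: lower_exponent_def)+

lemma upper_exponent_bounds: "0 \<le> upper_exponent TYPE('a::banach_lattice)" "upper_exponent TYPE('a) \<le> 1"
  by (rule inverse_ereal_cases[OF upper_index_ge_1[of "UNIV :: 'a set"]]; simp add: upper_exponent_def)+

lemma lower_q_below_exponent:
  assumes "0 < k" "k < lower_exponent TYPE('a::banach_lattice)"
  shows "\<exists>q\<ge>1. k < 1 / q \<and> (\<exists>C>0. lower_q TYPE('a) q C)"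
proof -
  have "lower_index (UNIV :: 'a set) < ereal (1 / k)"
    using assms reciprocal_less_iff(2)[OF lower_index_ge_1[of "UNIV :: 'a set"]] by (simp add: lower_exponent_def)
  then obtain Q where Q: "1 \<le> Q" "\<exists>M. lower_estimate (UNIV :: 'a set) Q M" "Q < ereal (1 / k)"
    unfolding lower_index_def Inf_less_iff by (elim bexE CollectE conjE)
  obtain q where q: "Q = ereal q" "1 \<le> q" using Q(1,3) by (cases Q) auto
  obtain M where "lower_estimate (UNIV :: 'a set) (ereal q) M" using Q(2) q by auto
  then have "lower_q TYPE('a) q ((max M 1) powr q)" using q(2) by (rule lower_q_of_lower_estimate)
  moreover have "0 < (max M 1) powr q" by simp
  moreover have "k < 1 / q" using Q(3) q assms(1) by (simp add: field_simps)
  ultimately show ?thesis using q(2) by blast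
qed

lemma lower_q_fails_above_exponent:
  assumes "lower_exponent TYPE('a::banach_lattice) < k" "k \<le> 1" "0 \<le> C"
  shows "\<not> lower_q TYPE('a) (1 / k) C"
proof
  assume low: "lower_q TYPE('a) (1 / k) C"
  have k: "0 < k" using assms lower_exponent_bounds(1)[where 'a='a] by simp
  have "lower_estimate (UNIV :: 'a set) (ereal (1 / k)) (C powr (1 / (1 / k)))"
    using low assms k by (intro lower_estimate_of_lower_q) auto
  then have "lower_index (UNIV :: 'a set) \<le> ereal (1 / k)"
    unfolding lower_index_def using k assms by (intro Inf_lower) (auto simp: one_ereal_def)
  moreover have "ereal (1 / k) < lower_index (UNIV :: 'a set)"
    using assms k reciprocal_less_iff(1)[OF lower_index_ge_1[of "UNIV :: 'a set"]] by (simp add: lower_exponent_def)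
  ultimately show False by simp
qed

lemma upper_q_above_exponent:
  assumes "upper_exponent TYPE('a::banach_lattice) < k"
  shows "\<exists>q\<ge>1. 1 / q < k \<and> (\<exists>C>0. upper_q TYPE('a) q C)"
proof -
  have k: "0 < k" using assms upper_exponent_bounds(1)[where 'a='a] by simp
  have "ereal (1 / k) < upper_index (UNIV :: 'a set)"
    using assms k reciprocal_less_iff(1)[OF upper_index_ge_1[of "UNIV :: 'a set"]] by (simp add: upper_exponent_def)
  then obtain Q where Q: "1 \<le> Q" "\<exists>M. upper_estimate (UNIV :: 'a set) Q M" "ereal (1 / k) < Q"
    unfolding upper_index_def less_Sup_iff by (elim bexE CollectE conjE)
  obtain q M where q: "1 \<le> q" "1 / k < q" "upper_estimate (UNIV :: 'a set) (ereal q) M"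
  proof (cases Q)
    case (real r)
    then show ?thesis using Q that[of r] by auto
  next
    case PInf
    obtain M where "upper_estimate (UNIV :: 'a set) \<infinity> M" using Q(2) PInf by auto
    then have "upper_estimate (UNIV :: 'a set) (ereal (1 / k + 1)) (max M 0)"
      using k by (intro upper_estimate_finite_of_infinite) auto
    then show ?thesis using that[of "1 / k + 1"] k by simp
  qed (use Q in auto)
  have "upper_q TYPE('a) q ((max M 1) powr q)" using q(3,1) by (rule upper_q_of_upper_estimate)
  moreover have "0 < (max M 1) powr q" by simp
  moreover have "1 / q < k" using q k by (simp add: field_simps)
  ultimately show ?thesis using q(1) by blast
qed

lemma upper_q_fails_below_exponent:
  assumes "k < upper_exponent TYPE('a::banach_lattice)" "0 < k" "0 \<le> C"
  shows "\<not> upper_q TYPE('a) (1 / k) C"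
proof
  assume upp: "upper_q TYPE('a) (1 / k) C"
  have k: "k \<le> 1" using assms upper_exponent_bounds(2)[where 'a='a] by simp
  have "upper_estimate (UNIV :: 'a set) (ereal (1 / k)) (C powr (1 / (1 / k)))"
    using upp assms k by (intro upper_estimate_of_upper_q) auto
  then have "ereal (1 / k) \<le> upper_index (UNIV :: 'a set)"
    unfolding upper_index_def using k assms by (intro Sup_upper) (auto simp: one_ereal_def)
  moreover have "upper_index (UNIV :: 'a set) < ereal (1 / k)"
    using assms k reciprocal_less_iff(2)[OF upper_index_ge_1[of "UNIV :: 'a set"]] by (simp add: upper_exponent_def)
  ultimately show False by simp
qed

section \<open>Combining disjoint pairs along a binary tree\<close>

lemma powr_convex_combination_le:
  fixes W B s r q :: real
  assumes "0 \<le> W" "0 \<le> B" "0 \<le> s" "0 \<le> r" "s + r \<le> 1" "1 \<le> q"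
  shows "(s * W + r * B) powr q \<le> s * W powr q + r * B powr q"
proof -
  have shrink: "t powr q \<le> t" if "0 \<le> t" "t \<le> 1" for t :: real
    using powr_mono'[of 1 q t] that assms(6) by simp
  show ?thesis
  proof (cases "W = 0 \<or> B = 0 \<or> s + r = 0")
    case True
    then consider "W = 0" | "B = 0" | "s = 0" "r = 0" using assms by force
    then show ?thesis
      by cases (use assms shrink[of s] shrink[of r] in \<open>simp_all add: powr_mult mult_right_mono\<close>)
  next
    case False
    define m where "m = s + r"
    have m: "0 < m" "m \<le> 1" using False assms by (auto simp: m_def)
    have conv: "((s / m) * W + (r / m) * B) powr q \<le> (s / m) * W powr q + (r / m) * B powr q"
    proof -
      have "1 - r / m = s / m" using m by (simp add: m_def field_simps)
      moreover have "r / m \<le> 1" using m assms by (simp add: m_def)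
      ultimately show ?thesis
        using convex_onD[OF powr_convex[OF assms(6)], of "r / m" W B] False assms m by simp
    qed
    have "(s * W + r * B) powr q = m powr q * ((s / m) * W + (r / m) * B) powr q"
      using m by (simp add: powr_mult[symmetric] distrib_left)
    also have "\<dots> \<le> m * ((s / m) * W powr q + (r / m) * B powr q)"
      using m assms by (intro mult_mono conv shrink) auto
    also have "\<dots> = s * W powr q + r * B powr q" using m by (simp add: distrib_left)
    finally show ?thesis .
  qed
qed

text \<open>A multiplicative factor \<open>\<theta>\<close> available for every disjoint pair accumulates to \<open>\<theta>^k\<close> over the
  \<open>2^k\<close> leaves of a binary tree, because the two combinations obtained from the subtrees are again
  disjoint and may be normalized. The values \<open>1\<close> and \<open>-1\<close> of \<open>\<sigma>\<close> cover upper and lower bounds for the norm.\<close>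

lemma pair_gain_iterates:
  fixes Y :: "'a::banach_lattice set" and e :: "'i \<Rightarrow> 'a"
  assumes Y: "subspace Y" and q: "0 < q" and \<theta>: "0 \<le> \<theta>"
    and pair: "\<And>u v. u \<in> pos_sphere Y \<Longrightarrow> v \<in> pos_sphere Y \<Longrightarrow> inf u v = 0 \<Longrightarrow>
      \<exists>a b. 0 \<le> a \<and> 0 \<le> b \<and> 0 < a + b \<and>
        \<sigma> * norm (a *\<^sub>R u + b *\<^sub>R v) powr q \<le> \<sigma> * \<theta> * (a powr q + b powr q)"
    and J: "finite J" "card J = 2 ^ k" "disjoint_pos J e" "\<And>j. j \<in> J \<Longrightarrow> e j \<in> pos_sphere Y"
  shows "\<exists>c. (\<forall>j\<in>J. 0 \<le> c j) \<and> (\<exists>j\<in>J. 0 < c j) \<and>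
    \<sigma> * norm (\<Sum>j\<in>J. c j *\<^sub>R e j) powr q \<le> \<sigma> * \<theta> ^ k * (\<Sum>j\<in>J. c j powr q)"
  using J
proof (induction k arbitrary: J)
  case 0
  then obtain j where "J = {j}" by (auto simp: card_1_singleton_iff)
  moreover have "norm (e j) = 1" using 0 calculation by (simp add: pos_sphere_def)
  ultimately show ?case by (intro exI[of _ "\<lambda>_. 1"]) simp
next
  case (Suc k)
  obtain J1 where J1: "J1 \<subseteq> J" "card J1 = 2 ^ k" "finite J1"
    using obtain_subset_with_card_n[of "2 ^ k" J] Suc.prems(2) by (metis le_add1 mult_2 power_Suc)
  define J2 where "J2 = J - J1"
  have J2: "J2 \<subseteq> J" "finite J2" "J1 \<inter> J2 = {}" "J = J1 \<union> J2"
    using J1 Suc.prems(1) by (auto simp: J2_def)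
  have cardJ2: "card J2 = 2 ^ k"
    using J1 Suc.prems(1,2) by (simp add: J2_def card_Diff_subset)
  obtain c1 where c1: "\<And>j. j \<in> J1 \<Longrightarrow> 0 \<le> c1 j" "\<exists>j\<in>J1. 0 < c1 j"
    "\<sigma> * norm (\<Sum>j\<in>J1. c1 j *\<^sub>R e j) powr q \<le> \<sigma> * \<theta> ^ k * (\<Sum>j\<in>J1. c1 j powr q)"
    using Suc.IH[OF J1(3,2) disjoint_pos_subset[OF Suc.prems(3) J1(1)]] Suc.prems(4) J1(1)
    by (meson subsetD)
  obtain c2 where c2: "\<And>j. j \<in> J2 \<Longrightarrow> 0 \<le> c2 j" "\<exists>j\<in>J2. 0 < c2 j"
    "\<sigma> * norm (\<Sum>j\<in>J2. c2 j *\<^sub>R e j) powr q \<le> \<sigma> * \<theta> ^ k * (\<Sum>j\<in>J2. c2 j powr q)"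
    using Suc.IH[OF J2(2) cardJ2 disjoint_pos_subset[OF Suc.prems(3) J2(1)]] Suc.prems(4) J2(1)
    by (meson subsetD)
  define v1 v2 where "v1 = (\<Sum>j\<in>J1. c1 j *\<^sub>R e j)" and "v2 = (\<Sum>j\<in>J2. c2 j *\<^sub>R e j)"
  have inY: "e j \<in> Y" "norm (e j) = 1" "0 \<le> e j" if "j \<in> J" for j
    using Suc.prems(4)[OF that] by (simp_all add: pos_sphere_def)
  have pos: "0 < norm (\<Sum>j\<in>K. c j *\<^sub>R e j)"
    if K: "K \<subseteq> J" "finite K" "\<And>j. j \<in> K \<Longrightarrow> 0 \<le> c j" "\<exists>j\<in>K. 0 < c j" for K c
  proof -
    obtain j where j: "j \<in> K" "0 < c j" using K(4) by blast
    have "c j * norm (e j) \<le> norm (\<Sum>j\<in>K. c j *\<^sub>R e j)"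
      using disjoint_pos_subset[OF Suc.prems(3) K(1)] K(2,3) j(1) by (rule norm_term_le_lincomb)
    moreover have "norm (e j) = 1" using inY(2)[of j] K(1) j(1) by (simp add: subset_iff)
    ultimately have "c j \<le> norm (\<Sum>j\<in>K. c j *\<^sub>R e j)" by simp
    with j(2) show ?thesis by (rule less_le_trans)
  qed
  have n1: "0 < norm v1" and n2: "0 < norm v2"
    unfolding v1_def v2_def using pos J1 J2 c1 c2 by simp_all
  have v0: "0 \<le> v1" "0 \<le> v2" unfolding v1_def v2_def
    using c1(1) c2(1) inY(3) J1(1) J2(1) by (auto intro!: sum_nonneg scaleR_nonneg_nonneg)
  have vY: "v1 \<in> Y" "v2 \<in> Y" unfolding v1_def v2_def
    using inY(1) J1(1) J2(1) by (auto intro!: subspace_sum[OF Y] subspace_scale[OF Y])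
  have "inf v1 v2 = 0"
  proof -
    let ?c = "\<lambda>j. if j \<in> J1 then c1 j else c2 j"
    have d: "disjoint_pos J (\<lambda>j. ?c j *\<^sub>R e j)"
      using c1(1) c2(1) J2(4) by (intro disjoint_pos_scale[OF Suc.prems(3)]) auto
    have "v1 = (\<Sum>j\<in>J1. ?c j *\<^sub>R e j)" by (simp add: v1_def)
    moreover have "v2 = (\<Sum>j\<in>J2. ?c j *\<^sub>R e j)"
      unfolding v2_def by (rule sum.cong) (auto simp: J2_def)
    ultimately show ?thesis using disjoint_pos_sums[OF d J1(1) J2(1) J2(3) J1(3) J2(2)] by simp
  qed
  then have disj: "inf ((1 / norm v1) *\<^sub>R v1) ((1 / norm v2) *\<^sub>R v2) = 0"
    using v0 by (intro disjoint_scaleR) auto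
  have "(1 / norm v1) *\<^sub>R v1 \<in> pos_sphere Y" "(1 / norm v2) *\<^sub>R v2 \<in> pos_sphere Y"
    using n1 n2 v0 vY by (auto simp: pos_sphere_def intro!: subspace_scale[OF Y] scaleR_nonneg_nonneg)
  from pair[OF this disj] obtain a b where ab: "0 \<le> a" "0 \<le> b" "0 < a + b"
    and gain: "\<sigma> * norm (a *\<^sub>R ((1 / norm v1) *\<^sub>R v1) + b *\<^sub>R ((1 / norm v2) *\<^sub>R v2)) powr q
      \<le> \<sigma> * \<theta> * (a powr q + b powr q)"
    by (elim exE conjE)
  define a' b' where "a' = a / norm v1" and "b' = b / norm v2"
  have ab': "0 \<le> a'" "0 \<le> b'" using ab by (simp_all add: a'_def b'_def)
  define c where "c j = (if j \<in> J1 then a' * c1 j else b' * c2 j)" for j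
  have split: "(\<Sum>j\<in>J. f j) = (\<Sum>j\<in>J1. f j) + (\<Sum>j\<in>J2. f j)" for f :: "'i \<Rightarrow> 'c::comm_monoid_add"
    unfolding J2(4) by (rule sum.union_disjoint[OF J1(3) J2(2,3)])
  have c_J2: "c j = b' * c2 j" if "j \<in> J2" for j using that by (simp add: c_def J2_def)
  have comb: "(\<Sum>j\<in>J. c j *\<^sub>R e j) = a *\<^sub>R ((1 / norm v1) *\<^sub>R v1) + b *\<^sub>R ((1 / norm v2) *\<^sub>R v2)"
  proof -
    have "(\<Sum>j\<in>J1. c j *\<^sub>R e j) = a' *\<^sub>R v1" by (simp add: c_def v1_def scaleR_sum_right)
    moreover have "(\<Sum>j\<in>J2. c j *\<^sub>R e j) = b' *\<^sub>R v2" by (simp add: c_J2 v2_def scaleR_sum_right)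
    ultimately show ?thesis by (simp add: split a'_def b'_def)
  qed
  have csum: "(\<Sum>j\<in>J. c j powr q)
      = a' powr q * (\<Sum>j\<in>J1. c1 j powr q) + b' powr q * (\<Sum>j\<in>J2. c2 j powr q)"
  proof -
    have "(\<Sum>j\<in>J1. c j powr q) = a' powr q * (\<Sum>j\<in>J1. c1 j powr q)"
      by (simp add: c_def powr_mult sum_distrib_left)
    moreover have "(\<Sum>j\<in>J2. c j powr q) = b' powr q * (\<Sum>j\<in>J2. c2 j powr q)"
      by (simp add: c_J2 powr_mult sum_distrib_left)
    ultimately show ?thesis by (simp only: split)
  qed
  have "\<sigma> * norm (\<Sum>j\<in>J. c j *\<^sub>R e j) powr q \<le> \<sigma> * \<theta> * (a powr q + b powr q)"
    using gain by (simp only: comb)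
  also have "\<dots> = \<theta> * (a' powr q * (\<sigma> * norm v1 powr q) + b' powr q * (\<sigma> * norm v2 powr q))"
  proof -
    have "a powr q = a' powr q * norm v1 powr q" "b powr q = b' powr q * norm v2 powr q"
      using n1 n2 by (simp_all add: a'_def b'_def powr_mult[symmetric])
    then show ?thesis by (simp add: algebra_simps)
  qed
  also have "\<dots> \<le> \<theta> * (a' powr q * (\<sigma> * \<theta> ^ k * (\<Sum>j\<in>J1. c1 j powr q))
      + b' powr q * (\<sigma> * \<theta> ^ k * (\<Sum>j\<in>J2. c2 j powr q)))"
    using \<theta> c1(3) c2(3) unfolding v1_def v2_def by (intro mult_left_mono add_mono) auto
  also have "\<dots> = \<sigma> * \<theta> ^ Suc k * (\<Sum>j\<in>J. c j powr q)"
    unfolding csum by (simp add: algebra_simps)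
  finally have "\<sigma> * norm (\<Sum>j\<in>J. c j *\<^sub>R e j) powr q \<le> \<sigma> * \<theta> ^ Suc k * (\<Sum>j\<in>J. c j powr q)" .
  moreover have "0 \<le> c j" if "j \<in> J" for j
    using that ab' c1(1) c2(1) by (cases "j \<in> J1") (simp_all add: c_def J2_def)
  moreover have "\<exists>j\<in>J. 0 < c j"
  proof (cases "0 < a")
    case True
    obtain j where "j \<in> J1" "0 < c1 j" using c1(2) by blast
    then show ?thesis using True n1 J1(1) by (intro bexI[of _ j]) (auto simp: c_def a'_def)
  next
    case False
    then have "0 < b" using ab by simp
    moreover obtain j where "j \<in> J2" "0 < c2 j" using c2(2) by blast
    ultimately show ?thesis using n2 J2(1) by (intro bexI[of _ j]) (auto simp: c_J2 b'_def)
  qed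
  ultimately show ?case by (intro exI[of _ c]) blast
qed

lemma ex_basis_prefix:
  fixes Y :: "'a::banach_lattice set"
  assumes "sublattice Y" "dim Y \<ge> m" "0 < m"
  shows "\<exists>x. disjoint_pos {..<m} x \<and> (\<forall>j\<in>{..<m}. x j \<in> pos_sphere Y)"
proof -
  obtain x where x: "disjoint_pos {..<dim Y} x" "\<forall>i<dim Y. norm (x i) = 1" "x ` {..<dim Y} \<subseteq> Y"
    using finite_dim_sublattice_basis[OF assms(1) refl] assms(2,3) by auto
  have "disjoint_pos {..<m} x" using assms(2) by (intro disjoint_pos_subset[OF x(1)]) simp
  moreover have "x j \<in> pos_sphere Y" if "j < m" for j
    using x that assms(2) disjoint_posD(1)[OF x(1), of j] by (auto simp: pos_sphere_def)
  ultimately show ?thesis by (intro exI[of _ x]) simp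
qed

lemma ex_tree_family:
  fixes Y :: "'a::banach_lattice set"
  assumes Y: "sublattice Y" "2 ^ k \<le> dim Y" and q: "0 < q" and \<theta>: "0 \<le> \<theta>"
    and pair: "\<And>u v. u \<in> pos_sphere Y \<Longrightarrow> v \<in> pos_sphere Y \<Longrightarrow> inf u v = 0 \<Longrightarrow>
      \<exists>a b. 0 \<le> a \<and> 0 \<le> b \<and> 0 < a + b \<and>
        \<sigma> * norm (a *\<^sub>R u + b *\<^sub>R v) powr q \<le> \<sigma> * \<theta> * (a powr q + b powr q)"
  obtains e :: "nat \<Rightarrow> 'a" where "disjoint_pos {..<2 ^ k} e" "0 < (\<Sum>j<2 ^ k. norm (e j) powr q)"
    "\<sigma> * norm (\<Sum>j<2 ^ k. e j) powr q \<le> \<sigma> * \<theta> ^ k * (\<Sum>j<2 ^ k. norm (e j) powr q)"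
proof -
  obtain x :: "nat \<Rightarrow> 'a" where x: "disjoint_pos {..<2 ^ k} x" "\<forall>j\<in>{..<2 ^ k}. x j \<in> pos_sphere Y"
    using ex_basis_prefix[OF Y(1), of "2 ^ k"] Y(2) by (metis zero_less_numeral zero_less_power)
  have subY: "subspace Y" using Y(1) by (simp add: sublattice_def)
  have "\<exists>c. (\<forall>j\<in>{..<2 ^ k::nat}. 0 \<le> c j) \<and> (\<exists>j\<in>{..<2 ^ k}. 0 < c j) \<and>
      \<sigma> * norm (\<Sum>j<2 ^ k. c j *\<^sub>R x j) powr q \<le> \<sigma> * \<theta> ^ k * (\<Sum>j<2 ^ k. c j powr q)"
    by (rule pair_gain_iterates[OF subY q \<theta> pair]) (use x in simp_all)
  then obtain c where "(\<forall>j\<in>{..<2 ^ k::nat}. 0 \<le> c j) \<and> (\<exists>j\<in>{..<2 ^ k}. 0 < c j) \<and>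
      \<sigma> * norm (\<Sum>j<2 ^ k. c j *\<^sub>R x j) powr q \<le> \<sigma> * \<theta> ^ k * (\<Sum>j<2 ^ k. c j powr q)" ..
  then have c: "\<And>j. j < 2 ^ k \<Longrightarrow> 0 \<le> c j" "\<exists>j<2 ^ k. 0 < c j"
    "\<sigma> * norm (\<Sum>j<2 ^ k. c j *\<^sub>R x j) powr q \<le> \<sigma> * \<theta> ^ k * (\<Sum>j<2 ^ k. c j powr q)"
    by (simp_all add: Bex_def)
  have norms: "(\<Sum>j<2 ^ k. norm (c j *\<^sub>R x j) powr q) = (\<Sum>j<2 ^ k. c j powr q)"
    using x(2) c(1) by (intro sum.cong) (auto simp: pos_sphere_def)
  obtain j where j: "j < 2 ^ k" "0 < c j" using c(2) by blast
  have "c j powr q \<le> (\<Sum>j<2 ^ k. c j powr q)" using j by (intro member_le_sum) auto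
  then have pos: "0 < (\<Sum>j<2 ^ k. c j powr q)" using j by (smt (verit) powr_gt_zero)
  have "disjoint_pos {..<2 ^ k} (\<lambda>j. c j *\<^sub>R x j)"
    using c(1) by (intro disjoint_pos_scale[OF x(1)]) simp
  then show ?thesis using pos c(3) unfolding norms[symmetric] by (rule that)
qed

text \<open>A sublattice of dimension \<open>2^k\<close> in which every disjoint pair loses a factor \<open>\<theta>\<close> contains \<open>2^k\<close> disjoint
  vectors that lose \<open>\<theta>^k\<close>, more than the constant \<open>C\<close> permits. So some pair satisfies the estimate with a
  constant arbitrarily close to \<open>1\<close>.\<close>

lemma ex_pair_lower_estimate:
  assumes low: "lower_q TYPE('a::banach_lattice) q C" and q: "1 \<le> q" and C: "0 < C"
    and \<theta>: "0 < \<theta>" "\<theta> < 1"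
  shows "\<exists>N. \<forall>Y::'a set. sublattice Y \<longrightarrow> N \<le> dim Y \<longrightarrow>
    (\<exists>u v. u \<in> pos_sphere Y \<and> v \<in> pos_sphere Y \<and> inf u v = 0 \<and>
      (\<forall>a\<ge>0. \<forall>b\<ge>0. \<theta> * (a powr q + b powr q) \<le> norm (a *\<^sub>R u + b *\<^sub>R v) powr q))"
proof -
  obtain k where k: "\<theta> ^ k < 1 / C" using real_arch_pow_inv[of "1 / C" \<theta>] C \<theta> by auto
  show ?thesis
  proof (intro exI[of _ "2 ^ k"] allI impI, rule ccontr)
    fix Y :: "'a set" assume Y: "sublattice Y" "2 ^ k \<le> dim Y"
    assume neg: "\<not> (\<exists>u v. u \<in> pos_sphere Y \<and> v \<in> pos_sphere Y \<and> inf u v = 0 \<and>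
      (\<forall>a\<ge>0. \<forall>b\<ge>0. \<theta> * (a powr q + b powr q) \<le> norm (a *\<^sub>R u + b *\<^sub>R v) powr q))"
    have pair: "\<exists>a b. 0 \<le> a \<and> 0 \<le> b \<and> 0 < a + b \<and>
        1 * norm (a *\<^sub>R u + b *\<^sub>R v) powr q \<le> 1 * \<theta> * (a powr q + b powr q)"
      if uv: "u \<in> pos_sphere Y" "v \<in> pos_sphere Y" "inf u v = 0" for u v
    proof -
      obtain a b where ab: "0 \<le> a" "0 \<le> b" "norm (a *\<^sub>R u + b *\<^sub>R v) powr q < \<theta> * (a powr q + b powr q)"
        using neg uv by (meson not_le)
      moreover have "0 < a + b"
      proof (rule ccontr)
        assume "\<not> ?thesis"
        then have "a = 0" "b = 0" using ab by simp_all
        then show False using ab(3) by simp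
      qed
      ultimately show ?thesis by (intro exI[of _ a] exI[of _ b]) simp
    qed
    have q0: "0 < q" and \<theta>0: "0 \<le> \<theta>" using q \<theta> by simp_all
    obtain e :: "nat \<Rightarrow> 'a" where e: "disjoint_pos {..<2 ^ k} e" "0 < (\<Sum>j<2 ^ k. norm (e j) powr q)"
      "1 * norm (\<Sum>j<2 ^ k. e j) powr q \<le> 1 * \<theta> ^ k * (\<Sum>j<2 ^ k. norm (e j) powr q)"
      by (rule ex_tree_family[OF Y q0 \<theta>0 pair])
    let ?S = "\<Sum>j<2 ^ k. norm (e j) powr q"
    have "?S \<le> C * norm (\<Sum>j<2 ^ k. e j) powr q"
      using low[unfolded lower_q_def, rule_format, OF _ e(1)] by simp
    also have "\<dots> \<le> C * (\<theta> ^ k * ?S)" using e(3) C by (intro mult_left_mono) auto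
    also have "\<dots> < 1 * ?S" using k C e(2) unfolding mult.assoc[symmetric]
      by (intro mult_strict_right_mono) (simp_all add: field_simps)
    finally show False by simp
  qed
qed

lemma ex_pair_upper_estimate:
  assumes upp: "upper_q TYPE('a::banach_lattice) q C" and q: "1 \<le> q" and \<theta>: "1 < \<theta>"
  shows "\<exists>N. \<forall>Y::'a set. sublattice Y \<longrightarrow> N \<le> dim Y \<longrightarrow>
    (\<exists>u v. u \<in> pos_sphere Y \<and> v \<in> pos_sphere Y \<and> inf u v = 0 \<and> norm (u + v) powr q \<le> 2 * \<theta>)"
proof -
  obtain k where k: "C < \<theta> ^ k" using real_arch_pow[OF \<theta>] by blast
  show ?thesis
  proof (intro exI[of _ "2 ^ k"] allI impI, rule ccontr)
    fix Y :: "'a set" assume Y: "sublattice Y" "2 ^ k \<le> dim Y"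
    assume neg: "\<not> (\<exists>u v. u \<in> pos_sphere Y \<and> v \<in> pos_sphere Y \<and> inf u v = 0 \<and> norm (u + v) powr q \<le> 2 * \<theta>)"
    have pair: "\<exists>a b. 0 \<le> a \<and> 0 \<le> b \<and> 0 < a + b \<and>
        (- 1) * norm (a *\<^sub>R u + b *\<^sub>R v) powr q \<le> (- 1) * \<theta> * (a powr q + b powr q)"
      if uv: "u \<in> pos_sphere Y" "v \<in> pos_sphere Y" "inf u v = 0" for u v
    proof -
      have "\<not> norm (u + v) powr q \<le> 2 * \<theta>" using neg uv by metis
      then show ?thesis by (intro exI[of _ 1]) simp
    qed
    have q0: "0 < q" and \<theta>0: "0 \<le> \<theta>" using q \<theta> by simp_all
    obtain e :: "nat \<Rightarrow> 'a" where e: "disjoint_pos {..<2 ^ k} e" "0 < (\<Sum>j<2 ^ k. norm (e j) powr q)"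
      "(- 1) * norm (\<Sum>j<2 ^ k. e j) powr q \<le> (- 1) * \<theta> ^ k * (\<Sum>j<2 ^ k. norm (e j) powr q)"
      by (rule ex_tree_family[OF Y q0 \<theta>0 pair])
    let ?S = "\<Sum>j<2 ^ k. norm (e j) powr q"
    have "\<theta> ^ k * ?S \<le> norm (\<Sum>j<2 ^ k. e j) powr q" using e(3) by simp
    also have "\<dots> \<le> C * ?S"
      using upp[unfolded upper_q_def, rule_format, OF _ e(1)] by simp
    also have "C * ?S < \<theta> ^ k * ?S" using k e(2) by (intro mult_strict_right_mono)
    finally show False by simp
  qed
qed

section \<open>Two-dimensional sublattices\<close>

context
  fixes Y :: "'a::banach_lattice set" and u v :: 'a
  assumes Y: "sublattice Y" and uv: "u \<in> pos_sphere Y" "v \<in> pos_sphere Y" "inf u v = 0"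
begin

lemma uv_pos: "0 \<le> u" "0 \<le> v" "norm u = 1" "norm v = 1" "u \<in> Y" "v \<in> Y"
  using uv by (simp_all add: pos_sphere_def)

lemma uv_nonzero: "u \<noteq> 0" "v \<noteq> 0"
  using uv_pos(3,4) by auto

lemma pair_family: "disjoint_pos {..<2} (\<lambda>i::nat. if i = 0 then u else v)"
  using uv_pos uv(3) by (auto simp: disjoint_pos_def inf_commute less_2_cases_iff)

lemma pair_image: "(\<lambda>i::nat. if i = 0 then u else v) ` {..<2} = {u, v}"
  by (auto simp: lessThan_Suc numeral_2_eq_2)

lemma pair_span: "sublattice (span {u, v})" "span {u, v} \<subseteq> Y" "dim (span {u, v}) = 2"
proof -
  show "sublattice (span {u, v})" using sublattice_span[OF pair_family] unfolding pair_image by simp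
  show "span {u, v} \<subseteq> Y" using Y uv_pos by (intro span_minimal) (auto simp: sublattice_def)
  show "dim (span {u, v}) = 2" using dim_span_disjoint_pos[OF pair_family] uv_nonzero
    unfolding pair_image by auto
qed

lemma pair_span_nonnegE:
  assumes "x \<in> span {u, v}" "0 \<le> x"
  obtains a b where "0 \<le> a" "0 \<le> b" "x = a *\<^sub>R u + b *\<^sub>R v"
proof -
  obtain c :: "nat \<Rightarrow> real" where c: "x = (\<Sum>i<2. c i *\<^sub>R (if i = 0 then u else v))"
    using assms(1) span_disjoint_pos[OF pair_family] unfolding pair_image by auto
  have "0 \<le> c i" if "i < 2" for i
    using lincomb_nonnegD[OF pair_family _ assms(2)[unfolded c], of i] that uv_nonzero by auto
  moreover have "x = c 0 *\<^sub>R u + c 1 *\<^sub>R v" using c by (simp add: numeral_2_eq_2)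
  ultimately show ?thesis by (intro that[of "c 0" "c 1"]) auto
qed

text \<open>Every \<open>x\<close> in the positive unit ball lies below \<open>u + v\<close>.\<close>

lemma alpha_pair_le: "alpha (span {u, v}) \<le> norm (u + v)"
proof (rule alpha_le)
  have below: "x \<le> u + v" "0 \<le> x" if x: "x \<in> pos_ball (span {u, v})" for x
  proof -
    show "0 \<le> x" using x by (simp add: pos_ball_def)
    obtain a b where ab: "0 \<le> a" "0 \<le> b" "x = a *\<^sub>R u + b *\<^sub>R v"
      using x pair_span_nonnegE[of x] by (auto simp: pos_ball_def)
    have au: "0 \<le> a *\<^sub>R u" "0 \<le> b *\<^sub>R v" using ab uv_pos by (auto intro: scaleR_nonneg_nonneg)
    have "norm (a *\<^sub>R u) \<le> norm x" "norm (b *\<^sub>R v) \<le> norm x"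
      using au unfolding ab(3) by (intro norm_mono_pos; simp)+
    then have "a \<le> 1" "b \<le> 1" using x ab uv_pos by (auto simp: pos_ball_def)
    then have "a *\<^sub>R u \<le> 1 *\<^sub>R u" "b *\<^sub>R v \<le> 1 *\<^sub>R v" using uv_pos by (intro scaleR_right_mono; simp)+
    then show "x \<le> u + v" using ab(3) by (simp add: add_mono)
  qed
  fix x y assume "x \<in> pos_ball (span {u, v})" "y \<in> pos_ball (span {u, v})"
  then show "norm (sup x y) \<le> norm (u + v)"
    using below[of x] below[of y] by (intro norm_mono_pos) (auto intro: le_supI1)
qed (simp add: span_zero)

lemma norm_split_le:
  assumes q: "1 \<le> q" and \<theta>: "0 \<le> \<theta>" "\<theta> \<le> 1"
    and AB: "0 \<le> A" "0 \<le> B" and st: "0 \<le> s" "s \<le> t" "t \<le> 1"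
    and est: "\<theta> * (A powr q + B powr q) \<le> norm (A *\<^sub>R u + B *\<^sub>R v) powr q"
  shows "\<theta> * (norm ((s * A) *\<^sub>R u + (t * B) *\<^sub>R v) powr q
      + norm (((1 - s) * A) *\<^sub>R u + ((1 - t) * B) *\<^sub>R v) powr q) \<le> norm (A *\<^sub>R u + B *\<^sub>R v) powr q"
proof -
  define w where "w = A *\<^sub>R u + B *\<^sub>R v"
  let ?x = "(s * A) *\<^sub>R u + (t * B) *\<^sub>R v" and ?y = "((1 - s) * A) *\<^sub>R u + ((1 - t) * B) *\<^sub>R v"
  \<comment> \<open>the splitting is the convex combination of the extreme ones \<open>(w, 0)\<close>, \<open>(B v, A u)\<close> and \<open>(0, w)\<close> with weights \<open>s\<close>, \<open>t - s\<close>, \<open>1 - t\<close>\<close>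
  have "?x = s *\<^sub>R w + ((t - s) * B) *\<^sub>R v" "?y = (1 - t) *\<^sub>R w + ((t - s) * A) *\<^sub>R u"
    by (simp_all add: w_def algebra_simps)
  then have "norm ?x \<le> s * norm w + (t - s) * B" "norm ?y \<le> (1 - t) * norm w + (t - s) * A"
    using norm_triangle_ineq[of "s *\<^sub>R w" "((t - s) * B) *\<^sub>R v"]
      norm_triangle_ineq[of "(1 - t) *\<^sub>R w" "((t - s) * A) *\<^sub>R u"] st AB uv_pos
    by (simp_all add: abs_mult)
  then have "norm ?x powr q \<le> (s * norm w + (t - s) * B) powr q"
    "norm ?y powr q \<le> ((1 - t) * norm w + (t - s) * A) powr q"
    using q by (intro powr_mono2; simp)+
  moreover have "(s * norm w + (t - s) * B) powr q \<le> s * norm w powr q + (t - s) * B powr q"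
    using q AB st by (intro powr_convex_combination_le) auto
  moreover have "((1 - t) * norm w + (t - s) * A) powr q \<le> (1 - t) * norm w powr q + (t - s) * A powr q"
    using q AB st by (intro powr_convex_combination_le) auto
  ultimately have "norm ?x powr q + norm ?y powr q
      \<le> (1 - (t - s)) * norm w powr q + (t - s) * (A powr q + B powr q)"
    by (simp add: algebra_simps)
  then have "\<theta> * (norm ?x powr q + norm ?y powr q)
      \<le> \<theta> * ((1 - (t - s)) * norm w powr q + (t - s) * (A powr q + B powr q))"
    using \<theta>(1) by (rule mult_left_mono)
  also have "\<dots> = (1 - (t - s)) * (\<theta> * norm w powr q) + (t - s) * (\<theta> * (A powr q + B powr q))"
    by (simp add: algebra_simps)
  also have "\<dots> \<le> (1 - (t - s)) * norm w powr q + (t - s) * norm w powr q"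
    using st \<theta> est by (intro add_mono mult_left_mono) (auto simp: w_def mult_left_le_one_le)
  also have "\<dots> = norm w powr q" by (simp add: algebra_simps)
  finally show ?thesis by (simp add: w_def)
qed

end

text \<open>A lower \<open>q\<close>-estimate on the disjoint vectors of a two-dimensional sublattice extends to all
  positive \<open>x\<close>, \<open>y\<close>: among the positive splittings of \<open>w = x + y\<close>, the convex function
  \<open>\<parallel>x\<parallel>\<^sup>q + \<parallel>y\<parallel>\<^sup>q\<close> is largest at an extreme one, where each coordinate of \<open>w\<close> goes entirely to \<open>x\<close>
  or to \<open>y\<close>.\<close>

lemma lambda_plus_pair_ge:
  fixes Y :: "'a::banach_lattice set"
  assumes Y: "sublattice Y" and uv: "u \<in> pos_sphere Y" "v \<in> pos_sphere Y" "inf u v = 0"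
    and q: "1 \<le> q" and \<theta>: "0 \<le> \<theta>" "\<theta> \<le> 1"
    and est: "\<And>a b. 0 \<le> a \<Longrightarrow> 0 \<le> b \<Longrightarrow> \<theta> * (a powr q + b powr q) \<le> norm (a *\<^sub>R u + b *\<^sub>R v) powr q"
  shows "(2 * \<theta>) powr (1 / q) \<le> lambda_plus (span {u, v})"
proof (rule lambda_plus_ge)
  note pair = pair_span[OF Y uv]
  show "sublattice (span {u, v})" "2 \<le> dim (span {u, v})" using pair by simp_all
  fix x y assume xy: "x \<in> pos_sphere (span {u, v})" "y \<in> pos_sphere (span {u, v})"
  obtain x1 x2 where x: "0 \<le> x1" "0 \<le> x2" "x = x1 *\<^sub>R u + x2 *\<^sub>R v"
    using pair_span_nonnegE[OF Y uv, of x] xy by (auto simp: pos_sphere_def)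
  obtain y1 y2 where y: "0 \<le> y1" "0 \<le> y2" "y = y1 *\<^sub>R u + y2 *\<^sub>R v"
    using pair_span_nonnegE[OF Y uv, of y] xy by (auto simp: pos_sphere_def)
  define A B where "A = x1 + y1" and "B = x2 + y2"
  have AB: "0 \<le> A" "0 \<le> B" using x y by (simp_all add: A_def B_def)
  have ratio: "\<exists>s. 0 \<le> s \<and> s \<le> 1 \<and> a = s * (a + b) \<and> b = (1 - s) * (a + b)" if "0 \<le> a" "0 \<le> b" for a b :: real
  proof (cases "a + b = 0")
    case True
    then have "a = 0" "b = 0" using that by simp_all
    then show ?thesis by (intro exI[of _ 0]) simp
  next
    case False
    then show ?thesis using that by (intro exI[of _ "a / (a + b)"]) (simp add: field_simps)
  qed
  obtain s where s: "0 \<le> s" "s \<le> 1" "x1 = s * A" "y1 = (1 - s) * A"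
    using ratio[OF x(1) y(1)] unfolding A_def by blast
  obtain t where t: "0 \<le> t" "t \<le> 1" "x2 = t * B" "y2 = (1 - t) * B"
    using ratio[OF x(2) y(2)] unfolding B_def by blast
  have w: "x + y = A *\<^sub>R u + B *\<^sub>R v" by (simp add: x y A_def B_def scaleR_add_left)
  have "\<theta> * (norm x powr q + norm y powr q) \<le> norm (x + y) powr q"
  proof (cases "s \<le> t")
    case True
    show ?thesis
      using norm_split_le[OF Y uv q \<theta> AB s(1) True t(2) est[OF AB]] unfolding w unfolding x(3) y(3) s(3,4) t(3,4) .
  next
    case False
    have vu: "inf v u = 0" using uv(3) by (simp add: inf_commute)
    have "\<theta> * (B powr q + A powr q) \<le> norm (B *\<^sub>R v + A *\<^sub>R u) powr q"
      using est[OF AB] by (simp add: add.commute)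
    then show ?thesis
      using norm_split_le[OF Y uv(2,1) vu q \<theta> AB(2,1) t(1) _ s(2)] False
      unfolding w unfolding x(3) y(3) s(3,4) t(3,4) by (simp add: add.commute)
  qed
  then have "(2 * \<theta>) powr (1 / q) \<le> (norm (x + y) powr q) powr (1 / q)"
    using xy q \<theta> by (intro powr_mono2) (auto simp: pos_sphere_def mult.commute)
  then show "(2 * \<theta>) powr (1 / q) \<le> norm (x + y)" using q by (simp add: powr_powr)
qed

section \<open>Families that are extremal for an estimate\<close>

text \<open>Take a violating family of least cardinality. Replacing a subfamily with several members by its sum gives
  a smaller family, which no longer violates the estimate; so the estimate with constant \<open>1\<close> must fail, or hold
  with equality, on every subfamily. With \<open>\<sigma> = 1\<close> this concerns lower estimates with constant \<open>c\<close>, with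
  \<open>\<sigma> = -1\<close> upper estimates with constant \<open>1/c\<close>.\<close>

lemma minimal_violating_family:
  fixes \<sigma> c q :: real
  assumes q: "0 < q"
    and ex: "\<exists>(I::nat set) x::nat \<Rightarrow> 'a::banach_lattice. finite I \<and> disjoint_pos I x \<and>
      c * (\<sigma> * norm (\<Sum>i\<in>I. x i) powr q) < \<sigma> * (\<Sum>i\<in>I. norm (x i) powr q)"
  obtains I and x :: "nat \<Rightarrow> 'a::banach_lattice" where "finite I" "disjoint_pos I x"
    "c * (\<sigma> * norm (\<Sum>i\<in>I. x i) powr q) < \<sigma> * (\<Sum>i\<in>I. norm (x i) powr q)"
    "\<And>i. i \<in> I \<Longrightarrow> x i \<noteq> 0"
    "\<And>A. A \<subseteq> I \<Longrightarrow> A \<noteq> {} \<Longrightarrow> \<sigma> * norm (\<Sum>i\<in>A. x i) powr q \<le> \<sigma> * (\<Sum>i\<in>A. norm (x i) powr q)"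
proof -
  define P where "P I x \<longleftrightarrow> finite I \<and> disjoint_pos I x \<and>
      c * (\<sigma> * norm (\<Sum>i\<in>I. x i) powr q) < \<sigma> * (\<Sum>i\<in>I. norm (x i) powr q)"
    for I :: "nat set" and x :: "nat \<Rightarrow> 'a"
  obtain n0 where n0: "\<exists>I x. P I x \<and> card I = n0" using ex unfolding P_def by blast
  define n where "n = (LEAST n. \<exists>I x. P I x \<and> card I = n)"
  have "\<exists>I x. P I x \<and> card I = n" unfolding n_def by (rule LeastI[of _ n0]) (rule n0)
  then obtain I x where I: "P I x" "card I = n" by (elim exE conjE)
  have least: "n \<le> card I'" if "P I' x'" for I' x'
    unfolding n_def using that by (intro Least_le exI[of _ I'] exI[of _ x']) simp
  have Pd: "finite I" "disjoint_pos I x"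
    "c * (\<sigma> * norm (\<Sum>i\<in>I. x i) powr q) < \<sigma> * (\<Sum>i\<in>I. norm (x i) powr q)"
    using I(1) by (simp_all add: P_def)
  have nz: "x i \<noteq> 0" if i: "i \<in> I" for i
  proof
    assume 0: "x i = 0"
    have "P (I - {i}) x"
      using Pd i 0 disjoint_pos_subset[OF Pd(2), of "I - {i}"] by (simp add: P_def sum.remove[of I i])
    from least[OF this] show False using I(2) Pd(1) i card_Diff1_less[of I i] by simp
  qed
  have merge: "\<sigma> * norm (\<Sum>i\<in>A. x i) powr q \<le> \<sigma> * (\<Sum>i\<in>A. norm (x i) powr q)"
    if A: "A \<subseteq> I" "A \<noteq> {}" for A
  proof (rule ccontr)
    assume neg: "\<not> ?thesis"
    have finA: "finite A" using A(1) Pd(1) by (rule finite_subset)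
    obtain a where a: "a \<in> A" using A(2) by blast
    have cardA: "1 < card A"
    proof (rule ccontr)
      assume "\<not> 1 < card A"
      moreover have "card A \<noteq> 0" using finA a by auto
      ultimately have "card A = 1" by simp
      then have "A = {a}" using a by (auto simp: card_1_singleton_iff)
      then show False using neg by simp
    qed
    define x' where "x' = x(a := \<Sum>i\<in>A. x i)"
    define I' where "I' = insert a (I - A)"
    have finI': "finite (I - A)" using Pd(1) by simp
    have off: "x' i = x i" if "i \<in> I - A" for i using that a by (auto simp: x'_def)
    have pos: "0 \<le> (\<Sum>i\<in>A. x i)"
      using A(1) Pd(2) by (intro sum_nonneg) (auto intro: disjoint_posD(1))
    have orth: "inf (\<Sum>i\<in>A. x i) (x j) = 0" if j: "j \<in> I - A" for j
      using disjoint_pos_sums[OF Pd(2) A(1), of "{j}"] j finA by auto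
    have "disjoint_pos I' x'"
      unfolding disjoint_pos_def
    proof (intro conjI ballI impI)
      fix i assume "i \<in> I'"
      then show "0 \<le> x' i" using pos disjoint_posD(1)[OF Pd(2)] by (auto simp: x'_def I'_def)
    next
      fix i j assume ij: "i \<in> I'" "j \<in> I'" "i \<noteq> j"
      then consider "i = a" "j \<in> I - A" | "j = a" "i \<in> I - A" | "i \<in> I - A" "j \<in> I - A"
        by (auto simp: I'_def)
      then show "inf (x' i) (x' j) = 0"
      proof cases
        case 1
        then show ?thesis using orth[of j] off[of j] by (simp add: x'_def)
      next
        case 2
        then show ?thesis using orth[of i] off[of i] by (simp add: x'_def inf_commute)
      next
        case 3
        then show ?thesis using off disjoint_posD(2)[OF Pd(2), of i j] ij(3) by simp
      qed
    qed
    moreover have sums: "(\<Sum>i\<in>I'. f (x' i)) = f (\<Sum>i\<in>A. x i) + (\<Sum>i\<in>I - A. f (x i))" for f :: "'a \<Rightarrow> 'b::comm_monoid_add"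
    proof -
      have "a \<notin> I - A" using a by simp
      then have "(\<Sum>i\<in>I'. f (x' i)) = f (x' a) + (\<Sum>i\<in>I - A. f (x' i))"
        unfolding I'_def using finI' by simp
      also have "(\<Sum>i\<in>I - A. f (x' i)) = (\<Sum>i\<in>I - A. f (x i))" by (rule sum.cong) (simp_all add: off)
      finally show ?thesis by (simp add: x'_def)
    qed
    have split: "(\<Sum>i\<in>I. f (x i)) = (\<Sum>i\<in>A. f (x i)) + (\<Sum>i\<in>I - A. f (x i))" for f :: "'a \<Rightarrow> 'b::comm_monoid_add"
      by (metis A(1) Pd(1) add.commute sum.subset_diff)
    have "(\<Sum>i\<in>I'. x' i) = (\<Sum>i\<in>I. x i)" using sums[of "\<lambda>v. v"] split[of "\<lambda>v. v"] by simp
    moreover have "\<sigma> * (\<Sum>i\<in>I. norm (x i) powr q) \<le> \<sigma> * (\<Sum>i\<in>I'. norm (x' i) powr q)"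
      using neg sums[of "\<lambda>v. norm v powr q"] split[of "\<lambda>v. norm v powr q"] by (simp add: distrib_left)
    ultimately have "P I' x'" using Pd(3) finI' by (simp add: P_def I'_def)
    from least[OF this] have "card I \<le> card I'" using I(2) by simp
    also have "card I' \<le> Suc (card (I - A))" unfolding I'_def by (rule card_insert_le_m1) simp_all
    also have "card (I - A) = card I - card A" using A(1) finA by (simp add: card_Diff_subset)
    finally show False using cardA card_mono[OF Pd(1) A(1)] by simp
  qed
  show ?thesis using that[OF Pd nz merge] .
qed

text \<open>If at most \<open>R\<close> of the values lay in each dyadic interval below \<open>T\<close>, the sum would be at most
  \<open>R\<close> times a geometric series.\<close>

lemma ex_dyadic_block:
  fixes g :: "'i \<Rightarrow> real"
  assumes I: "finite I" and g: "\<And>i. i \<in> I \<Longrightarrow> 0 < g i" "\<And>i. i \<in> I \<Longrightarrow> g i \<le> T"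
    and big: "2 * real R * T < (\<Sum>i\<in>I. g i)" and T: "0 \<le> T"
  shows "\<exists>J \<tau>. J \<subseteq> I \<and> card J = R \<and> 0 < \<tau> \<and> (\<forall>i\<in>J. \<tau> \<le> g i \<and> g i \<le> 2 * \<tau>)"
proof -
  define l where "l i = nat \<lfloor>log 2 (T / g i)\<rfloor>" for i
  have l: "T / 2 ^ (Suc (l i)) \<le> g i" "g i \<le> T / 2 ^ l i" if i: "i \<in> I" for i
  proof -
    have Tpos: "0 < T" "1 \<le> T / g i" using g[OF i] by (simp_all add: field_simps)
    then have "0 \<le> log 2 (T / g i)" by simp
    then have fl: "real (l i) \<le> log 2 (T / g i)" "log 2 (T / g i) \<le> real (Suc (l i))"
      unfolding l_def by linarith+
    have "2 powr real (l i) \<le> T / g i" using fl(1) Tpos by (simp add: le_log_iff)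
    then show "g i \<le> T / 2 ^ l i" using g[OF i] by (simp add: powr_realpow field_simps)
    have "T / g i \<le> 2 powr real (Suc (l i))" using fl(2) Tpos g[OF i] by (subst (asm) log_le_iff) auto
    then show "T / 2 ^ (Suc (l i)) \<le> g i"
      using g[OF i] by (simp add: powr_realpow field_simps del: power_Suc of_nat_Suc)
  qed
  have "\<exists>m. R \<le> card {i\<in>I. l i = m}"
  proof (rule ccontr)
    assume "\<nexists>m. R \<le> card {i\<in>I. l i = m}"
    then have small: "card {i\<in>I. l i = m} \<le> R" for m by (meson nat_le_linear)
    have "(\<Sum>i\<in>I. g i) \<le> (\<Sum>i\<in>I. T / 2 ^ l i)" using l by (intro sum_mono) auto
    also have "\<dots> = (\<Sum>m\<in>l ` I. \<Sum>i\<in>{i\<in>I. l i = m}. T / 2 ^ l i)"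
      using I by (rule sum.image_gen)
    also have "\<dots> = (\<Sum>m\<in>l ` I. real (card {i\<in>I. l i = m}) * (T / 2 ^ m))"
      by (intro sum.cong) simp_all
    also have "\<dots> \<le> (\<Sum>m\<in>l ` I. real R * (T / 2 ^ m))"
      using small T by (intro sum_mono mult_right_mono) auto
    also have "\<dots> = real R * T * (\<Sum>m\<in>l ` I. (1 / 2) ^ m)"
      by (simp add: sum_distrib_left power_one_over field_simps)
    also have "\<dots> \<le> real R * T * 2"
    proof (intro mult_left_mono)
      have "(\<Sum>m\<in>l ` I. (1 / 2 :: real) ^ m) \<le> (\<Sum>m. (1 / 2) ^ m)"
        using I by (intro sum_le_suminf) (auto simp: summable_geometric)
      then show "(\<Sum>m\<in>l ` I. (1 / 2 :: real) ^ m) \<le> 2" by (simp add: suminf_geometric)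
    qed (use T in auto)
    finally show False using big by simp
  qed
  then obtain m where m: "R \<le> card {i\<in>I. l i = m}" ..
  obtain J where J: "J \<subseteq> {i\<in>I. l i = m}" "card J = R" using obtain_subset_with_card_n[OF m] by metis
  show ?thesis
  proof (cases "R = 0")
    case True
    then show ?thesis by (intro exI[of _ "{}"] exI[of _ 1]) simp
  next
    case False
    then obtain j where "j \<in> J" using J(2) by fastforce
    then have "j \<in> I" using J(1) by blast
    then have "0 < T" using g[of j] by simp
    then show ?thesis using J l
      by (intro exI[of _ J] exI[of _ "T / 2 ^ Suc m"]) (auto simp: subset_iff)
  qed
qed

lemma normalize_block:
  fixes x :: "nat \<Rightarrow> 'a::banach_lattice"
  assumes x: "disjoint_pos I x" "\<And>i. i \<in> I \<Longrightarrow> x i \<noteq> 0" and J: "J \<subseteq> I" "finite J" "card J = R"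
    and \<tau>: "0 < \<tau>" "\<And>i. i \<in> J \<Longrightarrow> \<tau> \<le> norm (x i)" "\<And>i. i \<in> J \<Longrightarrow> norm (x i) \<le> \<tau>'"
  obtains y :: "nat \<Rightarrow> 'a" and f where "disjoint_pos {..<R} y" "\<And>i. i < R \<Longrightarrow> norm (y i) = 1"
    "inj_on f {..<R}" "f ` {..<R} = J"
    "\<And>A. A \<subseteq> {..<R} \<Longrightarrow> \<tau> * norm (\<Sum>i\<in>A. y i) \<le> norm (\<Sum>i\<in>f ` A. x i)"
    "\<And>A. A \<subseteq> {..<R} \<Longrightarrow> norm (\<Sum>i\<in>f ` A. x i) \<le> \<tau>' * norm (\<Sum>i\<in>A. y i)"
proof -
  obtain f where "bij_betw f {..<R} J" using ex_bij_lessThan[OF J(2)] J(3) by auto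
  then have f: "inj_on f {..<R}" "f ` {..<R} = J" by (simp_all add: bij_betw_def)
  define y where "y i = (1 / norm (x (f i))) *\<^sub>R x (f i)" for i
  have fJ: "f i \<in> J" "f i \<in> I" if "i < R" for i using f(2) J(1) that by auto
  have y: "disjoint_pos {..<R} y" unfolding y_def
    using f J(1) by (intro disjoint_pos_scale disjoint_pos_compose[OF x(1)]) auto
  have n: "norm (y i) = 1" if "i < R" for i using x(2)[OF fJ(2)[OF that]] by (simp add: y_def)
  have xy: "x (f i) = norm (x (f i)) *\<^sub>R y i" if "i < R" for i
    using x(2)[OF fJ(2)[OF that]] by (simp add: y_def)
  have sum: "(\<Sum>i\<in>f ` A. x i) = (\<Sum>i\<in>A. norm (x (f i)) *\<^sub>R y i)" if A: "A \<subseteq> {..<R}" for A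
  proof -
    have "(\<Sum>i\<in>f ` A. x i) = (\<Sum>i\<in>A. x (f i))"
      using sum.reindex[OF inj_on_subset[OF f(1) A], of x] by simp
    also have "\<dots> = (\<Sum>i\<in>A. norm (x (f i)) *\<^sub>R y i)" using A xy by (intro sum.cong) auto
    finally show ?thesis .
  qed
  have const: "norm (\<Sum>i\<in>A. t *\<^sub>R y i) = t * norm (\<Sum>i\<in>A. y i)" if "0 \<le> t" for t A
    using that by (simp add: scaleR_sum_right[symmetric])
  show ?thesis
  proof (rule that[OF y n f])
    fix A assume A: "A \<subseteq> {..<R}"
    note d = disjoint_pos_subset[OF y A]
    have \<tau>': "0 \<le> \<tau>'" if A0: "A \<noteq> {}"
    proof -
      obtain i where "i \<in> A" using A0 by blast
      then have "\<tau> \<le> norm (x (f i))" "norm (x (f i)) \<le> \<tau>'" using \<tau>(2,3) fJ A by auto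
      then show ?thesis using \<tau>(1) by simp
    qed
    have "norm (\<Sum>i\<in>A. \<tau> *\<^sub>R y i) \<le> norm (\<Sum>i\<in>A. norm (x (f i)) *\<^sub>R y i)"
      using \<tau>(1,2) fJ A by (intro norm_lincomb_mono[OF d]) auto
    then show "\<tau> * norm (\<Sum>i\<in>A. y i) \<le> norm (\<Sum>i\<in>f ` A. x i)"
      using \<tau>(1) by (simp only: sum[OF A] const less_imp_le)
    have le: "norm (\<Sum>i\<in>A. norm (x (f i)) *\<^sub>R y i) \<le> norm (\<Sum>i\<in>A. \<tau>' *\<^sub>R y i)"
      using \<tau>(3) fJ A by (intro norm_lincomb_mono[OF d]) auto
    show "norm (\<Sum>i\<in>f ` A. x i) \<le> \<tau>' * norm (\<Sum>i\<in>A. y i)"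
    proof (cases "A = {}")
      case False
      show ?thesis using le unfolding sum[OF A] const[OF \<tau>'[OF False]] .
    qed simp
  qed
qed

text \<open>When the lower \<open>q\<close>-estimate fails badly, a violating family of least cardinality admits no
  profitable merging of members, so all its subfamilies satisfy the reverse inequality; a dyadic
  block of it consists of members of comparable norm.\<close>

lemma family_of_lower_failure:
  assumes fail: "\<not> lower_q TYPE('a::banach_lattice) q (2 * real R)" and q: "1 \<le> q"
  shows "\<exists>y::nat \<Rightarrow> 'a. disjoint_pos {..<R} y \<and> (\<forall>i<R. norm (y i) = 1) \<and>
    (\<forall>A\<subseteq>{..<R}. A \<noteq> {} \<longrightarrow> norm (\<Sum>i\<in>A. y i) \<le> 2 * real (card A) powr (1 / q))"
proof -
  have q0: "0 < q" using q by simp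
  have "\<exists>(I::nat set) x::nat \<Rightarrow> 'a. finite I \<and> disjoint_pos I x \<and>
      2 * real R * (1 * norm (\<Sum>i\<in>I. x i) powr q) < 1 * (\<Sum>i\<in>I. norm (x i) powr q)"
    using fail unfolding lower_q_def by (simp add: not_le)
  from minimal_violating_family[OF q0 this] obtain I and x :: "nat \<Rightarrow> 'a" where I: "finite I" "disjoint_pos I x"
    "2 * real R * (1 * norm (\<Sum>i\<in>I. x i) powr q) < 1 * (\<Sum>i\<in>I. norm (x i) powr q)"
    "\<And>i. i \<in> I \<Longrightarrow> x i \<noteq> 0"
    "\<And>A. A \<subseteq> I \<Longrightarrow> A \<noteq> {} \<Longrightarrow> 1 * norm (\<Sum>i\<in>A. x i) powr q \<le> 1 * (\<Sum>i\<in>A. norm (x i) powr q)"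
    by metis
  have le: "norm (x i) powr q \<le> norm (\<Sum>i\<in>I. x i) powr q" if "i \<in> I" for i
    using norm_term_le_lincomb[OF I(2,1), of "\<lambda>_. 1" i] that q by (intro powr_mono2) auto
  have "\<exists>J \<tau>. J \<subseteq> I \<and> card J = R \<and> 0 < \<tau> \<and> (\<forall>i\<in>J. \<tau> \<le> norm (x i) powr q \<and> norm (x i) powr q \<le> 2 * \<tau>)"
    by (rule ex_dyadic_block[OF I(1) _ le]) (use I(3,4) in auto)
  then obtain J \<tau> where J: "J \<subseteq> I" "card J = R" "0 < \<tau>"
    and J\<tau>: "\<And>i. i \<in> J \<Longrightarrow> \<tau> \<le> norm (x i) powr q" "\<And>i. i \<in> J \<Longrightarrow> norm (x i) powr q \<le> 2 * \<tau>"
    by (elim exE conjE) simp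
  have root: "norm (x i) = (norm (x i) powr q) powr (1 / q)" for i using q0 by (simp add: powr_powr)
  have bounds: "\<tau> powr (1 / q) \<le> norm (x i)" "norm (x i) \<le> (2 * \<tau>) powr (1 / q)" if "i \<in> J" for i
    using powr_mono2[of "1 / q" \<tau> "norm (x i) powr q"] powr_mono2[of "1 / q" "norm (x i) powr q" "2 * \<tau>"]
      J\<tau>[OF that] J(3) q0 root[of i] by simp_all
  have finJ: "finite J" using J(1) I(1) by (rule finite_subset)
  have "0 < \<tau> powr (1 / q)" using J(3) by simp
  from normalize_block[OF I(2,4) J(1) finJ J(2) this bounds] obtain y :: "nat \<Rightarrow> 'a" and f where
    y: "disjoint_pos {..<R} y" "\<And>i. i < R \<Longrightarrow> norm (y i) = 1" and f: "inj_on f {..<R}" "f ` {..<R} = J"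
    and low: "\<And>A. A \<subseteq> {..<R} \<Longrightarrow> \<tau> powr (1 / q) * norm (\<Sum>i\<in>A. y i) \<le> norm (\<Sum>i\<in>f ` A. x i)"
    by metis
  have "norm (\<Sum>i\<in>A. y i) \<le> 2 * real (card A) powr (1 / q)" if A: "A \<subseteq> {..<R}" "A \<noteq> {}" for A
  proof -
    have fA: "f ` A \<subseteq> J" "f ` A \<noteq> {}" "card (f ` A) = card A"
      using A f by (auto intro: card_image inj_on_subset)
    have "norm (\<Sum>i\<in>f ` A. x i) powr q \<le> (\<Sum>i\<in>f ` A. norm (x i) powr q)"
      using I(5)[of "f ` A"] fA J(1) by simp
    also have "\<dots> \<le> (\<Sum>i\<in>f ` A. 2 * \<tau>)" using J\<tau>(2) fA(1) by (intro sum_mono) auto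
    also have "\<dots> = real (card A) * (2 * \<tau>)" using fA(3) by simp
    finally have "(norm (\<Sum>i\<in>f ` A. x i) powr q) powr (1 / q) \<le> (real (card A) * (2 * \<tau>)) powr (1 / q)"
      using q0 by (intro powr_mono2) auto
    then have "norm (\<Sum>i\<in>f ` A. x i) \<le> real (card A) powr (1 / q) * 2 powr (1 / q) * \<tau> powr (1 / q)"
      using q0 by (simp add: powr_powr powr_mult)
    with low[OF A(1)] have "\<tau> powr (1 / q) * norm (\<Sum>i\<in>A. y i)
        \<le> \<tau> powr (1 / q) * (real (card A) powr (1 / q) * 2 powr (1 / q))" by (simp add: mult_ac)
    then have "norm (\<Sum>i\<in>A. y i) \<le> real (card A) powr (1 / q) * 2 powr (1 / q)" using J(3) by simp
    also have "\<dots> \<le> real (card A) powr (1 / q) * 2 powr 1" using q by (intro mult_left_mono powr_mono) auto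
    finally show ?thesis by simp
  qed
  then show ?thesis using y by (intro exI[of _ y]) simp
qed

text \<open>The dual statement. Here the dyadic block comes from the triangle inequality: the norms themselves
  have a sum much larger than their \<open>\<ell>\<^sub>q\<close>-norm.\<close>

lemma family_of_upper_failure:
  assumes fail: "\<not> upper_q TYPE('a::banach_lattice) q ((1 + 2 * real R) powr q)" and q: "1 \<le> q"
  shows "\<exists>y::nat \<Rightarrow> 'a. disjoint_pos {..<R} y \<and> (\<forall>i<R. norm (y i) = 1) \<and>
    (\<forall>A\<subseteq>{..<R}. A \<noteq> {} \<longrightarrow> real (card A) powr (1 / q) \<le> 2 * norm (\<Sum>i\<in>A. y i))"
proof -
  have q0: "0 < q" using q by simp
  define C where "C = (1 + 2 * real R) powr q"
  have C: "0 < C" by (simp add: C_def)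
  have "\<exists>(I::nat set) x::nat \<Rightarrow> 'a. finite I \<and> disjoint_pos I x \<and>
      C * (\<Sum>i\<in>I. norm (x i) powr q) < norm (\<Sum>i\<in>I. x i) powr q"
    using fail unfolding upper_q_def C_def by (simp add: not_le)
  then have "\<exists>(I::nat set) x::nat \<Rightarrow> 'a. finite I \<and> disjoint_pos I x \<and>
      (1 / C) * ((- 1) * norm (\<Sum>i\<in>I. x i) powr q) < (- 1) * (\<Sum>i\<in>I. norm (x i) powr q)"
    using C by (simp add: field_simps)
  from minimal_violating_family[OF q0 this] obtain I and x :: "nat \<Rightarrow> 'a" where I: "finite I" "disjoint_pos I x"
    "(1 / C) * ((- 1) * norm (\<Sum>i\<in>I. x i) powr q) < (- 1) * (\<Sum>i\<in>I. norm (x i) powr q)"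
    "\<And>i. i \<in> I \<Longrightarrow> x i \<noteq> 0"
    "\<And>A. A \<subseteq> I \<Longrightarrow> A \<noteq> {} \<Longrightarrow> (- 1) * norm (\<Sum>i\<in>A. x i) powr q \<le> (- 1) * (\<Sum>i\<in>A. norm (x i) powr q)"
    by metis
  have viol: "C * (\<Sum>i\<in>I. norm (x i) powr q) < norm (\<Sum>i\<in>I. x i) powr q"
    using I(3) C by (simp add: field_simps)
  define T where "T = (\<Sum>i\<in>I. norm (x i) powr q) powr (1 / q)"
  have T0: "0 \<le> T" by (simp add: T_def)
  have le: "norm (x i) \<le> T" if "i \<in> I" for i
  proof -
    have "norm (x i) powr q \<le> (\<Sum>i\<in>I. norm (x i) powr q)" using that I(1) by (intro member_le_sum) auto
    then have "(norm (x i) powr q) powr (1 / q) \<le> T" unfolding T_def using q0 by (intro powr_mono2) auto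
    then show ?thesis using q0 by (simp add: powr_powr)
  qed
  have big: "2 * real R * T < (\<Sum>i\<in>I. norm (x i))"
  proof -
    have "(C * (\<Sum>i\<in>I. norm (x i) powr q)) powr (1 / q) < (norm (\<Sum>i\<in>I. x i) powr q) powr (1 / q)"
      using viol q0 C by (intro powr_less_mono2) (auto intro!: mult_nonneg_nonneg sum_nonneg)
    then have "(1 + 2 * real R) * T < norm (\<Sum>i\<in>I. x i)"
      using q0 by (simp add: powr_mult powr_powr C_def T_def)
    also have "\<dots> \<le> (\<Sum>i\<in>I. norm (x i))" by (rule norm_sum)
    finally show ?thesis using T0 by (simp add: algebra_simps)
  qed
  have "\<exists>J \<tau>. J \<subseteq> I \<and> card J = R \<and> 0 < \<tau> \<and> (\<forall>i\<in>J. \<tau> \<le> norm (x i) \<and> norm (x i) \<le> 2 * \<tau>)"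
    by (rule ex_dyadic_block[OF I(1) _ le big T0]) (use I(4) in auto)
  then obtain J \<tau> where J: "J \<subseteq> I" "card J = R" "0 < \<tau>"
    and bounds: "\<And>i. i \<in> J \<Longrightarrow> \<tau> \<le> norm (x i)" "\<And>i. i \<in> J \<Longrightarrow> norm (x i) \<le> 2 * \<tau>"
    by (elim exE conjE) simp
  have finJ: "finite J" using J(1) I(1) by (rule finite_subset)
  from normalize_block[OF I(2,4) J(1) finJ J(2,3) bounds] obtain y :: "nat \<Rightarrow> 'a" and f where
    y: "disjoint_pos {..<R} y" "\<And>i. i < R \<Longrightarrow> norm (y i) = 1" and f: "inj_on f {..<R}" "f ` {..<R} = J"
    and upp: "\<And>A. A \<subseteq> {..<R} \<Longrightarrow> norm (\<Sum>i\<in>f ` A. x i) \<le> 2 * \<tau> * norm (\<Sum>i\<in>A. y i)"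
    by metis
  have "real (card A) powr (1 / q) \<le> 2 * norm (\<Sum>i\<in>A. y i)" if A: "A \<subseteq> {..<R}" "A \<noteq> {}" for A
  proof -
    have fA: "f ` A \<subseteq> J" "f ` A \<noteq> {}" "card (f ` A) = card A"
      using A f by (auto intro: card_image inj_on_subset)
    have "real (card A) * \<tau> powr q = (\<Sum>i\<in>f ` A. \<tau> powr q)" using fA(3) by simp
    also have "\<dots> \<le> (\<Sum>i\<in>f ` A. norm (x i) powr q)"
      using bounds(1) fA(1) J(3) q0 by (intro sum_mono powr_mono2) auto
    also have "\<dots> \<le> norm (\<Sum>i\<in>f ` A. x i) powr q" using I(5)[of "f ` A"] fA J(1) by simp
    finally have "(real (card A) * \<tau> powr q) powr (1 / q) \<le> (norm (\<Sum>i\<in>f ` A. x i) powr q) powr (1 / q)"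
      using q0 by (intro powr_mono2) auto
    then have "real (card A) powr (1 / q) * \<tau> \<le> norm (\<Sum>i\<in>f ` A. x i)"
      using q0 J(3) by (simp add: powr_powr powr_mult)
    with upp[OF A(1)] have "\<tau> * real (card A) powr (1 / q) \<le> \<tau> * (2 * norm (\<Sum>i\<in>A. y i))"
      by (simp add: mult_ac)
    then show ?thesis using J(3) by simp
  qed
  then show ?thesis using y by (intro exI[of _ y]) simp
qed

section \<open>Subfamilies with position-independent norms\<close>

text \<open>Colourings of sets of several sizes \<open>r\<close> are handled one size after the other, passing to a
  homogeneous subset each time.\<close>

lemma simultaneous_ramsey:
  assumes s: "0 < (s::nat)"
  shows "\<exists>R. \<forall>f::nat \<Rightarrow> nat set \<Rightarrow> nat. (\<forall>r S. f r S < s) \<longrightarrow>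
    (\<exists>H\<subseteq>{..<R}. card H = K \<and>
      (\<forall>r\<in>set rs. \<forall>S\<subseteq>H. \<forall>S'\<subseteq>H. card S = r \<longrightarrow> card S' = r \<longrightarrow> f r S = f r S'))"
proof (induction rs)
  case Nil
  show ?case by (intro exI[of _ K] allI impI exI[of _ "{..<K}"]) simp
next
  case (Cons r rs)
  then obtain R1 where R1: "\<And>f::nat \<Rightarrow> nat set \<Rightarrow> nat. (\<forall>r S. f r S < s) \<Longrightarrow>
    (\<exists>H\<subseteq>{..<R1}. card H = K \<and>
      (\<forall>r\<in>set rs. \<forall>S\<subseteq>H. \<forall>S'\<subseteq>H. card S = r \<longrightarrow> card S' = r \<longrightarrow> f r S = f r S'))"
    by metis
  obtain R :: nat where R: "partn_lst {..<R} (replicate s R1) r" using ramsey_full ..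
  show ?case
  proof (intro exI[of _ R] allI impI)
    fix f :: "nat \<Rightarrow> nat set \<Rightarrow> nat" assume f: "\<forall>r S. f r S < s"
    have "f r \<in> nsets {..<R} r \<rightarrow> {..<length (replicate s R1)}" using f by simp
    from partn_lstE[OF R this] obtain i H1 where
      i: "i < s" and H1: "H1 \<in> nsets {..<R} (replicate s R1 ! i)" "f r ` nsets H1 r \<subseteq> {i}"
      by (metis length_replicate)
    then have H1': "H1 \<subseteq> {..<R}" "card H1 = R1" "finite H1" by (auto simp: nsets_def)
    obtain g where g: "bij_betw g {..<R1} H1" using ex_bij_lessThan[OF H1'(3)] H1'(2) by auto
    then have gi: "inj_on g {..<R1}" "g ` {..<R1} = H1" by (simp_all add: bij_betw_def)
    have "\<forall>r S. f r (g ` S) < s" using f by simp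
    from R1[of "\<lambda>r S. f r (g ` S)", OF this] obtain H2 where H2: "H2 \<subseteq> {..<R1}" "card H2 = K"
      "\<forall>r\<in>set rs. \<forall>S\<subseteq>H2. \<forall>S'\<subseteq>H2. card S = r \<longrightarrow> card S' = r \<longrightarrow> f r (g ` S) = f r (g ` S')"
      by metis
    have inj: "inj_on g H2" using gi(1) H2(1) by (rule inj_on_subset)
    have sub: "g ` H2 \<subseteq> H1" using H2(1) gi(2) by blast
    show "\<exists>H\<subseteq>{..<R}. card H = K \<and>
      (\<forall>r'\<in>set (r # rs). \<forall>S\<subseteq>H. \<forall>S'\<subseteq>H. card S = r' \<longrightarrow> card S' = r' \<longrightarrow> f r' S = f r' S')"
    proof (intro exI[of _ "g ` H2"] conjI ballI allI impI)
      show "g ` H2 \<subseteq> {..<R}" using sub H1'(1) by (rule subset_trans)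
      show "card (g ` H2) = K" using H2(2) card_image[OF inj] by simp
    next
      fix r' S S' assume r': "r' \<in> set (r # rs)" and S: "S \<subseteq> g ` H2" "S' \<subseteq> g ` H2" "card S = r'" "card S' = r'"
      show "f r' S = f r' S'"
      proof (cases "r' \<in> set rs")
        case True
        obtain T T' where T: "T \<subseteq> H2" "S = g ` T" "T' \<subseteq> H2" "S' = g ` T'"
          using S(1,2) by (metis subset_imageE)
        moreover have "card T = r'" "card T' = r'"
          using S(3,4) T card_image[OF inj_on_subset[OF inj]] by metis+
        ultimately show ?thesis using H2(3) True by metis
      next
        case False
        then have "r' = r" using r' by simp
        moreover have "f r S \<in> {i}" if "S \<subseteq> g ` H2" "card S = r" for S
        proof -
          have "S \<subseteq> H1" using that(1) sub by (rule subset_trans)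
          then have "S \<in> nsets H1 r" using that(2) finite_subset[OF _ H1'(3)] by (simp add: nsets_def)
          then show ?thesis using H1(2) by blast
        qed
        ultimately show ?thesis using S by auto
      qed
    qed
  qed
qed

definition pattern_sum :: "(nat \<Rightarrow> real) \<Rightarrow> (nat \<Rightarrow> 'a::real_vector) \<Rightarrow> nat list \<Rightarrow> 'a" where
  "pattern_sum V x ps = (\<Sum>i<length ps. V i *\<^sub>R x (ps ! i))"

text \<open>A set of positions is coloured by the norm of the pattern placed there, rounded down to a multiple
  of \<open>\<delta>\<close>. In a homogeneous subfamily the norm of a pattern depends on its position only up to \<open>\<delta>\<close>.\<close>

lemma ex_homogeneous_subfamily:
  assumes \<delta>: "0 < (\<delta>::real)"
  shows "\<exists>R. \<forall>x::nat \<Rightarrow> 'a::real_normed_vector. (\<forall>i. norm (x i) \<le> 1) \<longrightarrow>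
    (\<exists>h. strict_mono_on {..<K} h \<and> h ` {..<K} \<subseteq> {..<R} \<and>
      (\<forall>r\<in>set rs. \<forall>ps ps'. sorted_wrt (<) ps \<longrightarrow> sorted_wrt (<) ps' \<longrightarrow> set ps \<subseteq> {..<K} \<longrightarrow> set ps' \<subseteq> {..<K} \<longrightarrow>
        length ps = r \<longrightarrow> length ps' = r \<longrightarrow>
        \<bar>norm (pattern_sum V (\<lambda>i. x (h i)) ps) - norm (pattern_sum V (\<lambda>i. x (h i)) ps')\<bar> \<le> \<delta>))"
proof -
  define B where "B = (\<Sum>r\<in>set rs. \<Sum>i<r. \<bar>V i\<bar>)"
  define s where "s = Suc (nat \<lfloor>B / \<delta>\<rfloor>)"
  obtain R where R: "\<And>f::nat \<Rightarrow> nat set \<Rightarrow> nat. (\<forall>r S. f r S < s) \<Longrightarrow>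
    (\<exists>H\<subseteq>{..<R}. card H = K \<and>
      (\<forall>r\<in>set rs. \<forall>S\<subseteq>H. \<forall>S'\<subseteq>H. card S = r \<longrightarrow> card S' = r \<longrightarrow> f r S = f r S'))"
    using simultaneous_ramsey[of s K rs] by (metis s_def zero_less_Suc)
  show ?thesis
  proof (intro exI[of _ R] allI impI)
    fix x :: "nat \<Rightarrow> 'a" assume x: "\<forall>i. norm (x i) \<le> 1"
    \<comment> \<open>the reduction modulo \<open>s\<close> bounds the colours also for sets of sizes that do not matter\<close>
    define f where "f r S = nat \<lfloor>norm (pattern_sum V x (sorted_list_of_set S)) / \<delta>\<rfloor> mod s" for r :: nat and S
    have "\<forall>r S. f r S < s" by (simp add: f_def s_def)
    from R[OF this] obtain H where H: "H \<subseteq> {..<R}" "card H = K"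
      "\<forall>r\<in>set rs. \<forall>S\<subseteq>H. \<forall>S'\<subseteq>H. card S = r \<longrightarrow> card S' = r \<longrightarrow> f r S = f r S'"
      by metis
    have finH: "finite H" using H(1) finite_subset by blast
    define h where "h i = sorted_list_of_set H ! i" for i
    have len: "length (sorted_list_of_set H) = K" using H(2) by simp
    have hmono: "strict_mono_on {..<K} h"
      using strict_sorted_list_of_set[of H] len
      by (auto simp: strict_mono_on_def h_def sorted_wrt_iff_nth_less)
    have hH: "h i \<in> H" if "i < K" for i
      using nth_mem[of i "sorted_list_of_set H"] that len finH by (simp add: h_def)
    have round: "nat \<lfloor>norm (pattern_sum V x qs) / \<delta>\<rfloor> mod s = nat \<lfloor>norm (pattern_sum V x qs) / \<delta>\<rfloor>"
      if "length qs \<in> set rs" for qs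
    proof -
      have "norm (pattern_sum V x qs) \<le> (\<Sum>i<length qs. \<bar>V i\<bar> * 1)"
        unfolding pattern_sum_def using x by (intro sum_norm_le) (simp add: mult_left_le)
      also have "\<dots> \<le> B" unfolding B_def 
        using member_le_sum[of "length qs" "set rs" "\<lambda>r. \<Sum>i<r. \<bar>V i\<bar>"] that by (simp add: sum_nonneg)
      finally have "norm (pattern_sum V x qs) / \<delta> \<le> B / \<delta>" using \<delta> by (simp add: divide_right_mono)
      then have "nat \<lfloor>norm (pattern_sum V x qs) / \<delta>\<rfloor> < s" unfolding s_def
        by (simp add: less_Suc_eq_le nat_mono floor_mono)
      then show ?thesis by simp
    qed
    have move: "pattern_sum V (\<lambda>i. x (h i)) ps = pattern_sum V x (map h ps)" for ps
      by (simp add: pattern_sum_def)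
    have sorted: "sorted_list_of_set (set (map h ps)) = map h ps" "set (map h ps) \<subseteq> H" "card (set (map h ps)) = length ps"
      if ps: "sorted_wrt (<) ps" "set ps \<subseteq> {..<K}" for ps
    proof -
      have "sorted_wrt (<) (map h ps)"
        unfolding sorted_wrt_map using ps(1)
        by (rule sorted_wrt_mono_rel[rotated]) (use hmono ps(2) in \<open>auto simp: strict_mono_on_def\<close>)
      then show "sorted_list_of_set (set (map h ps)) = map h ps" "card (set (map h ps)) = length ps"
        by (simp_all add: strict_sorted_equal strict_sorted_iff distinct_card[of "map h ps", simplified] sorted_list_of_set.idem_if_sorted_distinct)
      show "set (map h ps) \<subseteq> H" using hH ps(2) by auto
    qed
    show "\<exists>h. strict_mono_on {..<K} h \<and> h ` {..<K} \<subseteq> {..<R} \<and>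
      (\<forall>r\<in>set rs. \<forall>ps ps'. sorted_wrt (<) ps \<longrightarrow> sorted_wrt (<) ps' \<longrightarrow> set ps \<subseteq> {..<K} \<longrightarrow> set ps' \<subseteq> {..<K} \<longrightarrow>
        length ps = r \<longrightarrow> length ps' = r \<longrightarrow>
        \<bar>norm (pattern_sum V (\<lambda>i. x (h i)) ps) - norm (pattern_sum V (\<lambda>i. x (h i)) ps')\<bar> \<le> \<delta>)"
    proof (intro exI[of _ h] conjI ballI allI impI)
      show "strict_mono_on {..<K} h" by (rule hmono)
      show "h ` {..<K} \<subseteq> {..<R}" using hH H(1) by auto
    next
      fix r ps ps' assume r: "r \<in> set rs" and ps: "sorted_wrt (<) ps" "sorted_wrt (<) ps'"
        "set ps \<subseteq> {..<K}" "set ps' \<subseteq> {..<K}" "length ps = r" "length ps' = r"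
      have "f r (set (map h ps)) = f r (set (map h ps'))"
        using H(3) r sorted(2,3)[OF ps(1,3)] sorted(2,3)[OF ps(2,4)] ps(5,6) by metis
      then have "nat \<lfloor>norm (pattern_sum V x (map h ps)) / \<delta>\<rfloor> = nat \<lfloor>norm (pattern_sum V x (map h ps')) / \<delta>\<rfloor>"
        unfolding f_def sorted(1)[OF ps(1,3)] sorted(1)[OF ps(2,4)]
        using round[of "map h ps"] round[of "map h ps'"] ps(5,6) r by simp
      moreover have "0 \<le> \<lfloor>norm (pattern_sum V x (map h ps)) / \<delta>\<rfloor>" "0 \<le> \<lfloor>norm (pattern_sum V x (map h ps')) / \<delta>\<rfloor>"
        using \<delta> by simp_all
      ultimately have "\<lfloor>norm (pattern_sum V x (map h ps)) / \<delta>\<rfloor> = \<lfloor>norm (pattern_sum V x (map h ps')) / \<delta>\<rfloor>"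
        by linarith
      then have "\<bar>norm (pattern_sum V x (map h ps)) / \<delta> - norm (pattern_sum V x (map h ps')) / \<delta>\<bar> \<le> 1"
        by linarith
      then have "\<bar>norm (pattern_sum V x (map h ps)) - norm (pattern_sum V x (map h ps'))\<bar> / \<delta> \<le> 1"
        using \<delta> by (simp add: diff_divide_distrib[symmetric] abs_divide)
      then show "\<bar>norm (pattern_sum V (\<lambda>i. x (h i)) ps) - norm (pattern_sum V (\<lambda>i. x (h i)) ps')\<bar> \<le> \<delta>"
        using \<delta> by (simp add: move)
    qed
  qed
qed

lemma pattern_sum_append:
  assumes "\<And>i. V (i + Q) = V i" "Q dvd length ps"
  shows "pattern_sum V x (ps @ qs) = pattern_sum V x ps + pattern_sum V x qs"
proof -
  obtain k where k: "length ps = Q * k" using assms(2) ..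
  have period: "V (Q * k + i) = V i" for i
  proof (induction k)
    case (Suc k)
    have "V (Q * Suc k + i) = V ((Q * k + i) + Q)" by (simp add: algebra_simps)
    then show ?case using Suc assms(1) by simp
  qed simp
  have "pattern_sum V x (ps @ qs) = (\<Sum>i<length ps + length qs. V i *\<^sub>R x ((ps @ qs) ! i))"
    by (simp add: pattern_sum_def)
  also have "\<dots> = (\<Sum>i<length ps. V i *\<^sub>R x ((ps @ qs) ! i)) + (\<Sum>i<length qs. V (length ps + i) *\<^sub>R x ((ps @ qs) ! (length ps + i)))"
  proof -
    have "(\<Sum>i<a + b. g i) = (\<Sum>i<a. g i) + (\<Sum>i<b. g (a + i))" for a b and g :: "nat \<Rightarrow> 'b::comm_monoid_add"
      by (induction b) (simp_all add: add.assoc)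
    then show ?thesis .
  qed
  also have "\<dots> = pattern_sum V x ps + pattern_sum V x qs"
    by (simp add: pattern_sum_def nth_append k period)
  finally show ?thesis .
qed

section \<open>Layered vectors\<close>

text \<open>Let \<open>\<phi> N\<close> stand for a sum of \<open>N\<close> vectors, whose norm is roughly \<open>N powr \<kappa>\<close>. The function
  \<open>layer \<kappa> \<eta> K m \<phi>\<close> superposes the sums \<open>\<phi> (m ^ a * N)\<close>, rescaled to comparable norm and damped exponentially
  away from the middle layer \<open>a = K\<close>. Multiplication of \<open>N\<close> by \<open>m\<close> shifts the layers, and the damping makes
  the effect of this shift small. Superposition is iterated over a list \<open>ms\<close> of multipliers.\<close>

definition layer_weight :: "real \<Rightarrow> real \<Rightarrow> nat \<Rightarrow> nat \<Rightarrow> nat \<Rightarrow> real" where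
  "layer_weight \<kappa> \<eta> K m a = exp (- (\<eta> * \<bar>real a - real K\<bar>)) * real m powr (- (\<kappa> * real a))"

definition layer :: "real \<Rightarrow> real \<Rightarrow> nat \<Rightarrow> nat \<Rightarrow> (nat \<Rightarrow> 'a::real_vector) \<Rightarrow> nat \<Rightarrow> 'a" where
  "layer \<kappa> \<eta> K m \<phi> N = (\<Sum>a\<le>2 * K. layer_weight \<kappa> \<eta> K m a *\<^sub>R \<phi> (m ^ a * N))"

definition layers :: "real \<Rightarrow> real \<Rightarrow> nat \<Rightarrow> nat list \<Rightarrow> (nat \<Rightarrow> 'a::real_vector) \<Rightarrow> nat \<Rightarrow> 'a" where
  "layers \<kappa> \<eta> K ms \<phi> = foldr (layer \<kappa> \<eta> K) ms \<phi>"

text \<open>The \<open>N\<close> positions are spread evenly over an interval of length \<open>L\<close>, so that \<open>m N\<close> positions arise by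
  refining the spacing. This compatibility is what makes layered vectors periodic.\<close>

definition equidistant_sum :: "(nat \<Rightarrow> 'a::comm_monoid_add) \<Rightarrow> nat \<Rightarrow> nat \<Rightarrow> 'a" where
  "equidistant_sum y L N = (\<Sum>i<N. y (i * (L div N)))"

lemma layers_simps [simp]:
  "layers \<kappa> \<eta> K [] \<phi> = \<phi>"
  "layers \<kappa> \<eta> K (m # ms) \<phi> = layer \<kappa> \<eta> K m (layers \<kappa> \<eta> K ms \<phi>)"
  by (simp_all add: layers_def)

lemma layer_weight_nonneg: "0 \<le> layer_weight \<kappa> \<eta> K m a"
  by (simp add: layer_weight_def)

lemma layer_commute: "layer \<kappa> \<eta> K m (layer \<kappa> \<eta> K m' \<phi>) = layer \<kappa> \<eta> K m' (layer \<kappa> \<eta> K m \<phi>)"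
proof
  fix N
  let ?w = "layer_weight \<kappa> \<eta> K"
  have "layer \<kappa> \<eta> K m (layer \<kappa> \<eta> K m' \<phi>) N
      = (\<Sum>a\<le>2 * K. \<Sum>b\<le>2 * K. (?w m a * ?w m' b) *\<^sub>R \<phi> (m' ^ b * (m ^ a * N)))"
    by (simp add: layer_def scaleR_sum_right)
  also have "\<dots> = (\<Sum>b\<le>2 * K. \<Sum>a\<le>2 * K. (?w m' b * ?w m a) *\<^sub>R \<phi> (m ^ a * (m' ^ b * N)))"
    by (subst sum.swap) (simp add: mult_ac)
  also have "\<dots> = layer \<kappa> \<eta> K m' (layer \<kappa> \<eta> K m \<phi>) N"
    by (simp add: layer_def scaleR_sum_right)
  finally show "layer \<kappa> \<eta> K m (layer \<kappa> \<eta> K m' \<phi>) N = layer \<kappa> \<eta> K m' (layer \<kappa> \<eta> K m \<phi>) N" .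
qed

text \<open>Layering operators commute, so each multiplier can be treated as if it had been applied last.\<close>

lemma layers_remove1:
  "m \<in> set ms \<Longrightarrow> layers \<kappa> \<eta> K ms \<phi> = layer \<kappa> \<eta> K m (layers \<kappa> \<eta> K (remove1 m ms) \<phi>)"
  by (induction ms) (auto simp: layer_commute[of \<kappa> \<eta> K m])

lemma prod_list_pos: "\<forall>m\<in>set ms. (1::nat) \<le> m \<Longrightarrow> 1 \<le> prod_list ms"
  by (induction ms) (auto simp: Suc_le_eq)

lemma prod_list_remove1_nat: "m \<in> set ms \<Longrightarrow> prod_list ms = (m::nat) * prod_list (remove1 m ms)"
  by (induction ms) auto

lemma layer_nonneg:
  fixes \<phi> :: "nat \<Rightarrow> 'a::banach_lattice"
  assumes "\<And>N. 0 \<le> \<phi> N"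
  shows "0 \<le> layer \<kappa> \<eta> K m \<phi> N"
  unfolding layer_def by (intro sum_nonneg scaleR_nonneg_nonneg assms layer_weight_nonneg)

lemma layers_nonneg:
  fixes \<phi> :: "nat \<Rightarrow> 'a::banach_lattice"
  assumes "\<And>N. 0 \<le> \<phi> N"
  shows "0 \<le> layers \<kappa> \<eta> K ms \<phi> N"
  by (induction ms arbitrary: N) (simp_all add: assms layer_nonneg)

lemma layer_weight_le: "0 \<le> \<eta> \<Longrightarrow> layer_weight \<kappa> \<eta> K m a \<le> real m powr (- (\<kappa> * real a))"
  unfolding layer_weight_def by (intro mult_left_le_one_le) auto

text \<open>The error \<open>N powr \<xi>\<close> allowed in the size of \<open>\<phi> N\<close> accumulates only to a power of \<open>prod_list ms\<close> with exponent
  proportional to \<open>K \<xi>\<close>, which the damping \<open>exp (- \<eta> K)\<close> can absorb.\<close>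

lemma norm_layers_le:
  fixes \<phi> :: "nat \<Rightarrow> 'a::real_normed_vector"
  assumes \<eta>: "0 \<le> \<eta>" and \<xi>: "0 \<le> \<xi>" and D: "0 \<le> D" and ms: "\<forall>m\<in>set ms. 1 \<le> m"
    and \<phi>: "\<And>N. 1 \<le> N \<Longrightarrow> N \<le> L \<Longrightarrow> norm (\<phi> N) \<le> D * real N powr (\<kappa> + \<xi>)"
    and N: "1 \<le> N" "N * prod_list ms ^ (2 * K) \<le> L"
  shows "norm (layers \<kappa> \<eta> K ms \<phi> N)
    \<le> D * (2 * real K + 1) ^ length ms * real (prod_list ms) powr (2 * real K * \<xi>) * real N powr (\<kappa> + \<xi>)"
  using ms N
proof (induction ms arbitrary: N)
  case Nil
  then show ?case using \<phi> by simp
next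
  case (Cons m ms)
  have m: "1 \<le> m" and ms': "\<forall>m\<in>set ms. 1 \<le> m" using Cons.prems(1) by auto
  have P: "1 \<le> prod_list ms" using ms' by (rule prod_list_pos)
  define B where "B = D * (2 * real K + 1) ^ length ms * real (prod_list ms) powr (2 * real K * \<xi>)"
  have B: "0 \<le> B" using D by (simp add: B_def)
  have "norm (layer_weight \<kappa> \<eta> K m a *\<^sub>R layers \<kappa> \<eta> K ms \<phi> (m ^ a * N))
      \<le> B * real m powr (2 * real K * \<xi>) * real N powr (\<kappa> + \<xi>)" if a: "a \<le> 2 * K" for a
  proof -
    have "m ^ a * N * prod_list ms ^ (2 * K) \<le> N * prod_list (m # ms) ^ (2 * K)"
      using power_increasing[OF a m] by (simp add: power_mult_distrib mult_ac)
    also have "\<dots> \<le> L" by (rule Cons.prems(3))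
    finally have IH: "norm (layers \<kappa> \<eta> K ms \<phi> (m ^ a * N)) \<le> B * real (m ^ a * N) powr (\<kappa> + \<xi>)"
      unfolding B_def using ms' m Cons.prems(2) by (intro Cons.IH) (auto simp: Suc_le_eq)
    have "real (m ^ a * N) powr (\<kappa> + \<xi>) = real m powr (real a * (\<kappa> + \<xi>)) * real N powr (\<kappa> + \<xi>)"
      using m by (simp add: powr_mult powr_realpow[symmetric] powr_powr)
    then have eq: "real m powr (- (\<kappa> * real a)) * real (m ^ a * N) powr (\<kappa> + \<xi>) = real m powr (real a * \<xi>) * real N powr (\<kappa> + \<xi>)"
      using m by (simp add: powr_add[symmetric] algebra_simps)
    have "norm (layer_weight \<kappa> \<eta> K m a *\<^sub>R layers \<kappa> \<eta> K ms \<phi> (m ^ a * N))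
        \<le> real m powr (- (\<kappa> * real a)) * (B * real (m ^ a * N) powr (\<kappa> + \<xi>))"
      using IH layer_weight_le[OF \<eta>] layer_weight_nonneg by (auto intro!: mult_mono)
    also have "\<dots> = B * (real m powr (real a * \<xi>) * real N powr (\<kappa> + \<xi>))" unfolding eq[symmetric] by simp
    also have "\<dots> \<le> B * (real m powr (2 * real K * \<xi>) * real N powr (\<kappa> + \<xi>))"
      using a \<xi> m B by (intro mult_left_mono mult_right_mono powr_mono) (auto intro!: mult_right_mono)
    finally show ?thesis by (simp add: mult_ac)
  qed
  then have "norm (layer \<kappa> \<eta> K m (layers \<kappa> \<eta> K ms \<phi>) N)
      \<le> real (card {..2 * K}) * (B * real m powr (2 * real K * \<xi>) * real N powr (\<kappa> + \<xi>))"
    unfolding layer_def by (intro sum_norm_bound) auto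
  moreover have "real (card {..2 * K}) = 2 * real K + 1" by simp
  ultimately have "norm (layer \<kappa> \<eta> K m (layers \<kappa> \<eta> K ms \<phi>) N)
      \<le> (2 * real K + 1) * (B * real m powr (2 * real K * \<xi>) * real N powr (\<kappa> + \<xi>))" by (simp only:)
  then show ?case by (simp add: B_def powr_mult mult_ac)
qed

lemma norm_layers_ge:
  fixes \<phi> :: "nat \<Rightarrow> 'a::banach_lattice"
  assumes d: "0 \<le> d" and ms: "\<forall>m\<in>set ms. 1 \<le> m"
    and pos: "\<And>N. 0 \<le> \<phi> N"
    and \<phi>: "\<And>N. 1 \<le> N \<Longrightarrow> N \<le> L \<Longrightarrow> d * real N powr (\<kappa> - \<xi>) \<le> norm (\<phi> N)"
    and N: "1 \<le> N" "N * prod_list ms ^ (2 * K) \<le> L"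
  shows "d * real (prod_list ms) powr (- (real K * \<xi>)) * real N powr (\<kappa> - \<xi>) \<le> norm (layers \<kappa> \<eta> K ms \<phi> N)"
  using ms N
proof (induction ms arbitrary: N)
  case Nil
  then show ?case using \<phi> by simp
next
  case (Cons m ms)
  have m: "1 \<le> m" and ms': "\<forall>m\<in>set ms. 1 \<le> m" using Cons.prems(1) by auto
  define B where "B = d * real (prod_list ms) powr (- (real K * \<xi>))"
  have "K \<le> 2 * K" by simp
  then have "m ^ K * N * prod_list ms ^ (2 * K) \<le> N * prod_list (m # ms) ^ (2 * K)"
    using power_increasing[of K "2 * K" m] m by (simp add: power_mult_distrib mult_ac)
  also have "\<dots> \<le> L" by (rule Cons.prems(3))
  finally have IH: "B * real (m ^ K * N) powr (\<kappa> - \<xi>) \<le> norm (layers \<kappa> \<eta> K ms \<phi> (m ^ K * N))"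
    unfolding B_def using ms' m Cons.prems(2) by (intro Cons.IH) (auto simp: Suc_le_eq)
  have "real (m ^ K * N) powr (\<kappa> - \<xi>) = real m powr (real K * (\<kappa> - \<xi>)) * real N powr (\<kappa> - \<xi>)"
    using m by (simp add: powr_mult powr_realpow[symmetric] powr_powr)
  then have eq: "real m powr (- (\<kappa> * real K)) * real (m ^ K * N) powr (\<kappa> - \<xi>) = real m powr (- (real K * \<xi>)) * real N powr (\<kappa> - \<xi>)"
    using m by (simp add: powr_add[symmetric] algebra_simps)
  have "B * (real m powr (- (real K * \<xi>)) * real N powr (\<kappa> - \<xi>))
      = real m powr (- (\<kappa> * real K)) * (B * real (m ^ K * N) powr (\<kappa> - \<xi>))"
    unfolding eq[symmetric] by simp
  also have "\<dots> \<le> real m powr (- (\<kappa> * real K)) * norm (layers \<kappa> \<eta> K ms \<phi> (m ^ K * N))"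
    using IH by (intro mult_left_mono) auto
  also have "\<dots> = norm (layer_weight \<kappa> \<eta> K m K *\<^sub>R layers \<kappa> \<eta> K ms \<phi> (m ^ K * N))"
    by (simp add: layer_weight_def)
  also have "\<dots> \<le> norm (layer \<kappa> \<eta> K m (layers \<kappa> \<eta> K ms \<phi>) N)"
  proof (rule norm_mono_pos)
    have nn: "0 \<le> layer_weight \<kappa> \<eta> K m a *\<^sub>R layers \<kappa> \<eta> K ms \<phi> (m ^ a * N)" for a
      by (intro scaleR_nonneg_nonneg layer_weight_nonneg layers_nonneg pos)
    show "0 \<le> layer_weight \<kappa> \<eta> K m K *\<^sub>R layers \<kappa> \<eta> K ms \<phi> (m ^ K * N)" by (rule nn)
    have "0 \<le> (\<Sum>a\<in>{..2 * K} - {K}. layer_weight \<kappa> \<eta> K m a *\<^sub>R layers \<kappa> \<eta> K ms \<phi> (m ^ a * N))"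
      by (intro sum_nonneg nn)
    then show "layer_weight \<kappa> \<eta> K m K *\<^sub>R layers \<kappa> \<eta> K ms \<phi> (m ^ K * N) \<le> layer \<kappa> \<eta> K m (layers \<kappa> \<eta> K ms \<phi>) N"
      unfolding layer_def by (simp add: sum.remove[of "{..2 * K}" K])
  qed
  finally show ?case by (simp add: B_def powr_mult mult_ac)
qed

text \<open>Multiplying the number of copies by \<open>m\<close> shifts the layers by one step, and consecutive damping factors
  have a quotient between \<open>exp (- \<eta>)\<close> and \<open>exp \<eta>\<close>. So the layered vector is an approximate eigenvector for the
  eigenvalue \<open>m powr \<kappa>\<close>, up to the two outermost layers, which carry the factor \<open>exp (- \<eta> K)\<close>.\<close>

lemma layer_shift:
  fixes \<psi> :: "nat \<Rightarrow> 'a::banach_lattice"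
  assumes pos: "\<And>N. 0 \<le> \<psi> N" and m: "1 \<le> m" and \<eta>: "0 \<le> \<eta>"
  shows "norm (real m powr \<kappa> *\<^sub>R layer \<kappa> \<eta> K m \<psi> 1 - layer \<kappa> \<eta> K m \<psi> m)
    \<le> (exp \<eta> - 1) * real m powr \<kappa> * norm (layer \<kappa> \<eta> K m \<psi> 1)
      + exp (- (\<eta> * real K)) * (real m powr \<kappa> * norm (\<psi> 1)
        + real m powr (- (2 * real K * \<kappa>)) * norm (\<psi> (m ^ (2 * K + 1))))"
proof -
  define w where "w a = exp (- (\<eta> * \<bar>real a - real K\<bar>))" for a
  define t where "t a = real m powr (- (\<kappa> * real a)) *\<^sub>R \<psi> (m ^ Suc a)" for a
  have m0: "0 < real m" using m by simp
  have t0: "0 \<le> t a" for a unfolding t_def by (intro scaleR_nonneg_nonneg pos) simp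
  have w0: "0 \<le> w a" for a by (simp add: w_def)
  have lm: "layer \<kappa> \<eta> K m \<psi> m = (\<Sum>a<2 * K. w a *\<^sub>R t a) + w (2 * K) *\<^sub>R t (2 * K)"
    by (simp add: layer_def layer_weight_def w_def t_def lessThan_Suc_atMost[symmetric] mult.commute)
  have l1: "real m powr \<kappa> *\<^sub>R layer \<kappa> \<eta> K m \<psi> 1 = (real m powr \<kappa> * w 0) *\<^sub>R \<psi> 1 + (\<Sum>a<2 * K. w (Suc a) *\<^sub>R t a)"
  proof -
    have "layer \<kappa> \<eta> K m \<psi> 1 = layer_weight \<kappa> \<eta> K m 0 *\<^sub>R \<psi> 1 + (\<Sum>a<2 * K. layer_weight \<kappa> \<eta> K m (Suc a) *\<^sub>R \<psi> (m ^ Suc a))"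
      unfolding layer_def lessThan_Suc_atMost[symmetric] by (subst sum.lessThan_Suc_shift) simp
    moreover have "real m powr \<kappa> * layer_weight \<kappa> \<eta> K m 0 = real m powr \<kappa> * w 0"
      using m0 by (simp add: layer_weight_def w_def)
    moreover have "real m powr \<kappa> * layer_weight \<kappa> \<eta> K m (Suc a) = w (Suc a) * real m powr (- (\<kappa> * real a))" for a
    proof -
      have "real m powr \<kappa> * real m powr (- (\<kappa> * real (Suc a))) = real m powr (- (\<kappa> * real a))"
        by (simp add: powr_add[symmetric] algebra_simps)
      then show ?thesis by (simp add: layer_weight_def w_def)
    qed
    ultimately show ?thesis by (simp add: scaleR_add_right scaleR_sum_right t_def)
  qed
  define S where "S = (\<Sum>a<2 * K. w (Suc a) *\<^sub>R t a)"
  have S0: "0 \<le> S" unfolding S_def by (intro sum_nonneg scaleR_nonneg_nonneg w0 t0)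
  have S_le: "norm S \<le> real m powr \<kappa> * norm (layer \<kappa> \<eta> K m \<psi> 1)"
  proof -
    have "norm S \<le> norm (real m powr \<kappa> *\<^sub>R layer \<kappa> \<eta> K m \<psi> 1)"
      unfolding l1 S_def[symmetric] using S0 w0[of 0] pos[of 1]
      by (intro norm_mono_pos) (auto intro!: scaleR_nonneg_nonneg simp: add_increasing)
    then show ?thesis by simp
  qed
  have wdiff: "\<bar>w (Suc a) - w a\<bar> \<le> (exp \<eta> - 1) * w (Suc a)" for a
  proof -
    have "w a \<le> exp \<eta> * w (Suc a)" "w (Suc a) \<le> exp \<eta> * w a"
    proof -
      have "\<eta> * \<bar>real (Suc a) - real K\<bar> \<le> \<eta> * (1 + \<bar>real a - real K\<bar>)"
        "\<eta> * \<bar>real a - real K\<bar> \<le> \<eta> * (1 + \<bar>real (Suc a) - real K\<bar>)"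
        using \<eta> by (intro mult_left_mono; linarith)+
      then show "w a \<le> exp \<eta> * w (Suc a)" "w (Suc a) \<le> exp \<eta> * w a"
        by (simp_all add: w_def mult_exp_exp distrib_left)
    qed
    moreover have "w (Suc a) - w a \<le> (exp \<eta> - 1) * w (Suc a)"
    proof -
      have "exp (- \<eta>) * w (Suc a) \<le> exp (- \<eta>) * (exp \<eta> * w a)" using calculation(2) by (intro mult_left_mono) auto
      then have "exp (- \<eta>) * w (Suc a) \<le> w a" by (simp add: mult.assoc[symmetric] mult_exp_exp)
      moreover have "2 - exp \<eta> \<le> exp (- \<eta>)"
        using exp_ge_add_one_self[of \<eta>] exp_ge_add_one_self[of "- \<eta>"] by linarith
      ultimately have "(2 - exp \<eta>) * w (Suc a) \<le> w a"
        using w0[of "Suc a"] by (meson mult_right_mono order_trans)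
      then show ?thesis by (simp add: algebra_simps)
    qed
    ultimately show ?thesis by (simp add: abs_le_iff algebra_simps)
  qed
  have mid: "norm (\<Sum>a<2 * K. (w (Suc a) - w a) *\<^sub>R t a) \<le> (exp \<eta> - 1) * norm S"
  proof -
    have "\<bar>\<Sum>a<2 * K. (w (Suc a) - w a) *\<^sub>R t a\<bar> \<le> (exp \<eta> - 1) *\<^sub>R S"
    proof (rule abs_leI)
      have "(\<Sum>a<2 * K. (w (Suc a) - w a) *\<^sub>R t a) \<le> (\<Sum>a<2 * K. ((exp \<eta> - 1) * w (Suc a)) *\<^sub>R t a)"
        using wdiff t0 by (intro sum_mono scaleR_right_mono) (auto simp: abs_le_iff)
      then show "(\<Sum>a<2 * K. (w (Suc a) - w a) *\<^sub>R t a) \<le> (exp \<eta> - 1) *\<^sub>R S"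
        by (simp add: S_def scaleR_sum_right)
      have "(\<Sum>a<2 * K. (- (w (Suc a) - w a)) *\<^sub>R t a) \<le> (\<Sum>a<2 * K. ((exp \<eta> - 1) * w (Suc a)) *\<^sub>R t a)"
        using wdiff t0 by (intro sum_mono scaleR_right_mono) (auto simp: abs_le_iff)
      then show "- (\<Sum>a<2 * K. (w (Suc a) - w a) *\<^sub>R t a) \<le> (exp \<eta> - 1) *\<^sub>R S"
        by (simp only: S_def scaleR_sum_right scaleR_minus_left sum_negf scaleR_scaleR)
    qed
    then have "norm (\<Sum>a<2 * K. (w (Suc a) - w a) *\<^sub>R t a) \<le> norm ((exp \<eta> - 1) *\<^sub>R S)" by (rule norm_le_of_abs_le)
    then show ?thesis using \<eta> by simp
  qed
  have "real m powr \<kappa> *\<^sub>R layer \<kappa> \<eta> K m \<psi> 1 - layer \<kappa> \<eta> K m \<psi> m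
      = (\<Sum>a<2 * K. (w (Suc a) - w a) *\<^sub>R t a) + ((real m powr \<kappa> * w 0) *\<^sub>R \<psi> 1 - w (2 * K) *\<^sub>R t (2 * K))"
    unfolding l1 lm by (simp add: scaleR_diff_left sum_subtractf)
  also have "norm \<dots> \<le> norm (\<Sum>a<2 * K. (w (Suc a) - w a) *\<^sub>R t a)
      + (norm ((real m powr \<kappa> * w 0) *\<^sub>R \<psi> 1) + norm (w (2 * K) *\<^sub>R t (2 * K)))"
    by (intro norm_triangle_le add_left_mono norm_triangle_ineq4)
  also have "norm ((real m powr \<kappa> * w 0) *\<^sub>R \<psi> 1) = exp (- (\<eta> * real K)) * (real m powr \<kappa> * norm (\<psi> 1))"
    by (simp add: w_def abs_mult)
  also have "norm (w (2 * K) *\<^sub>R t (2 * K)) = exp (- (\<eta> * real K)) * (real m powr (- (2 * real K * \<kappa>)) * norm (\<psi> (m ^ (2 * K + 1))))"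
    by (simp add: w_def t_def abs_mult mult_ac)
  also have "norm (\<Sum>a<2 * K. (w (Suc a) - w a) *\<^sub>R t a) \<le> (exp \<eta> - 1) * (real m powr \<kappa> * norm (layer \<kappa> \<eta> K m \<psi> 1))"
    using mid S_le \<eta> by (meson mult_left_mono order_trans diff_ge_0_iff_ge one_le_exp_iff)
  finally show ?thesis by (simp add: distrib_left mult_ac)
qed

lemma sum_multiples:
  fixes g :: "nat \<Rightarrow> 'a::comm_monoid_add"
  assumes "0 < b"
  shows "(\<Sum>i<b * A. if b dvd i then g i else 0) = (\<Sum>i<A. g (b * i))"
proof -
  have "(\<Sum>i<b * A. if b dvd i then g i else 0) = (\<Sum>i\<in>{i\<in>{..<b * A}. b dvd i}. g i)"
    by (rule sum.inter_filter[symmetric]) simp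
  also have "{i\<in>{..<b * A}. b dvd i} = (\<lambda>i. b * i) ` {..<A}" using assms by (auto simp: dvd_def)
  also have "sum g ((\<lambda>i. b * i) ` {..<A}) = (\<Sum>i<A. g (b * i))"
    using assms by (subst sum.reindex) (auto simp: inj_on_def)
  finally show ?thesis .
qed

text \<open>The layered vector over an equidistant grid repeats one and the same coefficient pattern \<open>V\<close>;
  evaluated at \<open>N\<close> it consists of \<open>N\<close> successive copies of that pattern.\<close>

lemma layers_pattern:
  assumes "\<forall>m\<in>set ms. 1 \<le> m"
  shows "\<exists>V. (\<forall>i. 0 \<le> V i) \<and> (\<forall>i. V (i + prod_list ms ^ (2 * K)) = V i) \<and>
    (\<forall>(y::nat \<Rightarrow> 'a::real_vector) L N. 0 < L \<longrightarrow> 1 \<le> N \<longrightarrow> N * prod_list ms ^ (2 * K) dvd L \<longrightarrow>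
      layers \<kappa> \<eta> K ms (equidistant_sum y L) N
        = (\<Sum>i<N * prod_list ms ^ (2 * K). V i *\<^sub>R y (i * (L div (N * prod_list ms ^ (2 * K))))))"
  using assms
proof (induction ms)
  case Nil
  show ?case by (intro exI[of _ "\<lambda>_. 1"]) (simp add: equidistant_sum_def)
next
  case (Cons m ms)
  define Q where "Q = prod_list ms ^ (2 * K)"
  have m: "1 \<le> m" "\<forall>m\<in>set ms. 1 \<le> m" using Cons.prems by auto
  have Q: "1 \<le> Q" using prod_list_pos[OF m(2)] by (simp add: Q_def Suc_le_eq)
  from Cons.IH[OF m(2), folded Q_def] obtain V where
    "(\<forall>i. 0 \<le> V i) \<and> (\<forall>i. V (i + Q) = V i) \<and>
    (\<forall>(y::nat \<Rightarrow> 'a) L N. 0 < L \<longrightarrow> 1 \<le> N \<longrightarrow> N * Q dvd L \<longrightarrow>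
      layers \<kappa> \<eta> K ms (equidistant_sum y L) N = (\<Sum>i<N * Q. V i *\<^sub>R y (i * (L div (N * Q)))))" ..
  then have V: "\<And>i. 0 \<le> V i" "\<And>i. V (i + Q) = V i"
    "\<And>(y::nat \<Rightarrow> 'a) L N. 0 < L \<Longrightarrow> 1 \<le> N \<Longrightarrow> N * Q dvd L \<Longrightarrow>
      layers \<kappa> \<eta> K ms (equidistant_sum y L) N = (\<Sum>i<N * Q. V i *\<^sub>R y (i * (L div (N * Q))))"
    by simp_all
  have period: "V (i + k * Q) = V i" for i k
  proof (induction k)
    case (Suc k)
    have "V (i + Suc k * Q) = V ((i + k * Q) + Q)" by (simp add: algebra_simps)
    then show ?case using Suc V(2) by simp
  qed simp
  define Q' where "Q' = prod_list (m # ms) ^ (2 * K)"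
  \<comment> \<open>in the refined grid, layer \<open>a\<close> occupies every \<open>b a\<close>-th position\<close>
  define b where "b a = m ^ (2 * K - a)" for a
  have b: "0 < b a" for a using m by (simp add: b_def)
  have bQ: "Q' = b a * (m ^ a * Q)" if "a \<le> 2 * K" for a
  proof -
    have "m ^ (2 * K) = b a * m ^ a" using that by (simp add: b_def flip: power_add)
    then show ?thesis by (simp add: Q'_def Q_def power_mult_distrib)
  qed
  define W where "W i = (\<Sum>a\<le>2 * K. layer_weight \<kappa> \<eta> K m a * (if b a dvd i then V (i div b a) else 0))" for i
  have "0 \<le> W i" for i unfolding W_def by (auto intro!: sum_nonneg mult_nonneg_nonneg layer_weight_nonneg V(1))
  moreover have "W (i + Q') = W i" for i
    unfolding W_def
  proof (intro sum.cong refl arg_cong2[of _ _ _ _ "(*)"])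
    fix a assume "a \<in> {..2 * K}"
    then have a: "Q' = b a * (m ^ a * Q)" by (intro bQ) simp
    have "b a dvd Q'" unfolding a by simp
    then have "b a dvd i + Q' \<longleftrightarrow> b a dvd i" by (rule dvd_add_left_iff)
    moreover have "(i + Q') div b a = i div b a + m ^ a * Q" unfolding a using b[of a] by simp
    ultimately show "(if b a dvd i + Q' then V ((i + Q') div b a) else 0) = (if b a dvd i then V (i div b a) else 0)"
      by (simp add: period)
  qed
  moreover have "layers \<kappa> \<eta> K (m # ms) (equidistant_sum y L) N = (\<Sum>i<N * Q'. W i *\<^sub>R y (i * (L div (N * Q'))))"
    if L: "0 < L" "1 \<le> N" "N * Q' dvd L" for y :: "nat \<Rightarrow> 'a" and L N
  proof -
    have "layers \<kappa> \<eta> K ms (equidistant_sum y L) (m ^ a * N)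
        = (\<Sum>i<N * Q'. (if b a dvd i then V (i div b a) else 0) *\<^sub>R y (i * (L div (N * Q'))))"
      if a: "a \<le> 2 * K" for a
    proof -
      have NQ: "N * Q' = b a * (m ^ a * N * Q)" using bQ[OF a] by (simp add: mult_ac)
      have "m ^ a * N * Q dvd N * Q'" unfolding NQ by simp
      then have dv: "m ^ a * N * Q dvd L" using L(3) by (rule dvd_trans)
      have step: "L div (m ^ a * N * Q) = b a * (L div (N * Q'))"
      proof -
        obtain c where c: "L = N * Q' * c" using L(3) ..
        have pos: "m ^ a * N * Q \<noteq> 0" "N * Q' \<noteq> 0" using L(1) c unfolding NQ by auto
        have "L = m ^ a * N * Q * (b a * c)" unfolding c NQ by (simp only: mult_ac)
        then have "L div (m ^ a * N * Q) = b a * c" by (metis nonzero_mult_div_cancel_left pos(1))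
        moreover have "L div (N * Q') = c" unfolding c using pos(2) by (rule nonzero_mult_div_cancel_left)
        ultimately show ?thesis by simp
      qed
      have "layers \<kappa> \<eta> K ms (equidistant_sum y L) (m ^ a * N)
          = (\<Sum>i<m ^ a * N * Q. V i *\<^sub>R y (i * (L div (m ^ a * N * Q))))"
        using dv L m by (intro V(3)) (auto simp: Suc_le_eq)
      also have "\<dots> = (\<Sum>i<m ^ a * N * Q. V (b a * i div b a) *\<^sub>R y (b a * i * (L div (N * Q'))))"
      proof (intro sum.cong refl arg_cong2[of _ _ _ _ "(*\<^sub>R)"] arg_cong[of _ _ V] arg_cong[of _ _ y])
        fix i
        show "i = b a * i div b a" using b[of a] by simp
        show "i * (L div (m ^ a * N * Q)) = b a * i * (L div (N * Q'))"
          unfolding step by (simp only: mult.assoc mult.left_commute)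
      qed
      also have "\<dots> = (\<Sum>i<b a * (m ^ a * N * Q). if b a dvd i then V (i div b a) *\<^sub>R y (i * (L div (N * Q'))) else 0)"
        by (rule sum_multiples[OF b, symmetric])
      also have "\<dots> = (\<Sum>i<N * Q'. (if b a dvd i then V (i div b a) else 0) *\<^sub>R y (i * (L div (N * Q'))))"
        unfolding NQ by (intro sum.cong) auto
      finally show ?thesis .
    qed
    then have "layers \<kappa> \<eta> K (m # ms) (equidistant_sum y L) N
        = (\<Sum>a\<le>2 * K. layer_weight \<kappa> \<eta> K m a *\<^sub>R (\<Sum>i<N * Q'. (if b a dvd i then V (i div b a) else 0) *\<^sub>R y (i * (L div (N * Q')))))"
      by (simp add: layer_def)
    also have "\<dots> = (\<Sum>i<N * Q'. \<Sum>a\<le>2 * K. (layer_weight \<kappa> \<eta> K m a * (if b a dvd i then V (i div b a) else 0)) *\<^sub>R y (i * (L div (N * Q'))))"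
      unfolding scaleR_sum_right scaleR_scaleR by (rule sum.swap)
    also have "\<dots> = (\<Sum>i<N * Q'. W i *\<^sub>R y (i * (L div (N * Q'))))"
      by (simp add: W_def scaleR_sum_left)
    finally show ?thesis .
  qed
  ultimately show ?case unfolding Q'_def[symmetric] by (intro exI[of _ W]) simp
qed

section \<open>Blocks that behave like a power function\<close>

text \<open>The parameters are chosen in this order: \<open>\<eta>\<close> makes neighbouring layers almost equally weighted, \<open>\<xi>\<close> makes
  the growth error slower than half of the damping \<open>exp (\<eta> K)\<close>, and \<open>K\<close>, which may depend on the constants
  \<open>C\<close> of the family belonging to \<open>\<xi>\<close>, makes the outermost layers negligible.\<close>

lemma ex_layer_parameters:
  fixes \<kappa> \<epsilon> :: real
  assumes \<kappa>: "0 \<le> \<kappa>" "\<kappa> \<le> 1" and M: "1 \<le> M" and \<epsilon>: "0 < \<epsilon>" and P: "1 \<le> (P::real)"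
  obtains \<eta> \<xi> :: real where "0 < \<eta>" "0 < \<xi>"
    "\<And>C. 0 < C \<Longrightarrow> \<exists>K\<ge>1. \<forall>m\<in>{1..M}. (exp \<eta> - 1) * real m powr \<kappa>
      + exp (- (\<eta> * real K)) * (2 * C * (2 * real K + 1) ^ M * P powr (6 * real K * \<xi>) * real m powr \<kappa>) \<le> \<epsilon>"
proof -
  define \<eta> where "\<eta> = ln (1 + \<epsilon> / (2 * real M))"
  define \<xi> where "\<xi> = \<eta> / (12 * (ln P + 1))"
  have M0: "0 < real M" using M by simp
  have \<eta>: "0 < \<eta>" "exp \<eta> - 1 = \<epsilon> / (2 * real M)"
  proof -
    have "0 < \<epsilon> / (2 * real M)" using \<epsilon> M0 by simp
    then show "0 < \<eta>" "exp \<eta> - 1 = \<epsilon> / (2 * real M)" by (simp_all add: \<eta>_def)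
  qed
  have lnP: "0 \<le> ln P" using P by simp
  have \<xi>: "0 < \<xi>" using \<eta> lnP by (simp add: \<xi>_def)
  have growth: "P powr (6 * real K * \<xi>) \<le> exp (\<eta> * real K / 2)" for K
  proof -
    have "P powr (6 * real K * \<xi>) = exp (6 * real K * \<xi> * ln P)" using P by (simp add: powr_def)
    also have "6 * real K * \<xi> * ln P \<le> \<eta> * real K / 2"
    proof -
      have "\<xi> * ln P \<le> \<eta> / 12" using \<eta> lnP by (simp add: \<xi>_def field_simps)
      then have "6 * real K * (\<xi> * ln P) \<le> 6 * real K * (\<eta> / 12)" by (intro mult_left_mono) auto
      then show ?thesis by (simp add: mult_ac)
    qed
    finally show ?thesis by simp
  qed
  have lim: "(\<lambda>K. (2 * real K + 1) ^ M * exp (- (\<eta> * real K / 2))) \<longlonglongrightarrow> 0"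
  proof -
    define x where "x K = \<eta> / 4 * (2 * real K + 1)" for K :: nat
    have "filterlim x at_top sequentially"
      unfolding x_def using \<eta>
      by (intro filterlim_tendsto_pos_mult_at_top[OF tendsto_const] filterlim_tendsto_add_at_top[OF tendsto_const, of _ _ 1, simplified add.commute[of 1]] filterlim_real_sequentially) auto
    then have "(\<lambda>K. x K ^ M / exp (x K)) \<longlonglongrightarrow> 0"
      by (rule filterlim_compose[OF tendsto_power_div_exp_0])
    then have "(\<lambda>K. (4 / \<eta>) ^ M * exp (\<eta> / 4) * (x K ^ M / exp (x K))) \<longlonglongrightarrow> (4 / \<eta>) ^ M * exp (\<eta> / 4) * 0"
      by (intro tendsto_intros)
    moreover have "(4 / \<eta>) ^ M * exp (\<eta> / 4) * (x K ^ M / exp (x K)) = (2 * real K + 1) ^ M * exp (- (\<eta> * real K / 2))" for K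
    proof -
      have "(4 / \<eta>) ^ M * x K ^ M = (2 * real K + 1) ^ M"
      proof -
        have "4 / \<eta> * x K = 2 * real K + 1" using \<eta>(1) by (simp add: x_def)
        then show ?thesis by (simp only: power_mult_distrib[symmetric])
      qed
      moreover have "exp (\<eta> / 4) / exp (x K) = exp (- (\<eta> * real K / 2))"
        by (simp add: x_def exp_diff[symmetric] algebra_simps)
      moreover have "(4 / \<eta>) ^ M * exp (\<eta> / 4) * (x K ^ M / exp (x K)) = ((4 / \<eta>) ^ M * x K ^ M) * (exp (\<eta> / 4) / exp (x K))"
        by simp
      ultimately show ?thesis by (simp only:)
    qed
    ultimately show ?thesis by simp
  qed
  show ?thesis
  proof (rule that[OF \<eta>(1) \<xi>])
    fix C :: real assume C: "0 < C"
    have "0 < \<epsilon> / (4 * C * real M)" using \<epsilon> C M0 by simp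
    with lim have "eventually (\<lambda>K. \<bar>(2 * real K + 1) ^ M * exp (- (\<eta> * real K / 2))\<bar> < \<epsilon> / (4 * C * real M)) sequentially"
      by (auto simp: tendsto_iff)
    then have "eventually (\<lambda>K. 1 \<le> K \<and> \<bar>(2 * real K + 1) ^ M * exp (- (\<eta> * real K / 2))\<bar> < \<epsilon> / (4 * C * real M)) sequentially"
      by (intro eventually_conj eventually_ge_at_top)
    from eventually_happens'[OF sequentially_bot this] obtain K where K: "1 \<le> K" "\<bar>(2 * real K + 1) ^ M * exp (- (\<eta> * real K / 2))\<bar> < \<epsilon> / (4 * C * real M)"
      by (elim exE conjE)
    have "exp (- (\<eta> * real K)) * P powr (6 * real K * \<xi>) \<le> exp (- (\<eta> * real K)) * exp (\<eta> * real K / 2)"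
      using growth by (intro mult_left_mono) auto
    also have "\<dots> = exp (- (\<eta> * real K / 2))" by (simp add: mult_exp_exp)
    finally have e: "exp (- (\<eta> * real K)) * P powr (6 * real K * \<xi>) \<le> exp (- (\<eta> * real K / 2))" .
    show "\<exists>K\<ge>1. \<forall>m\<in>{1..M}. (exp \<eta> - 1) * real m powr \<kappa>
      + exp (- (\<eta> * real K)) * (2 * C * (2 * real K + 1) ^ M * P powr (6 * real K * \<xi>) * real m powr \<kappa>) \<le> \<epsilon>"
    proof (intro exI[of _ K] conjI ballI)
      fix m assume m: "m \<in> {1..M}"
      have "real m powr \<kappa> \<le> real m powr 1" using m \<kappa> by (intro powr_mono) auto
      then have mk: "real m powr \<kappa> \<le> real M" using m by simp
      have "(exp \<eta> - 1) * real m powr \<kappa> \<le> (exp \<eta> - 1) * real M"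
        using mk \<eta>(1) by (intro mult_left_mono) auto
      also have "\<dots> = \<epsilon> / 2" using \<eta>(2) M0 by simp
      finally have 1: "(exp \<eta> - 1) * real m powr \<kappa> \<le> \<epsilon> / 2" .
      have "exp (- (\<eta> * real K)) * (2 * C * (2 * real K + 1) ^ M * P powr (6 * real K * \<xi>) * real m powr \<kappa>)
          = 2 * C * (2 * real K + 1) ^ M * (exp (- (\<eta> * real K)) * P powr (6 * real K * \<xi>)) * real m powr \<kappa>"
        by simp
      also have "\<dots> \<le> 2 * C * (2 * real K + 1) ^ M * exp (- (\<eta> * real K / 2)) * real M"
        using e mk C by (intro mult_mono) auto
      also have "\<dots> = 2 * C * real M * ((2 * real K + 1) ^ M * exp (- (\<eta> * real K / 2)))" by simp
      also have "\<dots> \<le> 2 * C * real M * (\<epsilon> / (4 * C * real M))"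
        using K(2) C M0 by (intro mult_left_mono) auto
      also have "\<dots> = \<epsilon> / 2" using C M0 by simp
      finally show "(exp \<eta> - 1) * real m powr \<kappa>
        + exp (- (\<eta> * real K)) * (2 * C * (2 * real K + 1) ^ M * P powr (6 * real K * \<xi>) * real m powr \<kappa>) \<le> \<epsilon>"
        using 1 by simp
    qed (rule K(1))
  qed
qed

text \<open>The middle layer bounds the norm of the layered vector from below. Compared with it the outermost
  layers are small, so the error in the shift relation becomes a relative one.\<close>

lemma layers_eigenvector:
  fixes \<phi> :: "nat \<Rightarrow> 'a::banach_lattice"
  assumes pos: "\<And>N. 0 \<le> \<phi> N" and \<eta>: "0 < \<eta>" and \<xi>: "0 < \<xi>" and D: "0 < D" and d: "0 < d"
    and ms: "\<forall>m\<in>set ms. 1 \<le> m" and len: "length ms \<le> M" and K: "1 \<le> K"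
    and \<phi>: "\<And>N. 1 \<le> N \<Longrightarrow> N \<le> L \<Longrightarrow> d * real N powr (\<kappa> - \<xi>) \<le> norm (\<phi> N)"
      "\<And>N. 1 \<le> N \<Longrightarrow> N \<le> L \<Longrightarrow> norm (\<phi> N) \<le> D * real N powr (\<kappa> + \<xi>)"
    and m: "m \<in> set ms" and L: "m * prod_list ms ^ (2 * K) \<le> L"
  defines "P \<equiv> real (prod_list ms)"
  shows "norm (real m powr \<kappa> *\<^sub>R layers \<kappa> \<eta> K ms \<phi> 1 - layers \<kappa> \<eta> K ms \<phi> m)
      \<le> ((exp \<eta> - 1) * real m powr \<kappa>
        + exp (- (\<eta> * real K)) * (2 * (D / d) * (2 * real K + 1) ^ M * P powr (6 * real K * \<xi>) * real m powr \<kappa>))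
        * norm (layers \<kappa> \<eta> K ms \<phi> 1)"
    and "d * P powr (- (real K * \<xi>)) \<le> norm (layers \<kappa> \<eta> K ms \<phi> 1)"
proof -
  define rs where "rs = remove1 m ms"
  define \<psi> where "\<psi> = layers \<kappa> \<eta> K rs \<phi>"
  have layers: "layers \<kappa> \<eta> K ms \<phi> = layer \<kappa> \<eta> K m \<psi>"
    unfolding \<psi>_def rs_def by (rule layers_remove1[OF m])
  have prod: "prod_list ms = m * prod_list rs" unfolding rs_def by (rule prod_list_remove1_nat[OF m])
  have m1: "1 \<le> m" using ms m by simp
  have rs1: "\<forall>m\<in>set rs. 1 \<le> m" using ms notin_set_remove1 unfolding rs_def by metis
  have P1: "1 \<le> prod_list rs" "1 \<le> prod_list ms" using prod_list_pos rs1 ms by blast+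
  have Pge: "real m \<le> P" "real (prod_list rs) \<le> P" "1 \<le> P"
    using P1 m1 by (simp_all add: P_def prod flip: of_nat_mult)
  have QL: "prod_list ms ^ (2 * K) \<le> L"
    using L m1 by (metis dual_order.trans mult.commute mult_le_mono1 nat_mult_1)
  show low: "d * P powr (- (real K * \<xi>)) \<le> norm (layers \<kappa> \<eta> K ms \<phi> 1)"
    using norm_layers_ge[of d ms \<phi> L \<kappa> \<xi> 1 K \<eta>] d ms pos \<phi>(1) QL by (simp add: P_def)
  define B where "B = D * (2 * real K + 1) ^ M * P powr (2 * real K * \<xi>)"
  have B: "0 < B" using D Pge by (simp add: B_def)
  have \<psi>: "norm (\<psi> N) \<le> B * real N powr (\<kappa> + \<xi>)" if N: "1 \<le> N" "N * prod_list rs ^ (2 * K) \<le> L" for N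
  proof -
    have "norm (\<psi> N) \<le> D * (2 * real K + 1) ^ length rs * real (prod_list rs) powr (2 * real K * \<xi>) * real N powr (\<kappa> + \<xi>)"
      unfolding \<psi>_def using \<eta> \<xi> D rs1 \<phi>(2) N by (intro norm_layers_le) auto
    also have "\<dots> \<le> B * real N powr (\<kappa> + \<xi>)"
      unfolding B_def
    proof (intro mult_right_mono mult_mono power_increasing powr_mono2)
      show "length rs \<le> M" using len m by (simp add: rs_def length_remove1)
    qed (use D \<xi> Pge P1 in auto)
    finally show ?thesis .
  qed
  have n1: "norm (\<psi> 1) \<le> B"
  proof -
    have "prod_list rs ^ (2 * K) \<le> prod_list ms ^ (2 * K)" using m1 by (intro power_mono) (simp_all add: prod)
    then show ?thesis using \<psi>[of 1] QL by simp
  qed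
  have n2: "real m powr (- (2 * real K * \<kappa>)) * norm (\<psi> (m ^ (2 * K + 1))) \<le> B * (real m powr \<kappa> * P powr (3 * real K * \<xi>))"
  proof -
    have "m ^ (2 * K + 1) * prod_list rs ^ (2 * K) = m * prod_list ms ^ (2 * K)"
      by (simp add: prod power_mult_distrib)
    then have "m ^ (2 * K + 1) * prod_list rs ^ (2 * K) \<le> L" using L by (simp only:)
    then have "norm (\<psi> (m ^ (2 * K + 1))) \<le> B * real (m ^ (2 * K + 1)) powr (\<kappa> + \<xi>)"
      using one_le_power[OF m1] by (intro \<psi>)
    also have "real (m ^ (2 * K + 1)) powr (\<kappa> + \<xi>) = real m powr (real (2 * K + 1) * (\<kappa> + \<xi>))"
      using m1 by (simp add: powr_realpow[symmetric] powr_powr del: power_Suc of_nat_add)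
    finally have "real m powr (- (2 * real K * \<kappa>)) * norm (\<psi> (m ^ (2 * K + 1)))
        \<le> real m powr (- (2 * real K * \<kappa>)) * (B * real m powr (real (2 * K + 1) * (\<kappa> + \<xi>)))"
      by (intro mult_left_mono) auto
    also have "\<dots> = B * (real m powr (- (2 * real K * \<kappa>)) * real m powr (real (2 * K + 1) * (\<kappa> + \<xi>)))" by simp
    also have "real m powr (- (2 * real K * \<kappa>)) * real m powr (real (2 * K + 1) * (\<kappa> + \<xi>)) = real m powr \<kappa> * real m powr ((2 * real K + 1) * \<xi>)"
      by (simp add: powr_add[symmetric] algebra_simps)
    also have "B * \<dots> \<le> B * (real m powr \<kappa> * P powr (3 * real K * \<xi>))"
    proof (intro mult_left_mono)
      have "real m powr ((2 * real K + 1) * \<xi>) \<le> P powr ((2 * real K + 1) * \<xi>)"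
        using Pge \<xi> by (intro powr_mono2) auto
      also have "\<dots> \<le> P powr (3 * real K * \<xi>)"
        using Pge K \<xi> by (intro powr_mono mult_right_mono) auto
      finally show "real m powr ((2 * real K + 1) * \<xi>) \<le> P powr (3 * real K * \<xi>)" .
    qed (use B in auto)
    finally show ?thesis .
  qed
  define p where "p = norm (layers \<kappa> \<eta> K ms \<phi> 1)"
  have B_le: "B * P powr (3 * real K * \<xi>) \<le> (D / d) * (2 * real K + 1) ^ M * P powr (6 * real K * \<xi>) * p"
  proof -
    have "P powr (2 * real K * \<xi>) * P powr (3 * real K * \<xi>) = P powr (6 * real K * \<xi>) * P powr (- (real K * \<xi>))"
      by (simp add: powr_add[symmetric] algebra_simps)
    then have "B * P powr (3 * real K * \<xi>) = (D / d) * (2 * real K + 1) ^ M * P powr (6 * real K * \<xi>) * (d * P powr (- (real K * \<xi>)))"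
      using d by (simp add: B_def)
    also have "\<dots> \<le> (D / d) * (2 * real K + 1) ^ M * P powr (6 * real K * \<xi>) * p"
      using low D d unfolding p_def by (intro mult_left_mono) auto
    finally show ?thesis .
  qed
  have "real m powr \<kappa> * norm (\<psi> 1) \<le> B * (real m powr \<kappa> * P powr (3 * real K * \<xi>))"
  proof -
    have "1 \<le> P powr (3 * real K * \<xi>)" using Pge \<xi> by (intro ge_one_powr_ge_zero) auto
    then have "real m powr \<kappa> * B \<le> real m powr \<kappa> * (B * P powr (3 * real K * \<xi>))"
      using B by (intro mult_left_mono) auto
    moreover have "real m powr \<kappa> * norm (\<psi> 1) \<le> real m powr \<kappa> * B" using n1 by (intro mult_left_mono) auto
    ultimately show ?thesis by (simp add: mult_ac)
  qed
  with n2 have "real m powr \<kappa> * norm (\<psi> 1) + real m powr (- (2 * real K * \<kappa>)) * norm (\<psi> (m ^ (2 * K + 1)))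
      \<le> 2 * (B * P powr (3 * real K * \<xi>)) * real m powr \<kappa>" by (simp add: algebra_simps)
  also have "\<dots> \<le> 2 * ((D / d) * (2 * real K + 1) ^ M * P powr (6 * real K * \<xi>) * p) * real m powr \<kappa>"
    using B_le by (intro mult_right_mono) auto
  finally have "exp (- (\<eta> * real K)) * (real m powr \<kappa> * norm (\<psi> 1) + real m powr (- (2 * real K * \<kappa>)) * norm (\<psi> (m ^ (2 * K + 1))))
      \<le> exp (- (\<eta> * real K)) * (2 * ((D / d) * (2 * real K + 1) ^ M * P powr (6 * real K * \<xi>) * p) * real m powr \<kappa>)"
    by (intro mult_left_mono) auto
  moreover have "norm (real m powr \<kappa> *\<^sub>R layers \<kappa> \<eta> K ms \<phi> 1 - layers \<kappa> \<eta> K ms \<phi> m)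
      \<le> (exp \<eta> - 1) * real m powr \<kappa> * p
        + exp (- (\<eta> * real K)) * (real m powr \<kappa> * norm (\<psi> 1) + real m powr (- (2 * real K * \<kappa>)) * norm (\<psi> (m ^ (2 * K + 1))))"
    unfolding p_def layers using \<eta> m1 by (intro layer_shift) (auto simp: \<psi>_def intro: layers_nonneg pos)
  ultimately have calculation: "exp (- (\<eta> * real K)) * (real m powr \<kappa> * norm (\<psi> 1) + real m powr (- (2 * real K * \<kappa>)) * norm (\<psi> (m ^ (2 * K + 1))))
      \<le> exp (- (\<eta> * real K)) * (2 * ((D / d) * (2 * real K + 1) ^ M * P powr (6 * real K * \<xi>) * p) * real m powr \<kappa>)"
    "norm (real m powr \<kappa> *\<^sub>R layers \<kappa> \<eta> K ms \<phi> 1 - layers \<kappa> \<eta> K ms \<phi> m)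
      \<le> (exp \<eta> - 1) * real m powr \<kappa> * p
        + exp (- (\<eta> * real K)) * (real m powr \<kappa> * norm (\<psi> 1) + real m powr (- (2 * real K * \<kappa>)) * norm (\<psi> (m ^ (2 * K + 1))))"
    by simp_all
  show "norm (real m powr \<kappa> *\<^sub>R layers \<kappa> \<eta> K ms \<phi> 1 - layers \<kappa> \<eta> K ms \<phi> m)
      \<le> ((exp \<eta> - 1) * real m powr \<kappa>
        + exp (- (\<eta> * real K)) * (2 * (D / d) * (2 * real K + 1) ^ M * P powr (6 * real K * \<xi>) * real m powr \<kappa>))
        * norm (layers \<kappa> \<eta> K ms \<phi> 1)"
  proof -
    have eq: "exp (- (\<eta> * real K)) * (2 * ((D / d) * (2 * real K + 1) ^ M * P powr (6 * real K * \<xi>) * p) * real m powr \<kappa>)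
      = exp (- (\<eta> * real K)) * (2 * (D / d) * (2 * real K + 1) ^ M * P powr (6 * real K * \<xi>) * real m powr \<kappa>) * p"
      by (simp only: mult_ac)
    show ?thesis using calculation unfolding p_def[symmetric] distrib_right eq by linarith
  qed
qed

text \<open>The positions in the \<open>j\<close>-th segment of length \<open>L\<close> that are used by \<open>m\<close> copies of a pattern of period \<open>Q\<close>.\<close>

definition grid :: "nat \<Rightarrow> nat \<Rightarrow> nat \<Rightarrow> nat \<Rightarrow> nat list" where
  "grid L Q j m = map (\<lambda>i. j * L + i * (L div (m * Q))) [0..<m * Q]"

lemma grid_index_less:
  fixes N L i :: nat
  assumes "1 \<le> N" "N \<le> L" "i < N"
  shows "i * (L div N) < L"
proof -
  have "0 < L div N" using assms by (simp add: div_greater_zero_iff)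
  then have "i * (L div N) < N * (L div N)" using assms(3) by simp
  also have "\<dots> \<le> L" by simp
  finally show ?thesis .
qed

lemma grid_sorted:
  assumes L: "0 < L" "m = 0 \<or> m * Q dvd L"
  shows "sorted_wrt (<) (grid L Q j m)" "set (grid L Q j m) \<subseteq> {j * L..<Suc j * L}" "length (grid L Q j m) = m * Q"
proof -
  have le: "m * Q \<le> L" using L by (auto intro: dvd_imp_le)
  have "a + i * (L div (m * Q)) < a + i' * (L div (m * Q))" if "i < i'" "i' < m * Q" for a i i'
  proof -
    have "0 < m * Q" using that by (cases "m * Q") simp_all
    then have "0 < L div (m * Q)" using le by (simp only: div_greater_zero_iff)
    then show ?thesis using that by simp
  qed
  then show "sorted_wrt (<) (grid L Q j m)" by (simp add: grid_def sorted_wrt_iff_nth_less)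
  show "set (grid L Q j m) \<subseteq> {j * L..<Suc j * L}"
  proof -
    have "i * (L div (m * Q)) < L" if "i < m * Q" for i
      using that by (intro grid_index_less[OF _ le]) (cases "m * Q", simp_all)
    then show ?thesis by (auto simp: grid_def)
  qed
  show "length (grid L Q j m) = m * Q" by (simp add: grid_def)
qed

text \<open>Grids with \<open>m\<^sub>j\<close> copies in the \<open>j\<close>-th segment join to one list of positions carrying \<open>\<Sum>\<^sub>j m\<^sub>j\<close> copies, since
  each grid ends with a complete period.\<close>

lemma concat_grids:
  assumes L: "0 < L" and m: "\<And>j. j < n \<Longrightarrow> m j = 0 \<or> m j * Q dvd L" and V: "\<And>i. V (i + Q) = V i"
  defines "ps \<equiv> concat (map (\<lambda>j. grid L Q j (m j)) [0..<n])"
  shows "sorted_wrt (<) ps" "set ps \<subseteq> {..<n * L}" "length ps = (\<Sum>j<n. m j) * Q"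
    "pattern_sum V x ps = (\<Sum>j<n. pattern_sum V x (grid L Q j (m j)))"
  using m unfolding ps_def
proof (induction n)
  case 0
  case 1 show ?case by simp
  case 2 show ?case by simp
  case 3 show ?case by simp
  case 4 show ?case by (simp add: pattern_sum_def)
next
  case (Suc n)
  let ?ps = "concat (map (\<lambda>j. grid L Q j (m j)) [0..<n])"
  have snoc: "concat (map (\<lambda>j. grid L Q j (m j)) [0..<Suc n]) = ?ps @ grid L Q n (m n)" by simp
  {
    case 1
    have IH: "sorted_wrt (<) ?ps" "set ?ps \<subseteq> {..<n * L}" using Suc.IH(1,2) 1 by simp_all
    note g = grid_sorted[OF L 1(1)[of n, simplified], of n]
    show ?case unfolding snoc sorted_wrt_append using IH g(1,2) by force
  next
    case 2
    have IH: "set ?ps \<subseteq> {..<n * L}" using Suc.IH(2) 2 by simp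
    note g = grid_sorted[OF L 2(1)[of n, simplified], of n]
    show ?case unfolding snoc using IH g(2) by (force simp: subset_iff)
  next
    case 3
    then show ?case unfolding snoc using Suc.IH(3) grid_sorted(3)[OF L, of "m n" Q n]
      by (simp add: distrib_right)
  next
    case 4
    have len: "length ?ps = (\<Sum>j<n. m j) * Q" using Suc.IH(3) 4 by simp
    have "pattern_sum V x ?ps = (\<Sum>j<n. pattern_sum V x (grid L Q j (m j)))" using Suc.IH(4) 4 by simp
    then show ?case unfolding snoc using pattern_sum_append[of V Q ?ps x "grid L Q n (m n)"] V len by simp
  }
qed

lemma pattern_sum_grid:
  "pattern_sum V x (grid L Q j m) = (\<Sum>i<m * Q. V i *\<^sub>R x (j * L + i * (L div (m * Q))))"
  by (simp add: pattern_sum_def grid_def)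

text \<open>There are arbitrarily long families in which the sum of any \<open>N\<close> members has norm \<open>N powr \<kappa>\<close> up to an
  arbitrarily small change of the exponent; the factors \<open>d\<close> and \<open>D\<close> do not depend on the length.\<close>

definition has_power_families :: "'a::banach_lattice itself \<Rightarrow> real \<Rightarrow> bool" where
  "has_power_families _ \<kappa> \<longleftrightarrow> (\<forall>\<xi>>0. \<exists>D>0. \<exists>d>0. \<forall>R. \<exists>x::nat \<Rightarrow> 'a.
      disjoint_pos {..<R} x \<and> (\<forall>i<R. norm (x i) = 1) \<and>
      (\<forall>A\<subseteq>{..<R}. A \<noteq> {} \<longrightarrow> d * real (card A) powr (\<kappa> - \<xi>) \<le> norm (\<Sum>i\<in>A. x i) \<and>
        norm (\<Sum>i\<in>A. x i) \<le> D * real (card A) powr (\<kappa> + \<xi>)))"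

text \<open>In a homogeneous subfamily place a layered vector \<open>v\<^sub>j\<close> in the \<open>j\<close>-th of \<open>n\<close> consecutive segments. By the
  approximate eigenvector property \<open>(m\<^sub>j powr \<kappa>) v\<^sub>j\<close> may be replaced by \<open>m\<^sub>j\<close> copies of the pattern in the same
  segment. The copies from all segments form a pattern that depends, up to position, only on their
  total number \<open>s\<close>, and homogeneity moves it into one segment, where it resembles \<open>s powr \<kappa>\<close> times a
  single copy.\<close>

lemma ex_power_blocks:
  assumes \<kappa>: "0 \<le> \<kappa>" "\<kappa> \<le> 1"
    and families: "has_power_families TYPE('a::banach_lattice) \<kappa>"
    and n: "1 \<le> n" and M: "1 \<le> M" and \<epsilon>: "0 < \<epsilon>"
  shows "\<exists>(v::nat \<Rightarrow> 'a) G. 0 < G \<and> disjoint_pos {..<n} v \<and>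
    (\<forall>m. 1 \<le> (\<Sum>j<n. m j) \<longrightarrow> (\<Sum>j<n. m j) \<le> M \<longrightarrow>
      \<bar>norm (\<Sum>j<n. (real (m j) powr \<kappa>) *\<^sub>R v j) - real (\<Sum>j<n. m j) powr \<kappa> * G\<bar> \<le> \<epsilon> * G)"
proof -
  define \<epsilon>1 where "\<epsilon>1 = min 1 (\<epsilon> / (2 * real n + 2))"
  have \<epsilon>1: "0 < \<epsilon>1" "\<epsilon>1 \<le> 1" "(2 * real n + 2) * \<epsilon>1 \<le> \<epsilon>"
  proof -
    have n0: "0 < 2 * real n + 2" by simp
    show "0 < \<epsilon>1" "\<epsilon>1 \<le> 1" using \<epsilon> n0 by (simp_all add: \<epsilon>1_def)
    have "\<epsilon>1 \<le> \<epsilon> / (2 * real n + 2)" by (simp add: \<epsilon>1_def)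
    then show "(2 * real n + 2) * \<epsilon>1 \<le> \<epsilon>" using n0 by (simp only: pos_le_divide_eq mult.commute)
  qed
  define ms where "ms = [1..<Suc M]"
  have ms: "\<forall>m\<in>set ms. 1 \<le> m" "length ms \<le> M" "set ms = {1..M}" by (auto simp: ms_def)
  define P where "P = prod_list ms"
  have P1: "1 \<le> P" unfolding P_def using ms(1) by (rule prod_list_pos)
  then have "1 \<le> real P" by simp
  from ex_layer_parameters[OF \<kappa> M \<epsilon>1(1) this] obtain \<eta> \<xi> :: real where \<eta>\<xi>: "0 < \<eta>" "0 < \<xi>"
    and params: "\<And>C. 0 < C \<Longrightarrow> \<exists>K\<ge>1. \<forall>m\<in>{1..M}. (exp \<eta> - 1) * real m powr \<kappa>
      + exp (- (\<eta> * real K)) * (2 * C * (2 * real K + 1) ^ M * real P powr (6 * real K * \<xi>) * real m powr \<kappa>) \<le> \<epsilon>1"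
    by metis
  from families[unfolded has_power_families_def, rule_format, OF \<eta>\<xi>(2)] obtain D d where D: "0 < D" and d: "0 < d" and fam:
    "\<And>R. \<exists>x::nat \<Rightarrow> 'a. disjoint_pos {..<R} x \<and> (\<forall>i<R. norm (x i) = 1) \<and>
      (\<forall>A\<subseteq>{..<R}. A \<noteq> {} \<longrightarrow> d * real (card A) powr (\<kappa> - \<xi>) \<le> norm (\<Sum>i\<in>A. x i) \<and>
        norm (\<Sum>i\<in>A. x i) \<le> D * real (card A) powr (\<kappa> + \<xi>))" by metis
  have "0 < D / d" using D d by simp
  from params[OF this] obtain K where K: "1 \<le> K" and gap: "\<And>m. m \<in> {1..M} \<Longrightarrow> (exp \<eta> - 1) * real m powr \<kappa>
      + exp (- (\<eta> * real K)) * (2 * (D / d) * (2 * real K + 1) ^ M * real P powr (6 * real K * \<xi>) * real m powr \<kappa>) \<le> \<epsilon>1"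
    by blast
  define Q where "Q = P ^ (2 * K)"
  define L where "L = Q * fact M"
  have Q1: "1 \<le> Q" using P1 by (simp add: Q_def Suc_le_eq)
  have L0: "0 < L" using Q1 by (simp add: L_def)
  have mQL: "m * Q dvd L" if "m \<in> {1..M}" for m
    using that dvd_fact[of m M] by (simp add: L_def mult.commute mult_dvd_mono)
  from layers_pattern[OF ms(1), of K \<kappa> \<eta>, folded P_def, folded Q_def] obtain V where
    "(\<forall>i. 0 \<le> V i) \<and> (\<forall>i. V (i + Q) = V i) \<and>
    (\<forall>(y::nat \<Rightarrow> 'a) L N. 0 < L \<longrightarrow> 1 \<le> N \<longrightarrow> N * Q dvd L \<longrightarrow>
      layers \<kappa> \<eta> K ms (equidistant_sum y L) N = (\<Sum>i<N * Q. V i *\<^sub>R y (i * (L div (N * Q)))))" ..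
  then have V: "\<And>i. 0 \<le> V i" "\<And>i. V (i + Q) = V i"
    and pattern: "\<And>(y::nat \<Rightarrow> 'a) N. 1 \<le> N \<Longrightarrow> N * Q dvd L \<Longrightarrow>
      layers \<kappa> \<eta> K ms (equidistant_sum y L) N = (\<Sum>i<N * Q. V i *\<^sub>R y (i * (L div (N * Q))))"
    using L0 by simp_all
  \<comment> \<open>a bound for the norms of all \<open>v\<^sub>j\<close> from below that is known before the subfamily is chosen\<close>
  define g0 where "g0 = d * real P powr (- (real K * \<xi>))"
  have g0: "0 < g0" using d P1 by (simp add: g0_def)
  have "0 < \<epsilon>1 * g0" using \<epsilon>1 g0 by simp
  from ex_homogeneous_subfamily[where 'a = 'a, OF this, of "n * L" "map (\<lambda>m. m * Q) ms" V] obtain R where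
    hom: "\<And>x::nat \<Rightarrow> 'a. (\<forall>i. norm (x i) \<le> 1) \<Longrightarrow>
    (\<exists>h. strict_mono_on {..<n * L} h \<and> h ` {..<n * L} \<subseteq> {..<R} \<and>
      (\<forall>r\<in>set (map (\<lambda>m. m * Q) ms). \<forall>ps ps'. sorted_wrt (<) ps \<longrightarrow> sorted_wrt (<) ps' \<longrightarrow>
        set ps \<subseteq> {..<n * L} \<longrightarrow> set ps' \<subseteq> {..<n * L} \<longrightarrow> length ps = r \<longrightarrow> length ps' = r \<longrightarrow>
        \<bar>norm (pattern_sum V (\<lambda>i. x (h i)) ps) - norm (pattern_sum V (\<lambda>i. x (h i)) ps')\<bar> \<le> \<epsilon>1 * g0))"
    by (elim exE) blast
  from fam[of R] obtain x0 :: "nat \<Rightarrow> 'a" where x0: "disjoint_pos {..<R} x0" "\<And>i. i < R \<Longrightarrow> norm (x0 i) = 1"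
    and x0_sums: "\<And>A. A \<subseteq> {..<R} \<Longrightarrow> A \<noteq> {} \<Longrightarrow> d * real (card A) powr (\<kappa> - \<xi>) \<le> norm (\<Sum>i\<in>A. x0 i) \<and>
        norm (\<Sum>i\<in>A. x0 i) \<le> D * real (card A) powr (\<kappa> + \<xi>)" by metis
  define x where "x i = (if i < R then x0 i else 0)" for i
  have "\<forall>i. norm (x i) \<le> 1" using x0(2) by (simp add: x_def)
  from hom[OF this] obtain h where h: "strict_mono_on {..<n * L} h" "h ` {..<n * L} \<subseteq> {..<R}"
    and hom_h: "\<And>r ps ps'. r \<in> set (map (\<lambda>m. m * Q) ms) \<Longrightarrow> sorted_wrt (<) ps \<Longrightarrow> sorted_wrt (<) ps' \<Longrightarrow>
      set ps \<subseteq> {..<n * L} \<Longrightarrow> set ps' \<subseteq> {..<n * L} \<Longrightarrow> length ps = r \<Longrightarrow> length ps' = r \<Longrightarrow>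
      \<bar>norm (pattern_sum V (\<lambda>i. x (h i)) ps) - norm (pattern_sum V (\<lambda>i. x (h i)) ps')\<bar> \<le> \<epsilon>1 * g0"
    by (elim exE conjE) blast
  define z where "z i = (if i < n * L then x (h i) else 0)" for i
  have z_eq: "z i = x0 (h i)" if "i < n * L" for i
    using that h(2) by (auto simp: z_def x_def)
  have h_inj: "inj_on h {..<n * L}" using h(1) by (rule strict_mono_on_imp_inj_on)
  have z_disj: "disjoint_pos {..<n * L} z"
  proof -
    have "disjoint_pos {..<n * L} (\<lambda>i. x0 (h i))" by (rule disjoint_pos_compose[OF x0(1) h(2) h_inj])
    then show ?thesis by (simp add: disjoint_pos_def z_eq)
  qed
  have z_pos: "0 \<le> z i" for i
    using disjoint_posD(1)[OF z_disj, of i] by (cases "i < n * L") (simp_all add: z_def)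
  have seg: "j * L + t < n * L" if "j < n" "t < L" for j t
  proof -
    have "j * L + t < Suc j * L" using that by simp
    also have "\<dots> \<le> n * L" using that by (intro mult_right_mono) auto
    finally show ?thesis .
  qed
  define \<phi> where "\<phi> j = equidistant_sum (\<lambda>t. z (j * L + t)) L" for j
  have \<phi>_pos: "0 \<le> \<phi> j N" for j N by (simp add: \<phi>_def equidistant_sum_def sum_nonneg z_pos)
  have \<phi>_bounds: "d * real N powr (\<kappa> - \<xi>) \<le> norm (\<phi> j N) \<and> norm (\<phi> j N) \<le> D * real N powr (\<kappa> + \<xi>)"
    if jN: "j < n" "1 \<le> N" "N \<le> L" for j N
  proof -
    define f where "f i = h (j * L + i * (L div N))" for i
    have step: "0 < L div N" using jN by (simp add: div_greater_zero_iff)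
    have in_seg: "j * L + i * (L div N) < n * L" if "i < N" for i
      by (rule seg[OF jN(1) grid_index_less[OF jN(2,3) that]])
    have inj: "inj_on f {..<N}"
    proof (rule inj_onI)
      fix a b assume ab: "a \<in> {..<N}" "b \<in> {..<N}" "f a = f b"
      then have "h (j * L + a * (L div N)) = h (j * L + b * (L div N))" by (simp only: f_def)
      then have "j * L + a * (L div N) = j * L + b * (L div N)"
        by (rule inj_onD[OF h_inj]) (use ab in_seg in simp_all)
      then show "a = b" using step by simp
    qed
    have "\<phi> j N = (\<Sum>i<N. x0 (f i))"
      unfolding \<phi>_def equidistant_sum_def f_def using in_seg z_eq by (intro sum.cong) auto
    also have "\<dots> = (\<Sum>i\<in>f ` {..<N}. x0 i)" using sum.reindex[OF inj, of x0] by simp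
    finally have \<phi>_eq: "\<phi> j N = (\<Sum>i\<in>f ` {..<N}. x0 i)" .
    have "f ` {..<N} \<subseteq> {..<R}" using h(2) in_seg by (auto simp: f_def)
    moreover have "f ` {..<N} \<noteq> {}" using jN by (auto simp: lessThan_empty_iff)
    moreover have "card (f ` {..<N}) = N" using card_image[OF inj] by simp
    ultimately show ?thesis unfolding \<phi>_eq using x0_sums[of "f ` {..<N}"] by simp
  qed
  define p where "p j m = pattern_sum V z (grid L Q j m)" for j m
  have p0: "p j 0 = 0" for j by (simp add: p_def pattern_sum_grid)
  have p_layers: "p j m = layers \<kappa> \<eta> K ms (\<phi> j) m" if "m \<in> {1..M}" for j m
    unfolding p_def pattern_sum_grid \<phi>_def using pattern[of m "\<lambda>t. z (j * L + t)"] mQL[OF that] that by simp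
  have one: "1 \<in> {1..M}" using M by simp
  have eig: "norm (real m powr \<kappa> *\<^sub>R p j 1 - p j m) \<le> \<epsilon>1 * norm (p j 1)" "g0 \<le> norm (p j 1)"
    if "j < n" "m \<in> {1..M}" for j m
  proof -
    have mL: "m * prod_list ms ^ (2 * K) \<le> L"
      using mQL[OF that(2)] L0 by (simp add: Q_def P_def dvd_imp_le)
    have mm: "m \<in> set ms" using that(2) ms(3) by simp
    note e = layers_eigenvector[where \<phi> = "\<phi> j" and \<kappa> = \<kappa>, OF \<phi>_pos \<eta>\<xi> D d ms(1,2) K _ _ mm mL, folded P_def, folded p_layers[OF one] p_layers[OF that(2)]]
    have e1: "norm (real m powr \<kappa> *\<^sub>R p j 1 - p j m) \<le> ((exp \<eta> - 1) * real m powr \<kappa>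
        + exp (- (\<eta> * real K)) * (2 * (D / d) * (2 * real K + 1) ^ M * real P powr (6 * real K * \<xi>) * real m powr \<kappa>))
        * norm (p j 1)"
      using \<phi>_bounds[OF that(1)] by (intro e(1)) simp_all
    also have "\<dots> \<le> \<epsilon>1 * norm (p j 1)" using gap[OF that(2)] by (intro mult_right_mono) auto
    finally show "norm (real m powr \<kappa> *\<^sub>R p j 1 - p j m) \<le> \<epsilon>1 * norm (p j 1)" .
    show "g0 \<le> norm (p j 1)" unfolding g0_def using \<phi>_bounds[OF that(1)] by (intro e(2)) simp_all
  qed
  have pat_z: "pattern_sum V (\<lambda>i. x (h i)) ps = pattern_sum V z ps" if "set ps \<subseteq> {..<n * L}" for ps
    unfolding pattern_sum_def using that nth_mem by (intro sum.cong) (auto simp: z_def subset_iff)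
  define G where "G = norm (p 0 1)"
  have G: "g0 \<le> G" "0 < G" using eig(2)[of 0 1] n one g0 by (auto simp: G_def)
  have total: "\<bar>norm (\<Sum>j<n. p j (m j)) - norm (p 0 (\<Sum>j<n. m j))\<bar> \<le> \<epsilon>1 * G"
    if m: "1 \<le> (\<Sum>j<n. m j)" "(\<Sum>j<n. m j) \<le> M" for m
  proof -
    have mj: "m j \<le> (\<Sum>j<n. m j)" if "j < n" for j using that by (intro member_le_sum) auto
    have dv: "m j = 0 \<or> m j * Q dvd L" if "j < n" for j
      using mj[OF that] m mQL[of "m j"] by (cases "m j = 0") simp_all
    define s where "s = (\<Sum>j<n. m j)"
    have s: "s \<in> {1..M}" using m by (simp add: s_def)
    define ps where "ps = concat (map (\<lambda>j. grid L Q j (m j)) [0..<n])"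
    note c = concat_grids(1-3)[where n = n and m = m and V = V and Q = Q, OF L0 dv V(2), folded ps_def, folded s_def]
    have c4: "pattern_sum V z ps = (\<Sum>j<n. pattern_sum V z (grid L Q j (m j)))"
      unfolding ps_def by (rule concat_grids(4)) (use L0 dv V(2) in auto)
    note g = grid_sorted[OF L0 disjI2[OF mQL[OF s]], of 0]
    have g_sub: "set (grid L Q 0 s) \<subseteq> {..<n * L}"
    proof -
      have "L \<le> n * L" using n by simp
      moreover have "set (grid L Q 0 s) \<subseteq> {0..<L}" using g(2) by simp
      ultimately show ?thesis by (meson atLeastLessThan_iff lessThan_iff less_le_trans subset_iff)
    qed
    have "s * Q \<in> set (map (\<lambda>m. m * Q) ms)" using s ms(3) by auto
    from hom_h[OF this c(1) g(1) c(2) g_sub c(3) g(3)]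
    have "\<bar>norm (pattern_sum V z ps) - norm (pattern_sum V z (grid L Q 0 s))\<bar> \<le> \<epsilon>1 * g0"
      by (simp only: pat_z[OF c(2)] pat_z[OF g_sub])
    moreover have "\<epsilon>1 * g0 \<le> \<epsilon>1 * G" using G \<epsilon>1 by (intro mult_left_mono) auto
    ultimately have "\<bar>norm (pattern_sum V z ps) - norm (p 0 s)\<bar> \<le> \<epsilon>1 * G" unfolding p_def by linarith
    moreover have "pattern_sum V z ps = (\<Sum>j<n. p j (m j))" unfolding p_def by (rule c4)
    ultimately show ?thesis by (simp only: s_def)
  qed
  have p1_le: "norm (p j 1) \<le> 2 * G" if j: "j < n" for j
  proof -
    define m where "m i = (if i = j then 1 else 0 :: nat)" for i
    have "(\<Sum>i<n. m i) = 1" using j by (simp add: m_def)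
    moreover have "(\<Sum>i<n. p i (m i)) = p j 1"
    proof -
      have "(\<Sum>i<n. p i (m i)) = (\<Sum>i<n. if i = j then p j 1 else 0)"
        by (intro sum.cong) (auto simp: m_def p0)
      then show ?thesis using j by simp
    qed
    ultimately have "\<bar>norm (p j 1) - G\<bar> \<le> \<epsilon>1 * G" using total[of m] M by (simp add: G_def)
    moreover have "\<epsilon>1 * G \<le> 1 * G" using \<epsilon>1 G by (intro mult_right_mono) auto
    ultimately show ?thesis by linarith
  qed
  have disj: "disjoint_pos {..<n} (\<lambda>j. p j 1)"
    unfolding disjoint_pos_def
  proof (intro conjI ballI impI)
    fix j
    show "0 \<le> p j 1" unfolding p_def pattern_sum_grid by (intro sum_nonneg scaleR_nonneg_nonneg V z_pos)
  next
    fix j j' assume j: "j \<in> {..<n}" "j' \<in> {..<n}" "j \<noteq> j'"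
    have "1 * Q dvd L" using mQL[OF one] .
    then have QL: "1 * Q \<le> L" "1 \<le> 1 * Q" using L0 Q1 by (auto intro: dvd_imp_le)
    define a where "a j i = j * L + i * (L div (1 * Q))" for j i
    have a: "a j i < n * L" "a j i div L = j" if "j < n" "i < 1 * Q" for j i
      using seg[OF that(1) grid_index_less[OF QL(2,1) that(2)]] grid_index_less[OF QL(2,1) that(2)]
      by (simp_all add: a_def)
    have vz0: "0 \<le> V i *\<^sub>R z k" for i k by (intro scaleR_nonneg_nonneg V z_pos)
    have pj: "p j 1 = (\<Sum>i<1 * Q. V i *\<^sub>R z (a j i))" for j unfolding p_def pattern_sum_grid a_def ..
    have "inf (V i *\<^sub>R z (a j i)) (V i' *\<^sub>R z (a j' i')) = 0" if "i < 1 * Q" "i' < 1 * Q" for i i'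
    proof -
      have "a j i \<noteq> a j' i'" using a(2)[of j i] a(2)[of j' i'] that j by auto
      then have "inf (z (a j i)) (z (a j' i')) = 0"
        using disjoint_posD(2)[OF z_disj, of "a j i" "a j' i'"] a(1)[of j i] a(1)[of j' i'] that j by simp
      then show ?thesis using z_pos V by (intro disjoint_scaleR) auto
    qed
    then have "inf (V i *\<^sub>R z (a j i)) (p j' 1) = 0" if "i < 1 * Q" for i
      unfolding pj using that vz0 by (intro disjoint_sum) auto
    then have "inf (p j' 1) (V i *\<^sub>R z (a j i)) = 0" if "i < 1 * Q" for i
      using that by (simp only: inf_commute)
    moreover have "0 \<le> p j' 1" unfolding pj using vz0 by (intro sum_nonneg)
    ultimately have "inf (p j' 1) (p j 1) = 0"
      unfolding pj[of j] using vz0 by (intro disjoint_sum) auto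
    then show "inf (p j 1) (p j' 1) = 0" by (simp only: inf_commute)
  qed
  have "\<bar>norm (\<Sum>j<n. (real (m j) powr \<kappa>) *\<^sub>R p j 1) - real (\<Sum>j<n. m j) powr \<kappa> * G\<bar> \<le> \<epsilon> * G"
    if m: "1 \<le> (\<Sum>j<n. m j)" "(\<Sum>j<n. m j) \<le> M" for m
  proof -
    define s where "s = (\<Sum>j<n. m j)"
    have s: "s \<in> {1..M}" using m by (simp add: s_def)
    have mj: "m j \<le> M" if "j < n" for j
      using that m(2) member_le_sum[of j "{..<n}" m] by simp
    have each: "norm ((real (m j) powr \<kappa>) *\<^sub>R p j 1 - p j (m j)) \<le> \<epsilon>1 * (2 * G)" if j: "j < n" for j
    proof (cases "m j = 0")
      case False
      then have "norm ((real (m j) powr \<kappa>) *\<^sub>R p j 1 - p j (m j)) \<le> \<epsilon>1 * norm (p j 1)"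
        using mj[OF j] by (intro eig(1) j) simp
      also have "\<dots> \<le> \<epsilon>1 * (2 * G)" using p1_le[OF j] \<epsilon>1 by (intro mult_left_mono) auto
      finally show ?thesis .
    qed (use p0 \<epsilon>1 G in simp)
    have "norm ((\<Sum>j<n. (real (m j) powr \<kappa>) *\<^sub>R p j 1) - (\<Sum>j<n. p j (m j))) \<le> (\<Sum>j<n. \<epsilon>1 * (2 * G))"
      unfolding sum_subtractf[symmetric] using each by (intro sum_norm_le) simp
    then have "\<bar>norm (\<Sum>j<n. (real (m j) powr \<kappa>) *\<^sub>R p j 1) - norm (\<Sum>j<n. p j (m j))\<bar> \<le> real n * (\<epsilon>1 * (2 * G))"
      using norm_triangle_ineq3 by (simp add: order_trans[OF norm_triangle_ineq3])
    moreover have "\<bar>norm (\<Sum>j<n. p j (m j)) - norm (p 0 s)\<bar> \<le> \<epsilon>1 * G" using total[OF m] by (simp only: s_def)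
    moreover have "\<bar>real s powr \<kappa> * G - norm (p 0 s)\<bar> \<le> \<epsilon>1 * G"
    proof -
      have "norm (real s powr \<kappa> *\<^sub>R p 0 1 - p 0 s) \<le> \<epsilon>1 * G" unfolding G_def using n by (intro eig(1) s) simp
      then have "\<bar>norm (real s powr \<kappa> *\<^sub>R p 0 1) - norm (p 0 s)\<bar> \<le> \<epsilon>1 * G" by (rule order_trans[OF norm_triangle_ineq3])
      then show ?thesis by (simp add: G_def)
    qed
    ultimately have "\<bar>norm (\<Sum>j<n. (real (m j) powr \<kappa>) *\<^sub>R p j 1) - real s powr \<kappa> * G\<bar>
        \<le> real n * (\<epsilon>1 * (2 * G)) + \<epsilon>1 * G + \<epsilon>1 * G" by linarith
    also have "\<dots> = ((2 * real n + 2) * \<epsilon>1) * G" by (simp add: algebra_simps)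
    also have "\<dots> \<le> \<epsilon> * G" using \<epsilon>1(3) G by (intro mult_right_mono) auto
    finally show ?thesis by (simp only: s_def)
  qed
  then show ?thesis using G(2) disj by (intro exI[of _ "\<lambda>j. p j 1"] exI[of _ G]) simp
qed

lemma norm_scale_lincomb:
  "norm (\<Sum>j\<in>J. (t * b j) *\<^sub>R v j) = \<bar>t\<bar> * norm (\<Sum>j\<in>J. b j *\<^sub>R (v j :: 'a::real_normed_vector))"
  by (simp add: scaleR_sum_right[symmetric] flip: scaleR_scaleR)

text \<open>The coefficients are approximated by \<open>\<kappa>\<close>-th powers of multiples of \<open>1/g\<close>. For disjointly supported \<open>b\<close>
  and \<open>b'\<close> the numerators of all coefficients add up, and by the power rule for the blocks equal norms mean
  nearly equal totals; so the total for \<open>b + b'\<close> is nearly twice as large. For \<open>\<kappa> = 0\<close> this approximation is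
  impossible, but then the sum of all blocks is not much larger than a single block.\<close>

lemma ex_power_family:
  assumes \<kappa>: "0 \<le> \<kappa>" "\<kappa> \<le> 1"
    and families: "has_power_families TYPE('a::banach_lattice) \<kappa>"
    and n: "1 \<le> n" and \<epsilon>: "0 < \<epsilon>"
  shows "\<exists>v::nat \<Rightarrow> 'a. disjoint_pos {..<n} v \<and> (\<forall>j<n. v j \<noteq> 0) \<and>
    (\<forall>b b'. (\<forall>j<n. 0 \<le> b j \<and> 0 \<le> b' j \<and> (b j = 0 \<or> b' j = 0)) \<longrightarrow>
      norm (\<Sum>j<n. b j *\<^sub>R v j) = 1 \<longrightarrow> norm (\<Sum>j<n. b' j *\<^sub>R v j) = 1 \<longrightarrow>
      \<bar>norm (\<Sum>j<n. (b j + b' j) *\<^sub>R v j) - 2 powr \<kappa>\<bar> \<le> \<epsilon>)"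
proof -
  define \<delta> where "\<delta> = min (1 / 4) (\<epsilon> / 6)"
  have \<delta>: "0 < \<delta>" "\<delta> \<le> 1 / 4" "6 * \<delta> \<le> \<epsilon>" using \<epsilon> by (auto simp: \<delta>_def)
  \<comment> \<open>mesh of the approximation of coefficients by integers\<close>
  obtain g :: nat where g: "1 \<le> g" "0 < \<kappa> \<Longrightarrow> (2 * real n + 1) * real g powr (- \<kappa>) \<le> \<delta>"
  proof (cases "0 < \<kappa>")
    case True
    obtain g :: nat where g: "((2 * real n + 1) / \<delta>) powr (1 / \<kappa>) < real g"
      using reals_Archimedean2 by blast
    have pos: "0 < (2 * real n + 1) / \<delta>" using \<delta> by simp
    then have g0: "0 < real g" using g by (smt (verit) powr_ge_zero)
    have "(((2 * real n + 1) / \<delta>) powr (1 / \<kappa>)) powr \<kappa> \<le> real g powr \<kappa>"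
      using g True by (intro powr_mono2) auto
    then have "(2 * real n + 1) / \<delta> \<le> real g powr \<kappa>" using True pos \<delta>(1) by (simp add: powr_powr)
    then have "2 * real n + 1 \<le> \<delta> * real g powr \<kappa>" using \<delta> by (simp add: pos_divide_le_eq mult.commute)
    then have "(2 * real n + 1) * real g powr (- \<kappa>) \<le> \<delta>"
      using g0 by (simp add: powr_minus_divide pos_divide_le_eq)
    moreover have "1 \<le> g" using g0 by simp
    ultimately show ?thesis by (intro that)
  qed (use that[of 1] in simp)
  have ng: "1 \<le> n * g" using n g by (simp add: Suc_le_eq)
  have "\<exists>(v::nat \<Rightarrow> 'a) G. 0 < G \<and> disjoint_pos {..<n} v \<and>
    (\<forall>m. 1 \<le> (\<Sum>j<n. m j) \<longrightarrow> (\<Sum>j<n. m j) \<le> n * g \<longrightarrow>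
      \<bar>norm (\<Sum>j<n. (real (m j) powr \<kappa>) *\<^sub>R v j) - real (\<Sum>j<n. m j) powr \<kappa> * G\<bar> \<le> \<delta> * G)"
    by (rule ex_power_blocks[OF \<kappa> families n ng \<delta>(1)])
  then obtain v :: "nat \<Rightarrow> 'a" and G where
    G: "0 < G" and v: "disjoint_pos {..<n} v" and blocks:
    "\<And>m. 1 \<le> (\<Sum>j<n. m j) \<Longrightarrow> (\<Sum>j<n. m j) \<le> n * g \<Longrightarrow>
      \<bar>norm (\<Sum>j<n. (real (m j) powr \<kappa>) *\<^sub>R v j) - real (\<Sum>j<n. m j) powr \<kappa> * G\<bar> \<le> \<delta> * G"
    by (elim exE conjE) blast
  define N where "N b = norm (\<Sum>j<n. b j *\<^sub>R v j)" for b
  have single: "\<bar>norm (v j) - G\<bar> \<le> \<delta> * G" if j: "j < n" for j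
  proof -
    define m where "m i = (if i = j then 1 else 0 :: nat)" for i
    have s: "(\<Sum>i<n. m i) = 1" using j by (simp add: m_def)
    have "(\<Sum>i<n. (real (m i) powr \<kappa>) *\<^sub>R v i) = (\<Sum>i<n. if i = j then v j else 0)"
      by (intro sum.cong) (auto simp: m_def)
    also have "\<dots> = v j" using j by simp
    finally show ?thesis using blocks[of m] s ng by simp
  qed
  have \<delta>G: "\<delta> * G \<le> G / 4" using mult_right_mono[OF \<delta>(2), of G] G by simp
  have v_bounds: "G / 2 \<le> norm (v j)" "norm (v j) \<le> 2 * G" if "j < n" for j
    using single[OF that] \<delta>G G by linarith+
  have nz: "v j \<noteq> 0" if "j < n" for j using v_bounds(1)[OF that] G by auto
  have mono: "N b \<le> N c" if "\<And>j. j < n \<Longrightarrow> 0 \<le> b j" "\<And>j. j < n \<Longrightarrow> b j \<le> c j" for b c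
    unfolding N_def using that by (intro norm_lincomb_mono[OF v]) auto
  have scale: "N (\<lambda>j. t * b j) = t * N b" if "0 \<le> t" for t b
    using that by (simp add: N_def norm_scale_lincomb)
  have main: "\<bar>N (\<lambda>j. b j + b' j) - 2 powr \<kappa>\<bar> \<le> \<epsilon>"
    if b: "\<And>j. j < n \<Longrightarrow> 0 \<le> b j" and b': "\<And>j. j < n \<Longrightarrow> 0 \<le> b' j"
      and bb': "\<And>j. j < n \<Longrightarrow> b j = 0 \<or> b' j = 0" and N1: "N b = 1" "N b' = 1" for b b'
  proof -
    define S where "S = (\<lambda>j. b j + b' j) ` {..<n}"
    define t where "t = Max S"
    have S: "finite S" "S \<noteq> {}" using n by (auto simp: S_def lessThan_empty_iff)
    have "t \<in> S" unfolding t_def using S by (rule Max_in)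
    then obtain j0 where j0: "j0 < n" "b j0 + b' j0 = t" by (auto simp: S_def)
    have le_t: "b j + b' j \<le> t" if "j < n" for j
      unfolding t_def using S(1) that by (intro Max_ge) (auto simp: S_def)
    have le_t1: "b j \<le> t" "b' j \<le> t" if "j < n" for j using le_t[OF that] b[OF that] b'[OF that] by linarith+
    have t: "0 < t"
    proof (rule ccontr)
      assume "\<not> 0 < t"
      then have "b j = 0" if "j < n" for j using le_t1(1)[OF that] b[OF that] by simp
      then show False using N1(1) by (simp add: N_def)
    qed
    have t_le: "t * norm (v j0) \<le> 1"
    proof (cases "b j0 = 0")
      case True
      then show ?thesis using norm_term_le_lincomb[OF v, of b' j0] b' j0 N1(2) by (simp add: N_def)
    next
      case False
      then have "b' j0 = 0" using bb'[OF j0(1)] by simp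
      then show ?thesis using norm_term_le_lincomb[OF v, of b j0] b j0 N1(1) by (simp add: N_def)
    qed
    show ?thesis
    proof (cases "\<kappa> = 0")
      case True
      have "1 \<le> N (\<lambda>j. b j + b' j)" using mono[of b "\<lambda>j. b j + b' j"] b b' N1(1) by simp
      moreover have "N (\<lambda>j. b j + b' j) \<le> 1 + \<epsilon>"
      proof -
        have "N (\<lambda>j. b j + b' j) \<le> N (\<lambda>j. t * 1)" using le_t b b' by (intro mono) auto
        also have "\<dots> = t * N (\<lambda>_. 1)" using t by (intro scale) auto
        also have "N (\<lambda>_. 1) \<le> G + \<delta> * G"
        proof -
          have "n \<le> n * g" using g by simp
          then show ?thesis using blocks[of "\<lambda>_. 1"] n True by (simp add: N_def)
        qed
        finally have "N (\<lambda>j. b j + b' j) \<le> t * (G + \<delta> * G)" using t by (simp add: mult_left_mono)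
        moreover have "t * (G - \<delta> * G) \<le> 1"
        proof -
          have "t * (G - \<delta> * G) \<le> t * norm (v j0)" using single[OF j0(1)] t by (intro mult_left_mono) auto
          then show ?thesis using t_le by simp
        qed
        moreover have "t * (\<delta> * G) \<le> 2 * \<delta>"
        proof -
          have "t * (G / 2) \<le> t * norm (v j0)" using v_bounds(1)[OF j0(1)] t by (intro mult_left_mono) auto
          then have "t * G \<le> 2" using t_le by simp
          then show ?thesis using mult_left_mono[of "t * G" 2 \<delta>] \<delta> by (simp add: mult_ac)
        qed
        moreover have "t * (G + \<delta> * G) = t * (G - \<delta> * G) + 2 * (t * (\<delta> * G))" by (simp add: algebra_simps)
        ultimately show ?thesis using \<delta> by linarith
      qed
      ultimately show ?thesis using True \<epsilon> by simp
    next
      case False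
      then have \<kappa>0: "0 < \<kappa>" using \<kappa> by simp
      have g0: "0 < real g" using g(1) by simp
      define r where "r = real g powr (- \<kappa>)"
      have r: "0 < r" "(2 * real n + 1) * r \<le> \<delta>" using g(2)[OF \<kappa>0] g0 by (simp_all add: r_def)
      define m where "m c j = nat \<lfloor>real g * (c j) powr (1 / \<kappa>)\<rfloor>" for c :: "nat \<Rightarrow> real" and j
      define X where "X c = (\<Sum>j<n. m c j)" for c
      have m_bounds: "r * real (m c j) powr \<kappa> \<le> c j \<and> c j \<le> r * real (m c j) powr \<kappa> + r \<and> m c j \<le> g"
        if c: "0 \<le> c j" "c j \<le> 1" for c j
      proof -
        let ?y = "real g * (c j) powr (1 / \<kappa>)"
        have y: "0 \<le> ?y" using g0 by simp
        have m1: "real (m c j) \<le> ?y" "?y \<le> real (m c j) + 1" using y unfolding m_def by linarith+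
        have ry: "r * ?y powr \<kappa> = c j"
        proof -
          have "?y powr \<kappa> = real g powr \<kappa> * c j" using \<kappa>0 c by (simp add: powr_mult powr_powr)
          moreover have "r * real g powr \<kappa> = 1" using g0 by (simp add: r_def powr_minus_divide)
          ultimately show ?thesis by (simp add: mult.assoc[symmetric])
        qed
        have "real (m c j) powr \<kappa> \<le> ?y powr \<kappa>" using m1(1) \<kappa>0 by (intro powr_mono2) auto
        then have "r * real (m c j) powr \<kappa> \<le> r * ?y powr \<kappa>" using r(1) by (intro mult_left_mono) auto
        then have 1: "r * real (m c j) powr \<kappa> \<le> c j" by (simp only: ry)
        have "?y powr \<kappa> \<le> (real (m c j) + 1) powr \<kappa>" using m1(2) y \<kappa>0 by (intro powr_mono2) auto
        also have "\<dots> \<le> real (m c j) powr \<kappa> + 1"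
        proof (cases "m c j = 0")
          case False
          define a where "a = real (m c j)"
          have a: "0 < a" using False by (simp add: a_def)
          \<comment> \<open>subadditivity of \<open>t powr \<kappa>\<close>, from \<open>s \<le> s powr \<kappa>\<close> on the unit interval\<close>
          have "s \<le> s powr \<kappa>" if "0 \<le> s" "s \<le> 1" for s :: real
            using powr_mono'[of \<kappa> 1 s] that \<kappa> by simp
          from this[of "a / (a + 1)"] this[of "1 / (a + 1)"]
          have "a / (a + 1) + 1 / (a + 1) \<le> (a / (a + 1)) powr \<kappa> + (1 / (a + 1)) powr \<kappa>"
            using a by (simp add: add_mono)
          also have "\<dots> = (a powr \<kappa> + 1) / (a + 1) powr \<kappa>" using a by (simp add: powr_divide add_divide_distrib)
          finally have "1 \<le> (a powr \<kappa> + 1) / (a + 1) powr \<kappa>" using a by (simp add: add_divide_distrib[symmetric])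
          then show ?thesis using a by (simp add: pos_le_divide_eq a_def)
        qed simp
        finally have "r * ?y powr \<kappa> \<le> r * (real (m c j) powr \<kappa> + 1)" using r(1) by (intro mult_left_mono) auto
        then have 2: "c j \<le> r * real (m c j) powr \<kappa> + r" by (simp add: ry distrib_left)
        have "(c j) powr (1 / \<kappa>) \<le> 1 powr (1 / \<kappa>)" using c \<kappa>0 by (intro powr_mono2) auto
        then have "?y \<le> real g" using g0 by simp
        then have "m c j \<le> g" using m1(1) by simp
        with 1 2 show ?thesis by simp
      qed
      have approx: "\<bar>N c - r * real (X c) powr \<kappa> * G\<bar> \<le> \<delta> * G"
        if c: "\<And>j. j < n \<Longrightarrow> 0 \<le> c j" "\<And>j. j < n \<Longrightarrow> c j \<le> 1" for c
      proof -
        define a where "a j = r * real (m c j) powr \<kappa>" for j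
        have Na: "\<bar>N a - r * real (X c) powr \<kappa> * G\<bar> \<le> r * G"
        proof (cases "X c = 0")
          case True
          then have "m c j = 0" if "j < n" for j using that by (simp add: X_def)
          then have "N a = 0" by (simp add: N_def a_def)
          then show ?thesis using True r(1) G by simp
        next
          case False
          have "X c \<le> (\<Sum>j<n. g)" unfolding X_def using m_bounds c by (intro sum_mono) simp
          then have "\<bar>N (\<lambda>j. real (m c j) powr \<kappa>) - real (X c) powr \<kappa> * G\<bar> \<le> \<delta> * G"
            using blocks[of "m c"] False unfolding N_def X_def[symmetric] by (simp add: Suc_le_eq)
          also have "\<dots> \<le> 1 * G" using \<delta> G by (intro mult_right_mono) auto
          finally have "r * \<bar>N (\<lambda>j. real (m c j) powr \<kappa>) - real (X c) powr \<kappa> * G\<bar> \<le> r * G"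
            using r(1) by simp
          moreover have "N a = r * N (\<lambda>j. real (m c j) powr \<kappa>)" unfolding a_def using r(1) by (intro scale) simp
          then have "N a - r * real (X c) powr \<kappa> * G = r * (N (\<lambda>j. real (m c j) powr \<kappa>) - real (X c) powr \<kappa> * G)"
            by (simp add: right_diff_distrib)
          ultimately show ?thesis using r(1) by (simp add: abs_mult)
        qed
        have "\<bar>N c - N a\<bar> \<le> norm ((\<Sum>j<n. c j *\<^sub>R v j) - (\<Sum>j<n. a j *\<^sub>R v j))"
          unfolding N_def by (rule norm_triangle_ineq3)
        also have "\<dots> \<le> (\<Sum>j<n. r * (2 * G))"
          unfolding sum_subtractf[symmetric] scaleR_diff_left[symmetric]
        proof (rule sum_norm_le)
          fix j assume "j \<in> {..<n}"
          then have j: "j < n" by simp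
          have "\<bar>c j - a j\<bar> \<le> r" using m_bounds[of c j, OF c(1)[OF j] c(2)[OF j]] by (simp add: a_def abs_le_iff)
          then show "norm ((c j - a j) *\<^sub>R v j) \<le> r * (2 * G)"
            using v_bounds(2)[OF j] r(1) by (simp add: mult_mono)
        qed
        finally have "\<bar>N c - N a\<bar> \<le> real n * (r * (2 * G))" by simp
        then have "\<bar>N c - r * real (X c) powr \<kappa> * G\<bar> \<le> ((2 * real n + 1) * r) * G"
          using Na by (simp add: algebra_simps abs_le_iff)
        also have "\<dots> \<le> \<delta> * G" using r(2) G by (intro mult_right_mono) auto
        finally show ?thesis .
      qed
      define c c' where "c j = 1 / t * b j" and "c' j = 1 / t * b' j" for j
      define \<nu> where "\<nu> = 1 / t"
      have c0: "0 \<le> c j" "0 \<le> c' j" "c j \<le> 1" "c' j \<le> 1" "c j + c' j \<le> 1" if "j < n" for j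
        using b[OF that] b'[OF that] le_t[OF that] le_t1[OF that] t
        by (simp_all add: c_def c'_def add_divide_distrib[symmetric])
      have Nc: "N c = \<nu>" "N c' = \<nu>" "N (\<lambda>j. c j + c' j) = \<nu> * N (\<lambda>j. b j + b' j)"
      proof -
        show "N c = \<nu>" "N c' = \<nu>" unfolding c_def c'_def using scale[of "1 / t"] t N1 by (simp_all add: \<nu>_def)
        have "(\<lambda>j. c j + c' j) = (\<lambda>j. 1 / t * (b j + b' j))" by (simp add: c_def c'_def distrib_left add_divide_distrib)
        then show "N (\<lambda>j. c j + c' j) = \<nu> * N (\<lambda>j. b j + b' j)" using scale[of "1 / t" "\<lambda>j. b j + b' j"] t by (simp add: \<nu>_def)
      qed
      have \<nu>: "G / 2 \<le> \<nu>"
      proof -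
        have "t * (G / 2) \<le> t * norm (v j0)" using v_bounds(1)[OF j0(1)] t by (intro mult_left_mono) auto
        then have "t * (G / 2) \<le> 1" using t_le by simp
        then show ?thesis using t by (simp add: \<nu>_def pos_le_divide_eq mult.commute)
      qed
      have X_add: "X (\<lambda>j. c j + c' j) = X c + X c'"
        unfolding X_def sum.distrib[symmetric]
      proof (rule sum.cong[OF refl])
        fix j assume "j \<in> {..<n}"
        then have "c j = 0 \<or> c' j = 0" using bb' by (auto simp: c_def c'_def)
        then show "m (\<lambda>j. c j + c' j) j = m c j + m c' j" by (auto simp: m_def)
      qed
      define F where "F k = r * real k powr \<kappa> * G" for k
      define k l where "k = min (X c) (X c')" and "l = max (X c) (X c')"
      define B where "B = F (X c + X c')"
      have est: "\<bar>\<nu> - F k\<bar> \<le> \<delta> * G" "\<bar>\<nu> - F l\<bar> \<le> \<delta> * G" "\<bar>\<nu> * N (\<lambda>j. b j + b' j) - B\<bar> \<le> \<delta> * G"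
        using approx[of c] approx[of c'] approx[of "\<lambda>j. c j + c' j"] c0 Nc X_add
        by (simp_all add: F_def B_def k_def l_def min_def max_def)
      have AB: "2 powr \<kappa> * F k \<le> B" "B \<le> 2 powr \<kappa> * F l"
      proof -
        have two: "2 powr \<kappa> * F i = F (2 * i)" for i by (simp add: F_def powr_mult)
        have F_mono: "F i \<le> F i'" if "i \<le> i'" for i i'
          unfolding F_def using that r(1) G \<kappa>0 by (intro mult_right_mono mult_left_mono powr_mono2) auto
        show "2 powr \<kappa> * F k \<le> B" "B \<le> 2 powr \<kappa> * F l"
          unfolding two B_def k_def l_def by (intro F_mono; simp)+
      qed
      have two_le: "2 powr \<kappa> \<le> 2" using powr_mono[of \<kappa> 1 2] \<kappa> by simp
      have "2 powr \<kappa> * (\<nu> - \<delta> * G) \<le> 2 powr \<kappa> * F k" "2 powr \<kappa> * F l \<le> 2 powr \<kappa> * (\<nu> + \<delta> * G)"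
      proof -
        have "\<nu> - \<delta> * G \<le> F k" "F l \<le> \<nu> + \<delta> * G" using est(1,2) by linarith+
        then show "2 powr \<kappa> * (\<nu> - \<delta> * G) \<le> 2 powr \<kappa> * F k"
          "2 powr \<kappa> * F l \<le> 2 powr \<kappa> * (\<nu> + \<delta> * G)" by (simp_all only: mult_left_mono powr_ge_zero)
      qed
      moreover have "2 powr \<kappa> * (\<delta> * G) \<le> 2 * (\<delta> * G)" using two_le \<delta> G by (intro mult_right_mono) auto
      ultimately have "\<bar>B - 2 powr \<kappa> * \<nu>\<bar> \<le> 2 * (\<delta> * G)" using AB unfolding right_diff_distrib distrib_left mult.commute[of _ \<nu>] by linarith
      then have "\<bar>\<nu> * N (\<lambda>j. b j + b' j) - 2 powr \<kappa> * \<nu>\<bar> \<le> 3 * (\<delta> * G)" using est(3) by linarith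
      also have "3 * (\<delta> * G) \<le> 3 * (\<delta> * (2 * \<nu>))" using \<nu> \<delta> by (intro mult_left_mono) auto
      finally have le: "\<bar>\<nu> * N (\<lambda>j. b j + b' j) - 2 powr \<kappa> * \<nu>\<bar> \<le> \<nu> * (6 * \<delta>)" by (simp add: mult_ac)
      have \<nu>0: "0 < \<nu>" using t by (simp add: \<nu>_def)
      have "\<nu> * N (\<lambda>j. b j + b' j) - 2 powr \<kappa> * \<nu> = \<nu> * (N (\<lambda>j. b j + b' j) - 2 powr \<kappa>)"
        by (simp only: right_diff_distrib mult.commute)
      then have "\<nu> * \<bar>N (\<lambda>j. b j + b' j) - 2 powr \<kappa>\<bar> \<le> \<nu> * (6 * \<delta>)"
        using le \<nu>0 by (simp only: abs_mult abs_of_pos)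
      then have "\<bar>N (\<lambda>j. b j + b' j) - 2 powr \<kappa>\<bar> \<le> 6 * \<delta>"
        using \<nu>0 by (simp only: mult_le_cancel_left_pos)
      then show ?thesis using \<delta>(3) by simp
    qed
  qed
  show ?thesis using v nz main unfolding N_def by (intro exI[of _ v]) simp
qed

section \<open>Families adapted to the indices\<close>

lemma normalized_sum_bounds:
  fixes x :: "nat \<Rightarrow> 'a::banach_lattice"
  assumes x: "disjoint_pos {..<R} x" "\<forall>i<R. norm (x i) = 1" and A: "A \<subseteq> {..<R}" "A \<noteq> {}"
  shows "1 \<le> norm (\<Sum>i\<in>A. x i)" "norm (\<Sum>i\<in>A. x i) \<le> real (card A)" "1 \<le> real (card A)"
    "(\<Sum>i\<in>A. norm (x i) powr q) = real (card A)"
proof -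
  have finA: "finite A" using A(1) finite_subset by blast
  obtain a where a: "a \<in> A" using A(2) by blast
  have n: "norm (x i) = 1" if "i \<in> A" for i using x(2) A(1) that by auto
  show "1 \<le> norm (\<Sum>i\<in>A. x i)"
    using norm_term_le_lincomb[OF disjoint_pos_subset[OF x(1) A(1)] finA, of "\<lambda>_. 1" a] a n[OF a] by simp
  have "norm (\<Sum>i\<in>A. x i) \<le> (\<Sum>i\<in>A. norm (x i))" by (rule norm_sum)
  also have "\<dots> = real (card A)" using n by simp
  finally show "norm (\<Sum>i\<in>A. x i) \<le> real (card A)" .
  show "1 \<le> real (card A)" using finA A(2) by (simp add: Suc_le_eq card_gt_0_iff)
  show "(\<Sum>i\<in>A. norm (x i) powr q) = real (card A)" using n by simp
qed

text \<open>Below the exponent a lower estimate holds for all families. Above it lower estimates fail, and the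
  extremal families for a failing estimate obey the opposite inequality.\<close>

lemma lower_exponent_families:
  assumes inf: "\<not> (\<exists>B::'a::banach_lattice set. finite B \<and> span B = UNIV)"
  shows "has_power_families TYPE('a) (lower_exponent TYPE('a))"
  unfolding has_power_families_def
proof (intro allI impI)
  fix \<xi> :: real assume \<xi>: "0 < \<xi>"
  define \<kappa> where "\<kappa> = lower_exponent TYPE('a)"
  have low: "\<exists>d>0. \<forall>R (x::nat \<Rightarrow> 'a) A. disjoint_pos {..<R} x \<longrightarrow> (\<forall>i<R. norm (x i) = 1) \<longrightarrow> A \<subseteq> {..<R} \<longrightarrow> A \<noteq> {} \<longrightarrow>
      d * real (card A) powr (\<kappa> - \<xi>) \<le> norm (\<Sum>i\<in>A. x i)"
  proof (cases "\<kappa> - \<xi> \<le> 0")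
    case True
    have "1 * real (card A) powr (\<kappa> - \<xi>) \<le> norm (\<Sum>i\<in>A. x i)"
      if x: "disjoint_pos {..<R} x" "\<forall>i<R. norm (x i) = 1" "A \<subseteq> {..<R}" "A \<noteq> {}" for R and x :: "nat \<Rightarrow> 'a" and A
    proof -
      note b = normalized_sum_bounds[OF x]
      have "real (card A) powr (\<kappa> - \<xi>) \<le> real (card A) powr 0" using True b(3) by (intro powr_mono) auto
      then show ?thesis using b(1,3) by simp
    qed
    then show ?thesis by (intro exI[of _ 1]) simp
  next
    case False
    then obtain q C where q: "1 \<le> q" "\<kappa> - \<xi> < 1 / q" "0 < C" "lower_q TYPE('a) q C"
      using lower_q_below_exponent[where 'a='a, of "\<kappa> - \<xi>"] \<xi> unfolding \<kappa>_def by auto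
    have "(1 / C) powr (1 / q) * real (card A) powr (\<kappa> - \<xi>) \<le> norm (\<Sum>i\<in>A. x i)"
      if x: "disjoint_pos {..<R} x" "\<forall>i<R. norm (x i) = 1" "A \<subseteq> {..<R}" "A \<noteq> {}" for R and x :: "nat \<Rightarrow> 'a" and A
    proof -
      note b = normalized_sum_bounds[OF x]
      have finA: "finite A" using x(3) finite_subset by blast
      have "real (card A) \<le> C * norm (\<Sum>i\<in>A. x i) powr q"
        using q(4)[unfolded lower_q_def, rule_format, OF finA disjoint_pos_subset[OF x(1,3)]] by (simp only: b(4))
      then have "1 / C * real (card A) \<le> norm (\<Sum>i\<in>A. x i) powr q" using q(3) by (simp add: field_simps)
      then have "(1 / C * real (card A)) powr (1 / q) \<le> (norm (\<Sum>i\<in>A. x i) powr q) powr (1 / q)"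
        using q by (intro powr_mono2) auto
      also have "(norm (\<Sum>i\<in>A. x i) powr q) powr (1 / q) = norm (\<Sum>i\<in>A. x i)" using q(1) by (simp add: powr_powr)
      finally have "(1 / C) powr (1 / q) * real (card A) powr (1 / q) \<le> norm (\<Sum>i\<in>A. x i)" by (simp only: powr_mult)
      moreover have "real (card A) powr (\<kappa> - \<xi>) \<le> real (card A) powr (1 / q)"
        using b(3) q(2) by (intro powr_mono) auto
      then have "(1 / C) powr (1 / q) * real (card A) powr (\<kappa> - \<xi>) \<le> (1 / C) powr (1 / q) * real (card A) powr (1 / q)"
        by (intro mult_left_mono) auto
      ultimately show ?thesis by linarith
    qed
    moreover have "0 < (1 / C) powr (1 / q)" using q(3) by simp
    ultimately show ?thesis by (intro exI[of _ "(1 / C) powr (1 / q)"]) simp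
  qed
  then obtain d where d: "0 < d" "\<And>R (x::nat \<Rightarrow> 'a) A. disjoint_pos {..<R} x \<Longrightarrow> (\<forall>i<R. norm (x i) = 1) \<Longrightarrow>
      A \<subseteq> {..<R} \<Longrightarrow> A \<noteq> {} \<Longrightarrow> d * real (card A) powr (\<kappa> - \<xi>) \<le> norm (\<Sum>i\<in>A. x i)"
    by (elim exE conjE) simp
  have "\<exists>x::nat \<Rightarrow> 'a. disjoint_pos {..<R} x \<and> (\<forall>i<R. norm (x i) = 1) \<and>
      (\<forall>A\<subseteq>{..<R}. A \<noteq> {} \<longrightarrow> norm (\<Sum>i\<in>A. x i) \<le> 2 * real (card A) powr (\<kappa> + \<xi>))" for R
  proof (cases "1 \<le> \<kappa> + \<xi>")
    case True
    obtain x :: "nat \<Rightarrow> 'a" where x: "disjoint_pos {..<R} x" "\<forall>i<R. norm (x i) = 1"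
      using infinite_dim_disjoint[OF inf, of R] by (elim exE conjE)
    have "norm (\<Sum>i\<in>A. x i) \<le> 2 * real (card A) powr (\<kappa> + \<xi>)" if A: "A \<subseteq> {..<R}" "A \<noteq> {}" for A
    proof -
      note b = normalized_sum_bounds[OF x A]
      have "real (card A) powr 1 \<le> real (card A) powr (\<kappa> + \<xi>)" using True b(3) by (intro powr_mono) auto
      then show ?thesis using b(2,3) by simp
    qed
    then show ?thesis using x by (intro exI[of _ x]) simp
  next
    case False
    then have "\<not> lower_q TYPE('a) (1 / (\<kappa> + \<xi>)) (2 * real R)"
      using \<xi> unfolding \<kappa>_def by (intro lower_q_fails_above_exponent) auto
    moreover have "0 < \<kappa> + \<xi>" using \<xi> lower_exponent_bounds(1)[where 'a='a] by (simp add: \<kappa>_def)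
    then have "1 \<le> 1 / (\<kappa> + \<xi>)" using False by (simp add: field_simps)
    ultimately have "\<exists>y::nat \<Rightarrow> 'a. disjoint_pos {..<R} y \<and> (\<forall>i<R. norm (y i) = 1) \<and>
        (\<forall>A\<subseteq>{..<R}. A \<noteq> {} \<longrightarrow> norm (\<Sum>i\<in>A. y i) \<le> 2 * real (card A) powr (1 / (1 / (\<kappa> + \<xi>))))"
      by (rule family_of_lower_failure)
    then show ?thesis by simp
  qed
  then show "\<exists>D>0. \<exists>d>0. \<forall>R. \<exists>x::nat \<Rightarrow> 'a. disjoint_pos {..<R} x \<and> (\<forall>i<R. norm (x i) = 1) \<and>
      (\<forall>A\<subseteq>{..<R}. A \<noteq> {} \<longrightarrow> d * real (card A) powr (lower_exponent TYPE('a) - \<xi>) \<le> norm (\<Sum>i\<in>A. x i) \<and>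
        norm (\<Sum>i\<in>A. x i) \<le> D * real (card A) powr (lower_exponent TYPE('a) + \<xi>))"
    unfolding \<kappa>_def[symmetric] using d by (intro exI[of _ 2] conjI exI[of _ d]) (simp_all, meson)
qed

lemma upper_exponent_families:
  assumes inf: "\<not> (\<exists>B::'a::banach_lattice set. finite B \<and> span B = UNIV)"
  shows "has_power_families TYPE('a) (upper_exponent TYPE('a))"
  unfolding has_power_families_def
proof (intro allI impI)
  fix \<xi> :: real assume \<xi>: "0 < \<xi>"
  define \<kappa> where "\<kappa> = upper_exponent TYPE('a)"
  obtain q C where q: "1 \<le> q" "1 / q < \<kappa> + \<xi>" "0 < C" "upper_q TYPE('a) q C"
    using upper_q_above_exponent[where 'a='a, of "\<kappa> + \<xi>"] \<xi> unfolding \<kappa>_def by auto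
  have upp: "norm (\<Sum>i\<in>A. x i) \<le> C powr (1 / q) * real (card A) powr (\<kappa> + \<xi>)"
    if x: "disjoint_pos {..<R} x" "\<forall>i<R. norm (x i) = 1" "A \<subseteq> {..<R}" "A \<noteq> {}" for R and x :: "nat \<Rightarrow> 'a" and A
  proof -
    note b = normalized_sum_bounds[OF x]
    have finA: "finite A" using x(3) finite_subset by blast
    have "norm (\<Sum>i\<in>A. x i) powr q \<le> C * real (card A)"
      using q(4)[unfolded upper_q_def, rule_format, OF finA disjoint_pos_subset[OF x(1,3)]] by (simp only: b(4))
    then have "(norm (\<Sum>i\<in>A. x i) powr q) powr (1 / q) \<le> (C * real (card A)) powr (1 / q)"
      using q by (intro powr_mono2) auto
    moreover have "(norm (\<Sum>i\<in>A. x i) powr q) powr (1 / q) = norm (\<Sum>i\<in>A. x i)" using q(1) by (simp add: powr_powr)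
    ultimately have "norm (\<Sum>i\<in>A. x i) \<le> C powr (1 / q) * real (card A) powr (1 / q)" by (simp only: powr_mult)
    moreover have "real (card A) powr (1 / q) \<le> real (card A) powr (\<kappa> + \<xi>)"
      using b(3) q(2) by (intro powr_mono) auto
    then have "C powr (1 / q) * real (card A) powr (1 / q) \<le> C powr (1 / q) * real (card A) powr (\<kappa> + \<xi>)"
      by (intro mult_left_mono) auto
    ultimately show ?thesis by linarith
  qed
  have "\<exists>x::nat \<Rightarrow> 'a. disjoint_pos {..<R} x \<and> (\<forall>i<R. norm (x i) = 1) \<and>
      (\<forall>A\<subseteq>{..<R}. A \<noteq> {} \<longrightarrow> 1 / 2 * real (card A) powr (\<kappa> - \<xi>) \<le> norm (\<Sum>i\<in>A. x i))" for R
  proof (cases "\<kappa> - \<xi> \<le> 0")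
    case True
    obtain x :: "nat \<Rightarrow> 'a" where x: "disjoint_pos {..<R} x" "\<forall>i<R. norm (x i) = 1"
      using infinite_dim_disjoint[OF inf, of R] by (elim exE conjE)
    have "1 / 2 * real (card A) powr (\<kappa> - \<xi>) \<le> norm (\<Sum>i\<in>A. x i)" if A: "A \<subseteq> {..<R}" "A \<noteq> {}" for A
    proof -
      note b = normalized_sum_bounds[OF x A]
      have "real (card A) powr (\<kappa> - \<xi>) \<le> real (card A) powr 0" using True b(3) by (intro powr_mono) auto
      then show ?thesis using b(1,3) by simp
    qed
    then show ?thesis using x by (intro exI[of _ x]) simp
  next
    case False
    then have "\<not> upper_q TYPE('a) (1 / (\<kappa> - \<xi>)) ((1 + 2 * real R) powr (1 / (\<kappa> - \<xi>)))"
      using \<xi> unfolding \<kappa>_def by (intro upper_q_fails_below_exponent) auto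
    moreover have "\<kappa> - \<xi> \<le> 1" using \<xi> upper_exponent_bounds(2)[where 'a='a] by (simp add: \<kappa>_def)
    then have "1 \<le> 1 / (\<kappa> - \<xi>)" using False by (simp add: field_simps)
    ultimately have "\<exists>y::nat \<Rightarrow> 'a. disjoint_pos {..<R} y \<and> (\<forall>i<R. norm (y i) = 1) \<and>
        (\<forall>A\<subseteq>{..<R}. A \<noteq> {} \<longrightarrow> real (card A) powr (1 / (1 / (\<kappa> - \<xi>))) \<le> 2 * norm (\<Sum>i\<in>A. y i))"
      by (rule family_of_upper_failure)
    then show ?thesis by (simp add: field_simps)
  qed
  moreover have "0 < C powr (1 / q)" using q(3) by simp
  ultimately show "\<exists>D>0. \<exists>d>0. \<forall>R. \<exists>x::nat \<Rightarrow> 'a. disjoint_pos {..<R} x \<and> (\<forall>i<R. norm (x i) = 1) \<and>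
      (\<forall>A\<subseteq>{..<R}. A \<noteq> {} \<longrightarrow> d * real (card A) powr (upper_exponent TYPE('a) - \<xi>) \<le> norm (\<Sum>i\<in>A. x i) \<and>
        norm (\<Sum>i\<in>A. x i) \<le> D * real (card A) powr (upper_exponent TYPE('a) + \<xi>))"
    unfolding \<kappa>_def[symmetric] using upp
    by (intro exI[of _ "C powr (1 / q)"] conjI exI[of _ "1 / 2"]) (simp_all, meson)
qed

section \<open>Limits over sublattices of growing dimension\<close>

text \<open>Two disjoint vectors of the span have disjointly supported coordinates.\<close>

lemma power_family_sublattice:
  fixes v :: "nat \<Rightarrow> 'a::banach_lattice"
  assumes v: "disjoint_pos {..<n} v" "\<forall>j<n. v j \<noteq> 0"
    and power: "\<And>b b'. (\<forall>j<n. 0 \<le> b j \<and> 0 \<le> b' j \<and> (b j = 0 \<or> b' j = 0)) \<Longrightarrow>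
      norm (\<Sum>j<n. b j *\<^sub>R v j) = 1 \<Longrightarrow> norm (\<Sum>j<n. b' j *\<^sub>R v j) = 1 \<Longrightarrow>
      \<bar>norm (\<Sum>j<n. (b j + b' j) *\<^sub>R v j) - r\<bar> \<le> \<epsilon>"
  shows "sublattice (span (v ` {..<n}))" "dim (span (v ` {..<n})) = n"
    "\<And>Z. sublattice Z \<Longrightarrow> Z \<subseteq> span (v ` {..<n}) \<Longrightarrow> 2 \<le> dim Z \<Longrightarrow> beta Z \<le> r + \<epsilon> \<and> r - \<epsilon> \<le> alpha Z"
proof -
  show "sublattice (span (v ` {..<n}))" using v(1) by (rule sublattice_span) simp
  show "dim (span (v ` {..<n})) = n" using dim_span_disjoint_pos[OF v(1)] v(2) by simp
  fix Z assume Z: "sublattice Z" "Z \<subseteq> span (v ` {..<n})" "2 \<le> dim Z"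
  obtain u w where uw: "u \<in> pos_sphere Z" "w \<in> pos_sphere Z" "inf u w = 0"
    using ex_disjoint_pair[OF Z(1,3)] by (elim exE conjE)
  then have in_span: "u \<in> span (v ` {..<n})" "w \<in> span (v ` {..<n})" and pos: "0 \<le> u" "0 \<le> w" and norm1: "norm u = 1" "norm w = 1"
    using Z(2) by (auto simp: pos_sphere_def)
  obtain b where b: "u = (\<Sum>j<n. b j *\<^sub>R v j)"
    using in_span(1) unfolding span_disjoint_pos[OF v(1) finite_lessThan] by (elim imageE)
  obtain c where c: "w = (\<Sum>j<n. c j *\<^sub>R v j)"
    using in_span(2) unfolding span_disjoint_pos[OF v(1) finite_lessThan] by (elim imageE)
  have "0 \<le> b j" "0 \<le> c j" if "j < n" for j
    using lincomb_nonnegD[OF v(1) finite_lessThan pos(1)[unfolded b], of j]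
      lincomb_nonnegD[OF v(1) finite_lessThan pos(2)[unfolded c], of j] that v(2) by simp_all
  moreover have "min (b j) (c j) = 0" if "j < n" for j
  proof (rule lincomb_eq_0D[OF v(1) finite_lessThan])
    show "(\<Sum>j<n. min (b j) (c j) *\<^sub>R v j) = 0"
      using uw(3) unfolding b c inf_lincomb[OF v(1) finite_lessThan] .
  qed (use that v(2) in simp_all)
  ultimately have "\<forall>j<n. 0 \<le> b j \<and> 0 \<le> c j \<and> (b j = 0 \<or> c j = 0)"
    by (simp add: min_def split: if_splits) metis
  from power[OF this norm1[unfolded b c]]
  have "\<bar>norm (u + w) - r\<bar> \<le> \<epsilon>" by (simp add: b c scaleR_add_left sum.distrib)
  then show "beta Z \<le> r + \<epsilon> \<and> r - \<epsilon> \<le> alpha Z"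
    using beta_le[OF uw] alpha_ge_add[OF uw] by linarith
qed

definition sublattices_of_dim :: "nat \<Rightarrow> 'a::banach_lattice set set" where
  "sublattices_of_dim n = {Y. sublattice Y \<and> dim Y = n}"

definition large_sublattices :: "'a::banach_lattice set \<Rightarrow> 'a set set" where
  "large_sublattices Y = {Z. sublattice Z \<and> Z \<subseteq> Y \<and> dim Z \<ge> 2}"

lemma sublattices_of_dim_nonempty:
  assumes inf: "\<not> (\<exists>B::'a::banach_lattice set. finite B \<and> span B = UNIV)"
  shows "(sublattices_of_dim n :: 'a set set) \<noteq> {}"
proof -
  obtain x :: "nat \<Rightarrow> 'a" where x: "disjoint_pos {..<n} x" "\<forall>i<n. norm (x i) = 1"
    using infinite_dim_disjoint[OF inf, of n] by (elim exE conjE)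
  have "x i \<noteq> 0" if "i \<in> {..<n}" for i using x(2) that by force
  then have "span (x ` {..<n}) \<in> sublattices_of_dim n"
    using sublattice_span[OF x(1)] dim_span_disjoint_pos[OF x(1)] by (simp add: sublattices_of_dim_def)
  then show ?thesis by blast
qed

lemma self_large: "Y \<in> sublattices_of_dim n \<Longrightarrow> 2 \<le> n \<Longrightarrow> Y \<in> large_sublattices Y"
  by (simp add: sublattices_of_dim_def large_sublattices_def)

lemma inf_sup_limit:
  fixes f :: "'a::banach_lattice set \<Rightarrow> real"
  assumes inf: "\<not> (\<exists>B::'a set. finite B \<and> span B = UNIV)"
    and f: "\<And>Z. sublattice Z \<Longrightarrow> 2 \<le> dim Z \<Longrightarrow> f Z \<in> {1..2}"
    and low: "\<And>e. 0 < e \<Longrightarrow> \<exists>N. \<forall>Y. sublattice Y \<longrightarrow> N \<le> dim Y \<longrightarrow> (\<exists>Z\<in>large_sublattices Y. l - e \<le> f Z)"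
    and upp: "\<And>e n. 0 < e \<Longrightarrow> 2 \<le> n \<Longrightarrow> \<exists>Y\<in>sublattices_of_dim n. \<forall>Z\<in>large_sublattices Y. f Z \<le> l + e"
  shows "(\<lambda>n. INF Y\<in>sublattices_of_dim n. SUP Z\<in>large_sublattices Y. f Z) \<longlonglongrightarrow> l"
proof (rule LIMSEQ_I)
  fix e :: real assume "0 < e"
  then have e: "0 < e / 2" by simp
  obtain N where N: "\<And>Y. sublattice Y \<Longrightarrow> N \<le> dim Y \<Longrightarrow> \<exists>Z\<in>large_sublattices Y. l - e / 2 \<le> f Z"
    using low[OF e] by blast
  have bdd: "bdd_above (f ` large_sublattices Y)" for Y
    using f by (intro bdd_aboveI[of _ 2]) (auto simp: large_sublattices_def)
  show "\<exists>no. \<forall>n\<ge>no. norm ((INF Y\<in>sublattices_of_dim n. SUP Z\<in>large_sublattices Y. f Z) - l) < e"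
  proof (intro exI[of _ "max N 2"] allI impI)
    fix n assume n: "max N 2 \<le> n"
    define F where "F Y = (SUP Z\<in>large_sublattices Y. f Z)" for Y
    have F1: "1 \<le> F Y" if "Y \<in> sublattices_of_dim n" for Y
      using cSUP_upper[OF self_large[OF that] bdd] f[of Y] that n by (simp add: F_def sublattices_of_dim_def)
    have "l - e / 2 \<le> (INF Y\<in>sublattices_of_dim n. F Y)"
    proof (rule cINF_greatest)
      show "(sublattices_of_dim n :: 'a set set) \<noteq> {}" by (rule sublattices_of_dim_nonempty[OF inf])
      fix Y :: "'a set" assume Y: "Y \<in> sublattices_of_dim n"
      then obtain Z where Z: "Z \<in> large_sublattices Y" "l - e / 2 \<le> f Z"
        using N[of Y] n by (auto simp: sublattices_of_dim_def)
      then show "l - e / 2 \<le> F Y" using cSUP_upper[OF Z(1) bdd] by (simp add: F_def)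
    qed
    moreover have "(INF Y\<in>sublattices_of_dim n. F Y) \<le> l + e / 2"
    proof -
      obtain Y where Y: "Y \<in> sublattices_of_dim n" "\<forall>Z\<in>large_sublattices Y. f Z \<le> l + e / 2"
        using upp[OF e, of n] n by auto
      have "(INF Y\<in>sublattices_of_dim n. F Y) \<le> F Y"
        using F1 by (intro cINF_lower[OF _ Y(1)] bdd_belowI[of _ 1]) auto
      also have "F Y \<le> l + e / 2"
        unfolding F_def using self_large[OF Y(1)] n Y(2) by (intro cSUP_least) auto
      finally show ?thesis .
    qed
    ultimately show "norm ((INF Y\<in>sublattices_of_dim n. SUP Z\<in>large_sublattices Y. f Z) - l) < e"
      using e unfolding F_def real_norm_def by linarith
  qed
qed

lemma sup_inf_limit:
  fixes f :: "'a::banach_lattice set \<Rightarrow> real"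
  assumes inf: "\<not> (\<exists>B::'a set. finite B \<and> span B = UNIV)"
    and f: "\<And>Z. sublattice Z \<Longrightarrow> 2 \<le> dim Z \<Longrightarrow> f Z \<in> {1..2}"
    and upp: "\<And>e. 0 < e \<Longrightarrow> \<exists>N. \<forall>Y. sublattice Y \<longrightarrow> N \<le> dim Y \<longrightarrow> (\<exists>Z\<in>large_sublattices Y. f Z \<le> l + e)"
    and low: "\<And>e n. 0 < e \<Longrightarrow> 2 \<le> n \<Longrightarrow> \<exists>Y\<in>sublattices_of_dim n. \<forall>Z\<in>large_sublattices Y. l - e \<le> f Z"
  shows "(\<lambda>n. SUP Y\<in>sublattices_of_dim n. INF Z\<in>large_sublattices Y. f Z) \<longlonglongrightarrow> l"
proof (rule LIMSEQ_I)
  fix e :: real assume "0 < e"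
  then have e: "0 < e / 2" by simp
  obtain N where N: "\<And>Y. sublattice Y \<Longrightarrow> N \<le> dim Y \<Longrightarrow> \<exists>Z\<in>large_sublattices Y. f Z \<le> l + e / 2"
    using upp[OF e] by blast
  have bdd: "bdd_below (f ` large_sublattices Y)" for Y
    using f by (intro bdd_belowI[of _ 1]) (auto simp: large_sublattices_def)
  show "\<exists>no. \<forall>n\<ge>no. norm ((SUP Y\<in>sublattices_of_dim n. INF Z\<in>large_sublattices Y. f Z) - l) < e"
  proof (intro exI[of _ "max N 2"] allI impI)
    fix n assume n: "max N 2 \<le> n"
    define F where "F Y = (INF Z\<in>large_sublattices Y. f Z)" for Y
    have F2: "F Y \<le> 2" if "Y \<in> sublattices_of_dim n" for Y
      using cINF_lower[OF bdd self_large[OF that]] f[of Y] that n by (simp add: F_def sublattices_of_dim_def)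
    have "(SUP Y\<in>sublattices_of_dim n. F Y) \<le> l + e / 2"
    proof (rule cSUP_least)
      show "(sublattices_of_dim n :: 'a set set) \<noteq> {}" by (rule sublattices_of_dim_nonempty[OF inf])
      fix Y :: "'a set" assume Y: "Y \<in> sublattices_of_dim n"
      then obtain Z where Z: "Z \<in> large_sublattices Y" "f Z \<le> l + e / 2"
        using N[of Y] n by (auto simp: sublattices_of_dim_def)
      then show "F Y \<le> l + e / 2" using cINF_lower[OF bdd Z(1)] by (simp add: F_def)
    qed
    moreover have "l - e / 2 \<le> (SUP Y\<in>sublattices_of_dim n. F Y)"
    proof -
      obtain Y where Y: "Y \<in> sublattices_of_dim n" "\<forall>Z\<in>large_sublattices Y. l - e / 2 \<le> f Z"
        using low[OF e, of n] n by auto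
      have "l - e / 2 \<le> F Y"
        unfolding F_def using self_large[OF Y(1)] n Y(2) by (intro cINF_greatest) auto
      also have "F Y \<le> (SUP Y\<in>sublattices_of_dim n. F Y)"
        using F2 by (intro cSUP_upper[OF Y(1)] bdd_aboveI[of _ 2]) auto
      finally show ?thesis .
    qed
    ultimately show "norm ((SUP Y\<in>sublattices_of_dim n. INF Z\<in>large_sublattices Y. f Z) - l) < e"
      using e unfolding F_def real_norm_def by linarith
  qed
qed

text \<open>Continuity of the exponential at the exponent \<open>\<kappa>\<close>, in the form in which it absorbs the change of \<open>\<kappa>\<close>
  by \<open>\<xi>\<close> together with a factor \<open>2 powr \<xi>\<close> next to \<open>2\<close>.\<close>

lemma ex_exponent_slack:
  fixes \<kappa> e c :: real
  assumes e: "0 < e" and c: "0 < c"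
  shows "\<exists>\<xi>>0. \<xi> < c \<and> 2 powr \<kappa> - e \<le> 2 powr ((1 - \<xi>) * (\<kappa> - \<xi>)) \<and> 2 powr ((1 + \<xi>) * (\<kappa> + \<xi>)) \<le> 2 powr \<kappa> + e"
proof -
  have "((\<lambda>\<xi>::real. 2 powr ((1 + \<xi>) * (\<kappa> + \<xi>))) \<longlongrightarrow> 2 powr ((1 + 0) * (\<kappa> + 0))) (at 0)"
    by (intro tendsto_intros) auto
  then have "(\<lambda>\<xi>::real. 2 powr ((1 + \<xi>) * (\<kappa> + \<xi>))) \<midarrow>0\<rightarrow> 2 powr \<kappa>" by simp
  from LIM_D[OF this e] obtain s where s: "0 < s"
    "\<And>\<xi>. \<xi> \<noteq> 0 \<Longrightarrow> \<bar>\<xi>\<bar> < s \<Longrightarrow> \<bar>2 powr ((1 + \<xi>) * (\<kappa> + \<xi>)) - 2 powr \<kappa>\<bar> < e"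
    by auto
  define \<xi> where "\<xi> = min s c / 2"
  have \<xi>: "0 < \<xi>" "\<xi> < s" "\<xi> < c" using s(1) c by (auto simp: \<xi>_def min_def)
  have "\<bar>2 powr ((1 + \<xi>) * (\<kappa> + \<xi>)) - 2 powr \<kappa>\<bar> < e" "\<bar>2 powr ((1 + - \<xi>) * (\<kappa> + - \<xi>)) - 2 powr \<kappa>\<bar> < e"
    using s(2)[of \<xi>] s(2)[of "- \<xi>"] \<xi> by simp_all
  then show ?thesis using \<xi> by (intro exI[of _ \<xi>]) (auto simp: abs_less_iff)
qed

lemma lambda_plus_lower_bound:
  assumes e: "0 < (e::real)"
  shows "\<exists>N. \<forall>Y::'a::banach_lattice set. sublattice Y \<longrightarrow> N \<le> dim Y \<longrightarrow>
    (\<exists>Z\<in>large_sublattices Y. 2 powr lower_exponent TYPE('a) - e \<le> lambda_plus Z)"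
proof (cases "lower_exponent TYPE('a) = 0")
  case True
  show ?thesis
  proof (intro exI[of _ 2] allI impI bexI)
    fix Y :: "'a set" assume Y: "sublattice Y" "2 \<le> dim Y"
    show "2 powr lower_exponent TYPE('a) - e \<le> lambda_plus Y"
      using parameters_bounded(1)[OF Y] True e by simp
    show "Y \<in> large_sublattices Y" using Y by (simp add: large_sublattices_def)
  qed
next
  case False
  define \<kappa> where "\<kappa> = lower_exponent TYPE('a)"
  have \<kappa>: "0 < \<kappa>" "\<kappa> \<le> 1" using False lower_exponent_bounds[where 'a='a] by (simp_all add: \<kappa>_def)
  obtain \<xi> where \<xi>: "0 < \<xi>" "\<xi> < \<kappa>" "2 powr \<kappa> - e \<le> 2 powr ((1 - \<xi>) * (\<kappa> - \<xi>))"
    using ex_exponent_slack[OF e \<kappa>(1), of \<kappa>] by (elim exE conjE)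
  obtain q C where q: "1 \<le> q" "\<kappa> - \<xi> < 1 / q" "0 < C" "lower_q TYPE('a) q C"
    using lower_q_below_exponent[where 'a='a, of "\<kappa> - \<xi>"] \<xi> unfolding \<kappa>_def by auto
  define \<theta> :: real where "\<theta> = 2 powr (- \<xi>)"
  have \<theta>: "0 < \<theta>" "\<theta> < 1" using \<xi> powr_less_mono[of "- \<xi>" 0 2] by (simp_all add: \<theta>_def)
  obtain N where N: "\<forall>Y::'a set. sublattice Y \<longrightarrow> N \<le> dim Y \<longrightarrow>
    (\<exists>u v. u \<in> pos_sphere Y \<and> v \<in> pos_sphere Y \<and> inf u v = 0 \<and>
      (\<forall>a\<ge>0. \<forall>b\<ge>0. \<theta> * (a powr q + b powr q) \<le> norm (a *\<^sub>R u + b *\<^sub>R v) powr q))"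
    using ex_pair_lower_estimate[OF q(4,1,3) \<theta>] ..
  show ?thesis
  proof (intro exI[of _ N] allI impI)
    fix Y :: "'a set" assume Y: "sublattice Y" "N \<le> dim Y"
    obtain u v where uv: "u \<in> pos_sphere Y" "v \<in> pos_sphere Y" "inf u v = 0"
      and est: "\<And>a b. 0 \<le> a \<Longrightarrow> 0 \<le> b \<Longrightarrow> \<theta> * (a powr q + b powr q) \<le> norm (a *\<^sub>R u + b *\<^sub>R v) powr q"
      using N[rule_format, OF Y] by (elim exE conjE) simp
    have "(2 * \<theta>) powr (1 / q) \<le> lambda_plus (span {u, v})"
      using \<theta> by (intro lambda_plus_pair_ge[OF Y(1) uv q(1) _ _ est]) auto
    moreover have "2 powr ((1 - \<xi>) * (\<kappa> - \<xi>)) \<le> (2 * \<theta>) powr (1 / q)"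
    proof -
      have "2 * \<theta> = 2 powr (1 - \<xi>)" by (simp add: \<theta>_def powr_diff powr_minus_divide)
      then have "(2 * \<theta>) powr (1 / q) = 2 powr ((1 - \<xi>) * (1 / q))" by (simp only: powr_powr)
      moreover have "(1 - \<xi>) * (\<kappa> - \<xi>) \<le> (1 - \<xi>) * (1 / q)" using q(2) \<xi> \<kappa> by (intro mult_left_mono) auto
      ultimately show ?thesis by (simp only: powr_mono)
    qed
    ultimately have "2 powr \<kappa> - e \<le> lambda_plus (span {u, v})" using \<xi>(3) by linarith
    moreover have "span {u, v} \<in> large_sublattices Y"
      using pair_span[OF Y(1) uv] by (simp only: large_sublattices_def mem_Collect_eq order.refl simp_thms)
    ultimately show "\<exists>Z\<in>large_sublattices Y. 2 powr lower_exponent TYPE('a) - e \<le> lambda_plus Z"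
      unfolding \<kappa>_def by (rule bexI)
  qed
qed

lemma alpha_upper_bound:
  assumes e: "0 < (e::real)"
  shows "\<exists>N. \<forall>Y::'a::banach_lattice set. sublattice Y \<longrightarrow> N \<le> dim Y \<longrightarrow>
    (\<exists>Z\<in>large_sublattices Y. alpha Z \<le> 2 powr upper_exponent TYPE('a) + e)"
proof -
  define \<kappa> where "\<kappa> = upper_exponent TYPE('a)"
  obtain \<xi> :: real where \<xi>: "0 < \<xi>" "2 powr ((1 + \<xi>) * (\<kappa> + \<xi>)) \<le> 2 powr \<kappa> + e"
    using ex_exponent_slack[OF e, of 1 \<kappa>] by auto
  obtain q C where q: "1 \<le> q" "1 / q < \<kappa> + \<xi>" "0 < C" "upper_q TYPE('a) q C"
    using upper_q_above_exponent[where 'a='a, of "\<kappa> + \<xi>"] \<xi> unfolding \<kappa>_def by auto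
  define \<theta> :: real where "\<theta> = 2 powr \<xi>"
  have \<theta>: "1 < \<theta>" using \<xi> powr_less_mono[of 0 \<xi> 2] by (simp add: \<theta>_def)
  obtain N where N: "\<forall>Y::'a set. sublattice Y \<longrightarrow> N \<le> dim Y \<longrightarrow>
    (\<exists>u v. u \<in> pos_sphere Y \<and> v \<in> pos_sphere Y \<and> inf u v = 0 \<and> norm (u + v) powr q \<le> 2 * \<theta>)"
    using ex_pair_upper_estimate[OF q(4,1) \<theta>] ..
  show ?thesis
  proof (intro exI[of _ N] allI impI)
    fix Y :: "'a set" assume Y: "sublattice Y" "N \<le> dim Y"
    obtain u v where uv: "u \<in> pos_sphere Y" "v \<in> pos_sphere Y" "inf u v = 0"
      and est: "norm (u + v) powr q \<le> 2 * \<theta>"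
      using N[rule_format, OF Y] by (elim exE conjE)
    have "(norm (u + v) powr q) powr (1 / q) \<le> (2 * \<theta>) powr (1 / q)"
      using est q by (intro powr_mono2) auto
    moreover have "(norm (u + v) powr q) powr (1 / q) = norm (u + v)" using q(1) by (simp add: powr_powr)
    moreover have "(2 * \<theta>) powr (1 / q) \<le> 2 powr ((1 + \<xi>) * (\<kappa> + \<xi>))"
    proof -
      have "2 * \<theta> = 2 powr (1 + \<xi>)" by (simp add: \<theta>_def powr_add)
      then have "(2 * \<theta>) powr (1 / q) = 2 powr ((1 + \<xi>) * (1 / q))" by (simp only: powr_powr)
      moreover have "(1 + \<xi>) * (1 / q) \<le> (1 + \<xi>) * (\<kappa> + \<xi>)" using q(2) \<xi> by (intro mult_left_mono) auto
      ultimately show ?thesis by (simp only: powr_mono)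
    qed
    ultimately have "alpha (span {u, v}) \<le> 2 powr \<kappa> + e"
      using \<xi>(2) alpha_pair_le[OF Y(1) uv] by linarith
    moreover have "span {u, v} \<in> large_sublattices Y"
      using pair_span[OF Y(1) uv] by (simp only: large_sublattices_def mem_Collect_eq order.refl simp_thms)
    ultimately show "\<exists>Z\<in>large_sublattices Y. alpha Z \<le> 2 powr upper_exponent TYPE('a) + e"
      unfolding \<kappa>_def by (rule bexI)
  qed
qed

lemma beta_upper_bound:
  assumes inf: "\<not> (\<exists>B::'a::banach_lattice set. finite B \<and> span B = UNIV)" and e: "0 < (e::real)" and n: "2 \<le> n"
  shows "\<exists>Y\<in>sublattices_of_dim n. \<forall>Z\<in>large_sublattices (Y :: 'a set). beta Z \<le> 2 powr lower_exponent TYPE('a) + e"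
proof -
  have n1: "1 \<le> n" using n by simp
  obtain v :: "nat \<Rightarrow> 'a" where v: "disjoint_pos {..<n} v" "\<forall>j<n. v j \<noteq> 0"
    and power: "\<And>b b'. (\<forall>j<n. 0 \<le> b j \<and> 0 \<le> b' j \<and> (b j = 0 \<or> b' j = 0)) \<Longrightarrow>
      norm (\<Sum>j<n. b j *\<^sub>R v j) = 1 \<Longrightarrow> norm (\<Sum>j<n. b' j *\<^sub>R v j) = 1 \<Longrightarrow>
      \<bar>norm (\<Sum>j<n. (b j + b' j) *\<^sub>R v j) - 2 powr lower_exponent TYPE('a)\<bar> \<le> e"
    using ex_power_family[OF lower_exponent_bounds lower_exponent_families[OF inf] n1 e] by (elim exE conjE) simp
  note y = power_family_sublattice[OF v power]
  show ?thesis
    using y by (intro bexI[of _ "span (v ` {..<n})"]) (simp_all add: sublattices_of_dim_def large_sublattices_def)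
qed

lemma alpha_lower_bound:
  assumes inf: "\<not> (\<exists>B::'a::banach_lattice set. finite B \<and> span B = UNIV)" and e: "0 < (e::real)" and n: "2 \<le> n"
  shows "\<exists>Y\<in>sublattices_of_dim n. \<forall>Z\<in>large_sublattices (Y :: 'a set). 2 powr upper_exponent TYPE('a) - e \<le> alpha Z"
proof -
  have n1: "1 \<le> n" using n by simp
  obtain v :: "nat \<Rightarrow> 'a" where v: "disjoint_pos {..<n} v" "\<forall>j<n. v j \<noteq> 0"
    and power: "\<And>b b'. (\<forall>j<n. 0 \<le> b j \<and> 0 \<le> b' j \<and> (b j = 0 \<or> b' j = 0)) \<Longrightarrow>
      norm (\<Sum>j<n. b j *\<^sub>R v j) = 1 \<Longrightarrow> norm (\<Sum>j<n. b' j *\<^sub>R v j) = 1 \<Longrightarrow>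
      \<bar>norm (\<Sum>j<n. (b j + b' j) *\<^sub>R v j) - 2 powr upper_exponent TYPE('a)\<bar> \<le> e"
    using ex_power_family[OF upper_exponent_bounds upper_exponent_families[OF inf] n1 e] by (elim exE conjE) simp
  note y = power_family_sublattice[OF v power]
  show ?thesis
    using y by (intro bexI[of _ "span (v ` {..<n})"]) (simp_all add: sublattices_of_dim_def large_sublattices_def)
qed

theorem proposition5p3:
  assumes infinite_dim: "\<not> (\<exists>B::'a::banach_lattice set. finite B \<and> span B = UNIV)"
  shows "(\<lambda>n. INF Y\<in>{Y::'a set. sublattice Y \<and> dim Y = n}.
              SUP Z\<in>{Z. sublattice Z \<and> Z \<subseteq> Y \<and> dim Z \<ge> 2}. lambda_plus Z)
           \<longlonglongrightarrow> 2 powr real_of_ereal (1 / lower_index (UNIV :: 'a set))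
       \<and> (\<lambda>n. INF Y\<in>{Y::'a set. sublattice Y \<and> dim Y = n}.
              SUP Z\<in>{Z. sublattice Z \<and> Z \<subseteq> Y \<and> dim Z \<ge> 2}. beta Z)
           \<longlonglongrightarrow> 2 powr real_of_ereal (1 / lower_index (UNIV :: 'a set))
       \<and> (\<lambda>n. SUP Y\<in>{Y::'a set. sublattice Y \<and> dim Y = n}.
              INF Z\<in>{Z. sublattice Z \<and> Z \<subseteq> Y \<and> dim Z \<ge> 2}. alpha Z)
           \<longlonglongrightarrow> 2 powr real_of_ereal (1 / upper_index (UNIV :: 'a set))"
proof (fold sublattices_of_dim_def large_sublattices_def lower_exponent_def[of "TYPE('a)"] upper_exponent_def[of "TYPE('a)"], intro conjI)
  have large: "sublattice Z \<and> 2 \<le> dim Z" if "Z \<in> large_sublattices Y" for Y Z :: "'a set"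
    using that by (simp add: large_sublattices_def)
  let ?l = "2 powr lower_exponent TYPE('a)"
  have beta_low: "\<exists>N. \<forall>Y::'a set. sublattice Y \<longrightarrow> N \<le> dim Y \<longrightarrow> (\<exists>Z\<in>large_sublattices Y. ?l - e \<le> beta Z)"
    if "0 < e" for e
    using lambda_plus_lower_bound[where 'a='a, OF that] lambda_plus_le_beta large by (meson order_trans)
  have lambda_upp: "\<exists>Y\<in>sublattices_of_dim n. \<forall>Z\<in>large_sublattices (Y :: 'a set). lambda_plus Z \<le> ?l + e"
    if "0 < e" "2 \<le> n" for e n
    using beta_upper_bound[OF infinite_dim that] lambda_plus_le_beta large by (meson order_trans)
  show "(\<lambda>n. INF Y\<in>(sublattices_of_dim n :: 'a set set). SUP Z\<in>large_sublattices Y. lambda_plus Z) \<longlonglongrightarrow> ?l"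
    using infinite_dim parameters_bounded(1) lambda_plus_lower_bound lambda_upp by (rule inf_sup_limit)
  show "(\<lambda>n. INF Y\<in>(sublattices_of_dim n :: 'a set set). SUP Z\<in>large_sublattices Y. beta Z) \<longlonglongrightarrow> ?l"
    using infinite_dim parameters_bounded(2) beta_low beta_upper_bound[OF infinite_dim] by (rule inf_sup_limit)
  show "(\<lambda>n. SUP Y\<in>(sublattices_of_dim n :: 'a set set). INF Z\<in>large_sublattices Y. alpha Z) \<longlonglongrightarrow> 2 powr upper_exponent TYPE('a)"
    using infinite_dim parameters_bounded(3) alpha_upper_bound alpha_lower_bound[OF infinite_dim] by (rule sup_inf_limit)
qed

end
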